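(* Let $u \in H^\infty(\mathbb{D})$ be a nonconstant inner function, and let $\varphi \in L^\infty(\mathbb{T})$. Then the following are equivalent: (1) $u H^2$ reduces $H_\varphi$. (2) $u H^2 \subseteq \ker H_\varphi \cap \ker H^*_\varphi$. (3) $P_+\varphi\in \big(\gcd \{u, \overline{Ju}\} H^2\big)^\perp$.
   Context: $\mathbb{T}$ is the unit circle and $\mathbb{D}$ the open unit disc. $H^2\subseteq L^2(\mathbb{T})$ is the Hardy space (functions whose negative Fourier coefficients vanish), $P_+$ is the orthogonal projection of $L^2(\mathbb{T})$ onto $H^2$, and $J:L^2(\mathbb{T})\to L^2(\mathbb{T})$ is the unitary $(Jf)(z)=f(\bar z)$. For $\varphi\in L^\infty(\mathbb{T})$, the Hankel operator $H_\varphi$ on $H^2$ is $H_\varphi f=P_+(\varphi\, Jf)$. $H^\infty(\mathbb{D})$ is the algebra of bounded analytic functions on $\mathbb{D}$; $u\in H^\infty(\mathbb{D})$ is inner if its radial limits satisfy $|u|=1$ a.e. on $\mathbb{T}$. For $u=\sum_{n\ge 0}a_nz^n$ one has $\overline{Ju}=\sum_{n\ge0}\bar a_nz^n$, which is inner when $u$ is inner. A closed subspace reduces an operator if it is invariant under both the operator and its adjoint. An inner function $u$ divides an inner function $v$ if $v=wu$ for some $w\in H^\infty(\mathbb{D})$; $\gcd\{u_1,u_2\}$ is an inner function dividing both $u_1$ and $u_2$ and divisible by every inner function dividing both (unique up to a unimodular constant). The orthogonal complement $\perp$ is taken in $H^2$. *)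

theory Defs
  imports "HOL-Complex_Analysis.Complex_Analysis"
begin

text \<open>
  Elements of \<open>L\<^sup>2(\<T>)\<close> and \<open>L\<^sup>\<infinity>(\<T>)\<close> are represented by functions on the complex plane, of which
  only the values on the unit circle matter. Functions that agree almost everywhere are
  not identified. Instead, the subspaces of \<open>L\<^sup>2(\<T>)\<close> below are closed under almost everywhere
  equality, and the operators are determined only up to almost everywhere equality. In contrast,
  elements of \<open>H\<^sup>\<infinity>(\<D>)\<close> are represented by functions of which only the values on the open unit
  disc matter.
\<close>

definition circle :: "complex measure" where
  "circle = distr (uniform_measure lborel {0..2 * pi}) (restrict_space borel (sphere 0 1)) cis"

definition L2 :: "(complex \<Rightarrow> complex) set" where
  "L2 = {f \<in> borel_measurable circle. integrable circle (\<lambda>z. (norm (f z))\<^sup>2)}"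

definition Linf :: "(complex \<Rightarrow> complex) set" where
  "Linf = {f \<in> borel_measurable circle. \<exists>C. AE z in circle. norm (f z) \<le> C}"

definition l2_inner :: "(complex \<Rightarrow> complex) \<Rightarrow> (complex \<Rightarrow> complex) \<Rightarrow> complex" where
  "l2_inner f g = (LINT z|circle. f z * cnj (g z))"

definition l2_norm :: "(complex \<Rightarrow> complex) \<Rightarrow> real" where
  "l2_norm f = sqrt (LINT z|circle. (norm (f z))\<^sup>2)"

definition fourier_coeff :: "(complex \<Rightarrow> complex) \<Rightarrow> int \<Rightarrow> complex" where
  "fourier_coeff f n = l2_inner f (\<lambda>z. z powi n)"

definition H2 :: "(complex \<Rightarrow> complex) set" where
  "H2 = {f \<in> L2. \<forall>n<0. fourier_coeff f n = 0}"

definition closed_subspace :: "(complex \<Rightarrow> complex) set \<Rightarrow> bool" where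
  "closed_subspace M \<longleftrightarrow>
     M \<subseteq> L2 \<and> (\<lambda>z. 0) \<in> M \<and>
     (\<forall>f\<in>M. \<forall>g\<in>M. (\<lambda>z. f z + g z) \<in> M) \<and>
     (\<forall>c. \<forall>f\<in>M. (\<lambda>z. c * f z) \<in> M) \<and>
     (\<forall>F. \<forall>f\<in>L2. (\<forall>n. F n \<in> M) \<longrightarrow> (\<lambda>n. l2_norm (\<lambda>z. F n z - f z)) \<longlonglongrightarrow> 0 \<longrightarrow> f \<in> M)"

definition H2_perp :: "(complex \<Rightarrow> complex) set \<Rightarrow> (complex \<Rightarrow> complex) set" where
  "H2_perp M = {f \<in> H2. \<forall>g\<in>M. l2_inner f g = 0}"

definition orth_proj ::
  "(complex \<Rightarrow> complex) set \<Rightarrow> (complex \<Rightarrow> complex) \<Rightarrow> complex \<Rightarrow> complex" where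
  "orth_proj M f = (SOME g. g \<in> M \<and> (\<forall>h\<in>M. l2_inner (\<lambda>z. f z - g z) h = 0))"

abbreviation P_plus :: "(complex \<Rightarrow> complex) \<Rightarrow> complex \<Rightarrow> complex" where
  "P_plus \<equiv> orth_proj H2"

definition flip :: "(complex \<Rightarrow> complex) \<Rightarrow> complex \<Rightarrow> complex" where
  "flip f z = f (cnj z)"

definition hankel :: "(complex \<Rightarrow> complex) \<Rightarrow> (complex \<Rightarrow> complex) \<Rightarrow> complex \<Rightarrow> complex" where
  "hankel \<phi> f = P_plus (\<lambda>z. \<phi> z * flip f z)"

definition H2_adjoint ::
  "((complex \<Rightarrow> complex) \<Rightarrow> complex \<Rightarrow> complex) \<Rightarrow> (complex \<Rightarrow> complex) \<Rightarrow> complex \<Rightarrow> complex" where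
  "H2_adjoint T g = (SOME k. k \<in> H2 \<and> (\<forall>f\<in>H2. l2_inner (T f) g = l2_inner f k))"

definition H2_ker :: "((complex \<Rightarrow> complex) \<Rightarrow> complex \<Rightarrow> complex) \<Rightarrow> (complex \<Rightarrow> complex) set" where
  "H2_ker T = {f \<in> H2. AE z in circle. T f z = 0}"

definition reduces ::
  "(complex \<Rightarrow> complex) set \<Rightarrow> ((complex \<Rightarrow> complex) \<Rightarrow> complex \<Rightarrow> complex) \<Rightarrow> bool" where
  "reduces M T \<longleftrightarrow>
     closed_subspace M \<and> M \<subseteq> H2 \<and> (\<forall>f\<in>M. T f \<in> M) \<and> (\<forall>f\<in>M. H2_adjoint T f \<in> M)"

definition Hinf :: "(complex \<Rightarrow> complex) set" where
  "Hinf = {f. f holomorphic_on ball 0 1 \<and> bounded (f ` ball 0 1)}"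

definition inner_function :: "(complex \<Rightarrow> complex) \<Rightarrow> bool" where
  "inner_function u \<longleftrightarrow> u \<in> Hinf \<and>
     (AE z in circle. \<exists>l. ((\<lambda>r. u (of_real r * z)) \<longlongrightarrow> l) (at_left 1) \<and> norm l = 1)"

definition boundary_value :: "(complex \<Rightarrow> complex) \<Rightarrow> complex \<Rightarrow> complex" where
  "boundary_value u z = Lim (at_left 1) (\<lambda>r. u (of_real r * z))"

definition times_H2 :: "(complex \<Rightarrow> complex) \<Rightarrow> (complex \<Rightarrow> complex) set" where
  "times_H2 u = {f \<in> L2. \<exists>h\<in>H2. AE z in circle. f z = boundary_value u z * h z}"

definition inner_dvd :: "(complex \<Rightarrow> complex) \<Rightarrow> (complex \<Rightarrow> complex) \<Rightarrow> bool" where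
  "inner_dvd u v \<longleftrightarrow> (\<exists>w\<in>Hinf. \<forall>z\<in>ball 0 1. v z = w z * u z)"

definition is_inner_gcd ::
  "(complex \<Rightarrow> complex) \<Rightarrow> (complex \<Rightarrow> complex) \<Rightarrow> (complex \<Rightarrow> complex) \<Rightarrow> bool" where
  "is_inner_gcd d u v \<longleftrightarrow>
     inner_function d \<and> inner_dvd d u \<and> inner_dvd d v \<and>
     (\<forall>e. inner_function e \<longrightarrow> inner_dvd e u \<longrightarrow> inner_dvd e v \<longrightarrow> inner_dvd e d)"

text \<open>
  The greatest common divisor is unique on the disc only up to a unimodular constant; the choice does not affect \<open>times_H2\<close>.
\<close>

definition inner_gcd ::
  "(complex \<Rightarrow> complex) \<Rightarrow> (complex \<Rightarrow> complex) \<Rightarrow> complex \<Rightarrow> complex" where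
  "inner_gcd u v = (SOME d. is_inner_gcd d u v)"

text \<open>
  For \<open>u(z) = \<Sum> a\<^sub>n z\<^sup>n\<close> on the disc this is the function with Taylor coefficients
  \<open>cnj a\<^sub>n\<close>.
\<close>

definition cnj_flip :: "(complex \<Rightarrow> complex) \<Rightarrow> complex \<Rightarrow> complex" where
  "cnj_flip u z = cnj (flip u z)"

end

theory Submission
  imports Defs
begin

text \<open>
  Write \<open>H\<close> for the Hankel operator with symbol \<open>\<phi>\<close>, \<open>U\<close> for the boundary function of \<open>u\<close>,
  \<open>J\<close> for \<open>flip\<close> and \<open>f\<^sup>#\<close> for \<open>cnj_flip f\<close>, that is, the complex conjugate of \<open>J f\<close>.

  \<^bold>\<open>Reducing means vanishing.\<close> The \<open>k\<close>-th Fourier coefficient of \<open>H (z\<^sup>n f)\<close>, for \<open>k \<ge> 0\<close>, is the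
  \<open>(k + n)\<close>-th coefficient of \<open>H f\<close>. Hence \<open>H (z\<^sup>n f) - z H (z\<^sup>n\<^sup>+\<^sup>1 f)\<close> is a constant function,
  and the constant is the \<open>n\<close>-th coefficient of \<open>H f\<close>. If \<open>H\<close> maps \<open>u H\<^sup>2\<close> into itself and \<open>f\<close> lies
  in \<open>u H\<^sup>2\<close>, then this constant function lies in \<open>u H\<^sup>2\<close> as well. But \<open>c = U h\<close> with \<open>c \<noteq> 0\<close> makes
  the complex conjugate of \<open>U\<close> a multiple of \<open>h \<in> H\<^sup>2\<close>, and then \<open>u\<close> is constant. So all coefficients of
  \<open>H f\<close> vanish (\<open>hankel_invariant_imp_kernel\<close>). The adjoint of \<open>H\<close> is the Hankel operator with symbol
  \<open>\<phi>\<^sup>#\<close>, so the same argument applies to it.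

  \<^bold>\<open>Vanishing means orthogonality.\<close> The \<open>n\<close>-th Fourier coefficient of \<open>\<phi> J f\<close> is the inner product
  of \<open>\<phi>\<close> with \<open>z\<^sup>n f\<^sup>#\<close>. Therefore \<open>H\<close> vanishes on \<open>u H\<^sup>2\<close> if and only if \<open>\<phi>\<close> is orthogonal to
  \<open>u\<^sup># H\<^sup>2\<close> (\<open>hankel_kernel_iff_perp\<close>), and the adjoint vanishes there if and only if \<open>\<phi>\<close> is
  orthogonal to \<open>u H\<^sup>2\<close>.

  \<^bold>\<open>Two ranges and one greatest common divisor.\<close> It remains to see that orthogonality to \<open>u H\<^sup>2\<close>
  and to \<open>v H\<^sup>2\<close> amounts to orthogonality to \<open>d H\<^sup>2\<close>, where \<open>d\<close> is a greatest common divisor of \<open>u\<close> and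
  \<open>v\<close> (\<open>H2_perp_inner_gcd\<close>). The double orthogonal complement \<open>M\<close> of the two ranges is invariant under
  multiplication by \<open>z\<close>. The argument of Beurling yields a unimodular \<open>E \<in> M\<close> with \<open>M \<subseteq> E H\<^sup>2\<close>, and
  the inner function with boundary function \<open>E\<close> is a greatest common divisor: it divides \<open>u\<close> and \<open>v\<close>
  because their boundary functions lie in \<open>M \<subseteq> E H\<^sup>2\<close>, and every common divisor \<open>c\<close> divides it because \<open>E \<in> M \<subseteq> c H\<^sup>2\<close>.

  Inner functions live on the disc and are characterised by radial limits, so one has to know that a
  unimodular \<open>E \<in> H\<^sup>2\<close> is the radial limit of a bounded analytic function. This is the theorem of Fatou
  (\<open>Fatou_radial\<close>), proved by convergence of Poisson integrals at Lebesgue points. It also shows that an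
  integrable function is determined by its Fourier coefficients (\<open>fourier_uniqueness\<close>). The Hilbert
  space facts behind the rest are \<open>L2_complete\<close> and \<open>orthogonal_projection_exists\<close>.
\<close>

section \<open>The uniform measure on the circle\<close>

lemma space_circle [simp]: "space circle = sphere 0 1"
  by (simp add: circle_def)

lemma sets_circle [measurable_cong]: "sets circle = sets (restrict_space borel (sphere 0 1))"
  by (simp add: circle_def)

lemma measurable_cis [measurable]: "cis \<in> borel_measurable borel"
  by (intro borel_measurable_continuous_onI continuous_intros)

lemma measurable_cis_sphere [measurable]:
  "cis \<in> uniform_measure lborel {0..2 * pi} \<rightarrow>\<^sub>M restrict_space borel (sphere 0 1)"
  by (intro measurable_restrict_space2) auto

lemma measure_circle_sphere [simp]: "measure circle (sphere 0 1) = 1"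
proof -
  have "emeasure circle (sphere 0 1) = emeasure (uniform_measure lborel {0..2 * pi}) UNIV"
    unfolding circle_def
  proof (subst emeasure_distr)
    show "sphere 0 1 \<in> sets (restrict_space borel (sphere (0::complex) 1))"
      by (subst sets_restrict_space_iff) auto
    have "cis -` sphere 0 1 = UNIV" by auto
    thus "emeasure (uniform_measure lborel {0..2 * pi}) (cis -` sphere 0 1 \<inter> space (uniform_measure lborel {0..2 * pi})) =
       emeasure (uniform_measure lborel {0..2 * pi}) UNIV" by simp
  qed simp
  also have "\<dots> = 1"
    by (subst emeasure_uniform_measure) (auto intro!: ennreal_divide_self)
  finally show ?thesis by (simp add: measure_def)
qed

interpretation circle: finite_measure circle
  by (rule finite_measureI) (metis measure_circle_sphere measure_def space_circle enn2real_top
        infinity_ennreal_def zero_neq_one)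

lemma borel_measurable_circleI:
  "f \<in> borel_measurable borel \<Longrightarrow> f \<in> borel_measurable circle"
  unfolding measurable_cong_sets[OF sets_circle refl] by (rule measurable_restrict_space1)

lemma borel_measurable_circle_continuous:
  "continuous_on (sphere 0 1) f \<Longrightarrow> f \<in> borel_measurable circle"
  unfolding measurable_cong_sets[OF sets_circle refl] by (rule borel_measurable_continuous_on_restrict)

lemma measurable_cis_circle [measurable]: "cis \<in> borel \<rightarrow>\<^sub>M circle"
  unfolding measurable_cong_sets[OF refl sets_circle]
  by (intro measurable_restrict_space2) auto

lemma measurable_powi_circle [measurable]: "(\<lambda>z. z powi n) \<in> borel_measurable circle"
  by (intro borel_measurable_circle_continuous continuous_intros) auto

lemma measurable_cnj_circle: "cnj \<in> circle \<rightarrow>\<^sub>M circle"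
  unfolding measurable_cong_sets[OF sets_circle sets_circle]
  by (intro measurable_restrict_space3 borel_measurable_continuous_onI continuous_intros) auto

lemma borel_measurable_cnj [measurable]: "cnj \<in> borel_measurable borel"
  by (intro borel_measurable_continuous_onI continuous_intros)

lemma borel_measurable_circle_cnj [measurable]:
  "f \<in> borel_measurable circle \<Longrightarrow> (\<lambda>z. f (cnj z)) \<in> borel_measurable circle"
  by (rule measurable_compose[OF measurable_cnj_circle])

lemma measurable_comp_cis:
  "f \<in> borel_measurable circle \<Longrightarrow> (\<lambda>t. f (cis t)) \<in> borel_measurable borel"
  by (rule measurable_compose[OF measurable_cis_circle])

lemma uniform_measure_eq_density:
  "uniform_measure lborel {0..2*pi} = density lborel (\<lambda>t. ennreal (indicator {0..2*pi} t / (2*pi)))"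
  unfolding uniform_measure_def
  by (intro density_cong)
     (auto simp: indicator_def divide_ennreal[symmetric] ennreal_1[symmetric] simp del: ennreal_1)

lemma integral_circle:
  fixes f :: "complex \<Rightarrow> complex"
  assumes [measurable]: "f \<in> borel_measurable circle"
  shows "(LINT z|circle. f z) = (LINT t:{0..2*pi}|lborel. f (cis t)) / (2 * pi)"
proof -
  have m: "(\<lambda>t. f (cis t)) \<in> borel_measurable borel" by (rule measurable_comp_cis) fact
  have "(LINT z|circle. f z) = (LINT t|uniform_measure lborel {0..2*pi}. f (cis t))"
    unfolding circle_def
    by (subst integral_distr) (use assms in \<open>auto simp: measurable_cong_sets[OF sets_circle refl, symmetric]\<close>)
  also have "\<dots> = (LINT t|lborel. (indicator {0..2*pi} t / (2*pi)) *\<^sub>R f (cis t))"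
    unfolding uniform_measure_eq_density by (subst integral_density) (use m in auto)
  also have "\<dots> = (LINT t:{0..2*pi}|lborel. f (cis t)) / (2 * pi)"
    unfolding set_lebesgue_integral_def
    by (subst integral_divide_zero [symmetric], rule Bochner_Integration.integral_cong)
       (auto simp: scaleR_conv_of_real)
  finally show ?thesis .
qed

lemma distr_uniform_reflect:
  "distr (uniform_measure lborel {0..2*pi}) borel (\<lambda>t. 2*pi - t) = uniform_measure lborel {0..2*pi}"
proof (rule measure_eqI)
  fix A :: "real set" assume "A \<in> sets (distr (uniform_measure lborel {0..2*pi}) borel (\<lambda>t. 2*pi - t))"
  hence [measurable]: "A \<in> sets borel" by simp
  let ?r = "\<lambda>t. 2*pi - t"
  have r[measurable]: "?r \<in> borel_measurable borel" by measurable
  have refl: "emeasure lborel (?r -` B) = emeasure lborel B" if [measurable]: "B \<in> sets borel" for B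
  proof -
    have "emeasure lborel B = emeasure (density (distr lborel borel (\<lambda>x. 2*pi + (-1) * x)) (\<lambda>_. ennreal \<bar>-1\<bar>)) B"
      by (subst lborel_real_affine[of "-1" "2*pi"]) auto
    also have "\<dots> = emeasure (distr lborel borel (\<lambda>x. 2*pi + (-1) * x)) B"
      by (simp add: density_1)
    also have "\<dots> = emeasure lborel (?r -` B)"
      by (subst emeasure_distr) auto
    finally show ?thesis by simp
  qed
  have "emeasure (distr (uniform_measure lborel {0..2*pi}) borel ?r) A
        = emeasure (uniform_measure lborel {0..2*pi}) (?r -` A)"
    by (subst emeasure_distr) auto
  also have "\<dots> = emeasure lborel ({0..2*pi} \<inter> ?r -` A) / emeasure lborel {0..2*pi}"
    by (rule emeasure_uniform_measure) (use measurable_sets[OF r, of A] in auto)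
  also have "{0..2*pi} \<inter> ?r -` A = ?r -` ({0..2*pi} \<inter> A)" by auto
  also have "emeasure lborel \<dots> = emeasure lborel ({0..2*pi} \<inter> A)" by (rule refl) auto
  also have "\<dots> / emeasure lborel {0..2*pi} = emeasure (uniform_measure lborel {0..2*pi}) A"
    by (rule emeasure_uniform_measure [symmetric]) auto
  finally show "emeasure (distr (uniform_measure lborel {0..2*pi}) borel ?r) A
     = emeasure (uniform_measure lborel {0..2*pi}) A" .
qed simp

text \<open>
  In terms of the angle \<open>t\<close>, conjugation is \<open>t \<mapsto> 2\<pi> - t\<close>, which preserves the uniform measure. This makes
  \<open>flip\<close> and \<open>cnj_flip\<close> isometries of \<open>L\<^sup>2\<close>.
\<close>

lemma distr_circle_cnj: "distr circle circle cnj = circle"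
proof -
  let ?U = "uniform_measure lborel {0..2*pi}" and ?S = "restrict_space borel (sphere 0 (1::real)) :: complex measure"
  have c: "cis \<in> borel \<rightarrow>\<^sub>M ?S" by (intro measurable_restrict_space2) auto
  have "distr circle circle cnj = distr circle ?S cnj"
    by (rule distr_cong) (simp_all add: sets_circle)
  also have "\<dots> = distr ?U ?S (cnj \<circ> cis)"
    unfolding circle_def 
    by (rule distr_distr) (use measurable_cnj_circle in \<open>auto simp: measurable_cong_sets[OF sets_circle sets_circle]\<close>)
  also have "cnj \<circ> cis = cis \<circ> (\<lambda>t. 2*pi - t)"
    by (simp add: fun_eq_iff complex_eq_iff cos_diff sin_diff)
  also have "distr ?U ?S \<dots> = distr (distr ?U borel (\<lambda>t. 2*pi - t)) ?S cis"
    by (rule distr_distr [symmetric]) (auto intro: c)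
  also have "\<dots> = circle"
    by (simp only: distr_uniform_reflect circle_def)
  finally show ?thesis .
qed

lemma integral_circle_cnj:
  fixes f :: "complex \<Rightarrow> complex"
  assumes "f \<in> borel_measurable circle"
  shows "(LINT z|circle. f (cnj z)) = (LINT z|circle. f z)"
  by (subst (2) distr_circle_cnj [symmetric], subst integral_distr) (use assms measurable_cnj_circle in auto)

lemma integrable_circle_cnj:
  fixes f :: "complex \<Rightarrow> 'a::{banach, second_countable_topology}"
  assumes "integrable circle f"
  shows "integrable circle (\<lambda>z. f (cnj z))"
proof -
  have "integrable (distr circle circle cnj) f" using assms by (simp add: distr_circle_cnj)
  thus ?thesis by (rule integrable_distr[OF measurable_cnj_circle])
qed

lemma AE_circle_cnj:
  assumes "AE z in circle. P z"
  shows "AE z in circle. P (cnj z)"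
proof -
  have "AE z in distr circle circle cnj. P z" using assms by (simp only: distr_circle_cnj)
  thus ?thesis by (rule AE_distrD[OF measurable_cnj_circle])
qed

lemma AE_circle_norm: "AE z in circle. norm z = 1"
  by (rule AE_I2) simp

section \<open>The space L2 and its inner product\<close>

lemma L2_measurable [measurable_dest]: "f \<in> L2 \<Longrightarrow> f \<in> borel_measurable circle"
  by (simp add: L2_def)

lemma L2_square_integrable: "f \<in> L2 \<Longrightarrow> integrable circle (\<lambda>z. (norm (f z))\<^sup>2)"
  by (simp add: L2_def)

lemma L2_mult_integrable:
  assumes f: "f \<in> L2" and g: "g \<in> L2"
  shows "integrable circle (\<lambda>z. f z * g z)"
proof (rule Bochner_Integration.integrable_bound)
  show "integrable circle (\<lambda>z. (norm (f z))\<^sup>2 + (norm (g z))\<^sup>2)"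
    using f g by (simp add: L2_def)
  show "(\<lambda>z. f z * g z) \<in> borel_measurable circle" using f g by measurable
  have "norm (f z * g z) \<le> (norm (f z))\<^sup>2 + (norm (g z))\<^sup>2" for z
  proof -
    have "2 * (norm (f z) * norm (g z)) \<le> (norm (f z))\<^sup>2 + (norm (g z))\<^sup>2"
      using sum_squares_bound[of "norm (f z)" "norm (g z)"] by (simp add: mult.assoc)
    moreover have "0 \<le> norm (f z) * norm (g z)" by simp
    ultimately show ?thesis unfolding norm_mult by linarith
  qed
  thus "AE z in circle. norm (f z * g z) \<le> norm ((norm (f z))\<^sup>2 + (norm (g z))\<^sup>2)" by simp
qed

lemma L2_cnj: "f \<in> L2 \<Longrightarrow> (\<lambda>z. cnj (f z)) \<in> L2"
  by (auto simp: L2_def)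

lemma L2_mult_cnj_integrable:
  "f \<in> L2 \<Longrightarrow> g \<in> L2 \<Longrightarrow> integrable circle (\<lambda>z. f z * cnj (g z))"
  by (rule L2_mult_integrable[OF _ L2_cnj])

lemma L2_bounded_mult:
  assumes [measurable]: "f \<in> L2" "b \<in> borel_measurable circle" and b: "AE z in circle. norm (b z) \<le> C"
  shows "(\<lambda>z. b z * f z) \<in> L2"
  unfolding L2_def
proof (intro CollectI conjI)
  show "(\<lambda>z. b z * f z) \<in> borel_measurable circle" by measurable
  show "integrable circle (\<lambda>z. (norm (b z * f z))\<^sup>2)"
  proof (rule Bochner_Integration.integrable_bound)
    show "integrable circle (\<lambda>z. C\<^sup>2 * (norm (f z))\<^sup>2)"
      using assms(1) by (simp add: L2_def)
    show "AE z in circle. norm ((norm (b z * f z))\<^sup>2) \<le> norm (C\<^sup>2 * (norm (f z))\<^sup>2)"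
      using b
    proof eventually_elim
      case (elim z)
      have "(norm (b z))\<^sup>2 \<le> C\<^sup>2" by (rule power_mono[OF elim]) simp
      thus ?case by (simp add: norm_mult power_mult_distrib mult_right_mono)
    qed
  qed measurable
qed

lemma L2_const [simp]: "(\<lambda>z. c) \<in> L2"
  by (simp add: L2_def)

lemma L2_bounded:
  assumes "f \<in> borel_measurable circle" and "AE z in circle. norm (f z) \<le> C"
  shows "f \<in> L2"
  using L2_bounded_mult[of "\<lambda>z. 1" f C] assms by simp

lemma L2_powi [simp]: "(\<lambda>z. z powi n) \<in> L2"
  by (rule L2_bounded[of _ 1]) (auto simp: norm_power_int)

lemma L2_integrable: "f \<in> L2 \<Longrightarrow> integrable circle f"
  using L2_mult_integrable[of f "\<lambda>z. 1"] by simp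

lemma L2_cmult: "f \<in> L2 \<Longrightarrow> (\<lambda>z. c * f z) \<in> L2"
  by (rule L2_bounded_mult[of f "\<lambda>z. c" "norm c"]) auto

lemma L2_add:
  assumes "f \<in> L2" "g \<in> L2"
  shows "(\<lambda>z. f z + g z) \<in> L2"
proof -
  have "integrable circle (\<lambda>z. (norm (f z))\<^sup>2 + (norm (g z))\<^sup>2 + 2 * Re (f z * cnj (g z)))"
    by (intro Bochner_Integration.integrable_add integrable_mult_right integrable_Re
          L2_square_integrable L2_mult_cnj_integrable assms)
  also have "(\<lambda>z. (norm (f z))\<^sup>2 + (norm (g z))\<^sup>2 + 2 * Re (f z * cnj (g z))) = (\<lambda>z. (norm (f z + g z))\<^sup>2)"
    by (simp add: fun_eq_iff cmod_power2) (simp add: power2_eq_square algebra_simps)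
  finally show ?thesis using assms by (auto simp: L2_def)
qed

lemma L2_diff:
  assumes "f \<in> L2" "g \<in> L2"
  shows "(\<lambda>z. f z - g z) \<in> L2"
  using L2_add[OF assms(1) L2_cmult[OF assms(2), of "-1"]] by simp

lemma L2_cong_AE:
  assumes "f \<in> L2" and [measurable]: "g \<in> borel_measurable circle" and "AE z in circle. g z = f z"
  shows "g \<in> L2"
proof -
  have [measurable]: "f \<in> borel_measurable circle" using assms(1) by (rule L2_measurable)
  have "integrable circle (\<lambda>z. (norm (g z))\<^sup>2) = integrable circle (\<lambda>z. (norm (f z))\<^sup>2)"
    by (rule integrable_cong_AE) (use assms(3) in \<open>auto elim: eventually_mono\<close>)
  thus ?thesis using assms by (simp add: L2_def)
qed

lemma L2_flip: "f \<in> L2 \<Longrightarrow> flip f \<in> L2"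
  unfolding L2_def flip_def[abs_def]
  by (auto intro: integrable_circle_cnj[of "\<lambda>z. (norm (f z))\<^sup>2"])

lemma l2_inner_add_left:
  "f \<in> L2 \<Longrightarrow> g \<in> L2 \<Longrightarrow> h \<in> L2 \<Longrightarrow> l2_inner (\<lambda>z. f z + g z) h = l2_inner f h + l2_inner g h"
  by (simp add: l2_inner_def distrib_right L2_mult_cnj_integrable)

lemma l2_inner_diff_left:
  "f \<in> L2 \<Longrightarrow> g \<in> L2 \<Longrightarrow> h \<in> L2 \<Longrightarrow> l2_inner (\<lambda>z. f z - g z) h = l2_inner f h - l2_inner g h"
  by (simp add: l2_inner_def left_diff_distrib L2_mult_cnj_integrable)

lemma l2_inner_cmult_left: "l2_inner (\<lambda>z. c * f z) h = c * l2_inner f h"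
  by (simp add: l2_inner_def mult.assoc)

lemma l2_inner_commute: "l2_inner g f = cnj (l2_inner f g)"
  proof -
  have "cnj (l2_inner f g) = (LINT z|circle. cnj (f z * cnj (g z)))"
    unfolding l2_inner_def using Bochner_Integration.integral_cnj by metis
  thus ?thesis by (simp add: l2_inner_def mult.commute)
qed

lemma l2_inner_diff_right:
  "f \<in> L2 \<Longrightarrow> g \<in> L2 \<Longrightarrow> h \<in> L2 \<Longrightarrow> l2_inner h (\<lambda>z. f z - g z) = l2_inner h f - l2_inner h g"
  by (simp add: l2_inner_commute[of h] l2_inner_diff_left)

lemma l2_inner_cmult_right: "l2_inner h (\<lambda>z. c * f z) = cnj c * l2_inner h f"
  by (simp add: l2_inner_commute[of h] l2_inner_cmult_left)

lemma l2_inner_cong_AE: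
  assumes "AE z in circle. f z = f' z" "AE z in circle. g z = g' z"
    and [measurable]: "f \<in> borel_measurable circle" "f' \<in> borel_measurable circle"
      "g \<in> borel_measurable circle" "g' \<in> borel_measurable circle"
  shows "l2_inner f g = l2_inner f' g'"
  unfolding l2_inner_def
proof (rule integral_cong_AE)
  show "AE z in circle. f z * cnj (g z) = f' z * cnj (g' z)"
    using assms(1,2) by eventually_elim simp
qed measurable

lemma l2_norm_nonneg [simp]: "0 \<le> l2_norm f"
  by (simp add: l2_norm_def)

lemma l2_norm_square: "(l2_norm f)\<^sup>2 = (LINT z|circle. (norm (f z))\<^sup>2)"
  by (simp add: l2_norm_def)

lemma l2_inner_self: "l2_inner f f = complex_of_real ((l2_norm f)\<^sup>2)"
  unfolding l2_norm_square l2_inner_def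
  by (subst integral_complex_of_real [symmetric]) (simp only: complex_norm_square)

lemma l2_norm_cmult: "l2_norm (\<lambda>z. c * f z) = norm c * l2_norm f"
  by (simp add: l2_norm_def norm_mult power_mult_distrib real_sqrt_mult)

lemma l2_norm_minus_commute: "l2_norm (\<lambda>z. f z - g z) = l2_norm (\<lambda>z. g z - f z)"
  by (simp add: l2_norm_def norm_minus_commute)

lemma l2_norm_cong_AE:
  assumes "AE z in circle. f z = g z"
    and [measurable]: "f \<in> borel_measurable circle" "g \<in> borel_measurable circle"
  shows "l2_norm f = l2_norm g"
  unfolding l2_norm_def
  by (intro arg_cong[where f=sqrt] integral_cong_AE) (use assms(1) in \<open>auto elim: eventually_mono\<close>)

lemma l2_norm_eq_0D:
  assumes "f \<in> L2" "l2_norm f = 0"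
  shows "AE z in circle. f z = 0"
proof -
  have "(LINT z|circle. (norm (f z))\<^sup>2) = 0" using assms(2) by (simp add: l2_norm_def)
  hence "AE z in circle. (norm (f z))\<^sup>2 = 0"
    by (subst (asm) integral_nonneg_eq_0_iff_AE) (use assms in \<open>auto simp: L2_def\<close>)
  thus ?thesis by (simp)
qed

lemma l2_norm_diff_square:
  assumes "f \<in> L2" "g \<in> L2"
  shows "(l2_norm (\<lambda>z. f z - g z))\<^sup>2 = (l2_norm f)\<^sup>2 + (l2_norm g)\<^sup>2 - 2 * Re (l2_inner f g)"
proof -
  have "complex_of_real ((l2_norm (\<lambda>z. f z - g z))\<^sup>2) = l2_inner (\<lambda>z. f z - g z) (\<lambda>z. f z - g z)"
    by (simp add: l2_inner_self)
  also have "\<dots> = l2_inner f f + l2_inner g g - (l2_inner f g + l2_inner g f)"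
    using assms by (simp add: l2_inner_diff_left l2_inner_diff_right L2_diff)
  also have "l2_inner f g + l2_inner g f = complex_of_real (2 * Re (l2_inner f g))"
    by (subst l2_inner_commute[of g f], rule complex_add_cnj)
  also have "l2_inner f f + l2_inner g g - \<dots> = complex_of_real ((l2_norm f)\<^sup>2 + (l2_norm g)\<^sup>2 - 2 * Re (l2_inner f g))"
    by (simp add: l2_inner_self)
  finally show ?thesis using of_real_eq_iff by blast
qed

lemma l2_inner_zero_AE:
  assumes "f \<in> L2" "g \<in> L2" "AE z in circle. g z = 0"
  shows "l2_inner f g = 0"
proof -
  have "l2_inner f g = l2_inner f (\<lambda>z. 0)"
    by (rule l2_inner_cong_AE) (use assms in \<open>auto simp: L2_measurable\<close>)
  thus ?thesis by (simp add: l2_inner_def)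
qed

lemma l2_Cauchy_Schwarz:
  assumes "f \<in> L2" "g \<in> L2"
  shows "norm (l2_inner f g) \<le> l2_norm f * l2_norm g"
proof (cases "l2_norm g = 0")
  case True
  with assms l2_norm_eq_0D l2_inner_zero_AE show ?thesis by simp
next
  case False
  hence pos: "l2_norm g > 0" using l2_norm_nonneg[of g] by linarith
  define c where "c = l2_inner f g / (l2_norm g)\<^sup>2"
  have "0 \<le> (l2_norm (\<lambda>z. f z - c * g z))\<^sup>2" by simp
  also have "\<dots> = (l2_norm f)\<^sup>2 + (norm c * l2_norm g)\<^sup>2 - 2 * Re (cnj c * l2_inner f g)"
    using assms by (simp add: l2_norm_diff_square L2_cmult l2_norm_cmult l2_inner_cmult_right)
  also have "cnj c * l2_inner f g = complex_of_real ((norm (l2_inner f g))\<^sup>2 / (l2_norm g)\<^sup>2)"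
    unfolding c_def by (simp add: complex_norm_square mult.commute del: of_real_power)
  also have "(norm c * l2_norm g)\<^sup>2 = (norm (l2_inner f g))\<^sup>2 / (l2_norm g)\<^sup>2"
    using pos unfolding c_def by (simp add: norm_divide norm_power power_divide power_mult_distrib) (simp add: field_simps)
  finally have "(norm (l2_inner f g))\<^sup>2 / (l2_norm g)\<^sup>2 \<le> (l2_norm f)\<^sup>2" by simp
  hence "(norm (l2_inner f g))\<^sup>2 \<le> (l2_norm f * l2_norm g)\<^sup>2"
    using pos by (simp add: field_simps)
  thus ?thesis by (rule power2_le_imp_le) simp
qed

lemma l2_norm_triangle_diff:
  assumes "f \<in> L2" "g \<in> L2"
  shows "l2_norm (\<lambda>z. f z - g z) \<le> l2_norm f + l2_norm g"
proof (rule power2_le_imp_le)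
  have "- Re (l2_inner f g) \<le> l2_norm f * l2_norm g"
    using l2_Cauchy_Schwarz[OF assms] abs_Re_le_cmod[of "l2_inner f g"] by linarith
  thus "(l2_norm (\<lambda>z. f z - g z))\<^sup>2 \<le> (l2_norm f + l2_norm g)\<^sup>2"
    by (simp add: l2_norm_diff_square[OF assms] power2_sum)
qed simp

lemma l2_norm_triangle:
  assumes "f \<in> L2" "g \<in> L2" "h \<in> L2"
  shows "l2_norm (\<lambda>z. f z - h z) \<le> l2_norm (\<lambda>z. f z - g z) + l2_norm (\<lambda>z. g z - h z)"
proof -
  have "(\<lambda>z. f z - h z) = (\<lambda>z. (f z - g z) - (h z - g z))" by auto
  thus ?thesis
    using l2_norm_triangle_diff[OF L2_diff[OF assms(1,2)] L2_diff[OF assms(3,2)]]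
    by (simp add: l2_norm_minus_commute[of g h])
qed

section \<open>Completeness and orthogonal projection\<close>

lemma integral_norm_le_l2_norm:
  assumes "f \<in> L2"
  shows "(LINT z|circle. norm (f z)) \<le> l2_norm f"
proof -
  have m[measurable]: "f \<in> borel_measurable circle" using assms by (rule L2_measurable)
  have L: "(\<lambda>z. complex_of_real (norm (f z))) \<in> L2"
    using assms by (simp add: L2_def)
  have "complex_of_real (LINT z|circle. norm (f z)) = l2_inner (\<lambda>z. complex_of_real (norm (f z))) (\<lambda>z. 1)"
    by (simp add: l2_inner_def)
  hence "norm (LINT z|circle. norm (f z)) = norm (l2_inner (\<lambda>z. complex_of_real (norm (f z))) (\<lambda>z. 1))"
    by (metis norm_of_real real_norm_def)
  also have "\<dots> \<le> l2_norm (\<lambda>z. complex_of_real (norm (f z))) * l2_norm (\<lambda>z. 1)"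
    by (rule l2_Cauchy_Schwarz[OF L]) simp
  also have "\<dots> = l2_norm f" by (simp add: l2_norm_def)
  finally show ?thesis by simp
qed

lemma nn_integral_square_l2_norm:
  assumes "f \<in> L2"
  shows "(\<integral>\<^sup>+z. ennreal ((norm (f z))\<^sup>2) \<partial>circle) = ennreal ((l2_norm f)\<^sup>2)"
  unfolding l2_norm_square using assms by (intro nn_integral_eq_integral) (auto simp: L2_def)

text \<open>
  The \<open>L\<^sup>2\<close> norm dominates the \<open>L\<^sup>1\<close> norm on a probability space, so the increments have a finite sum
  in \<open>L\<^sup>1\<close>; by monotone convergence they are then absolutely summable at almost every point.
\<close>

lemma L2_rapid_sequence_converges_AE:
  assumes F: "\<And>k. F k \<in> L2" and d: "\<And>k. l2_norm (\<lambda>z. F (Suc k) z - F k z) \<le> (1/2)^k"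
  shows "AE z in circle. convergent (\<lambda>k. F k z)"
proof -
  have m[measurable]: "F k \<in> borel_measurable circle" for k using F by (rule L2_measurable)
  let ?D = "\<lambda>k z. norm (F (Suc k) z - F k z)"
  have int: "integrable circle (?D k)" for k
    by (intro integrable_norm L2_integrable L2_diff F)
  have "(\<integral>\<^sup>+z. (\<Sum>k. ennreal (?D k z)) \<partial>circle) = (\<Sum>k. \<integral>\<^sup>+z. ennreal (?D k z) \<partial>circle)"
    by (rule nn_integral_suminf) measurable
  also have "\<dots> \<le> (\<Sum>k. ennreal ((1/2)^k))"
  proof (rule suminf_le)
    fix k
    have "(\<integral>\<^sup>+z. ennreal (?D k z) \<partial>circle) = ennreal (LINT z|circle. ?D k z)"
      by (rule nn_integral_eq_integral[OF int]) simp
    also have "\<dots> \<le> ennreal ((1/2)^k)"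
      using order_trans[OF integral_norm_le_l2_norm[OF L2_diff[OF F F]] d] by (rule ennreal_leI)
    finally show "(\<integral>\<^sup>+z. ennreal (?D k z) \<partial>circle) \<le> ennreal ((1/2)^k)" .
  qed auto
  also have "\<dots> < \<infinity>"
    by (subst suminf_ennreal2) (auto intro: summable_geometric)
  finally have "(\<integral>\<^sup>+z. (\<Sum>k. ennreal (?D k z)) \<partial>circle) \<noteq> \<infinity>" by simp
  hence "AE z in circle. (\<Sum>k. ennreal (?D k z)) \<noteq> \<infinity>"
    by (intro nn_integral_noteq_infinite) measurable
  thus ?thesis
  proof eventually_elim
    case (elim z)
    have "summable (\<lambda>k. ?D k z)"
      by (rule summable_suminf_not_top) (use elim in auto)
    hence "summable (\<lambda>k. F (Suc k) z - F k z)" by (rule summable_norm_cancel)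
    hence "convergent (\<lambda>n. \<Sum>k<n. F (Suc k) z - F k z)" by (simp add: summable_iff_convergent)
    hence "convergent (\<lambda>n. (F n z - F 0 z) + F 0 z)"
      by (intro convergent_add[OF _ convergent_const]) (simp add: sum_lessThan_telescope[of "\<lambda>k. F k z"])
    thus ?case by simp
  qed
qed

text \<open>
  A subsequence with geometrically decreasing increments converges almost everywhere. The lemma of
  Fatou turns its pointwise limit into a limit in norm of the whole sequence.
\<close>

theorem L2_complete:
  assumes F: "\<And>n. F n \<in> L2"
    and Cauchy: "\<And>e. e > 0 \<Longrightarrow> \<exists>N. \<forall>m\<ge>N. \<forall>n\<ge>N. l2_norm (\<lambda>z. F m z - F n z) < e"
  obtains f where "f \<in> L2" "(\<lambda>n. l2_norm (\<lambda>z. F n z - f z)) \<longlonglongrightarrow> 0"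
proof -
  have m[measurable]: "F k \<in> borel_measurable circle" for k using F by (rule L2_measurable)
  have "\<forall>k. \<exists>N. \<forall>m\<ge>N. \<forall>n\<ge>N. l2_norm (\<lambda>z. F m z - F n z) < (1/2)^k"
    using Cauchy by simp
  then obtain N where N: "\<And>k m n. m \<ge> N k \<Longrightarrow> n \<ge> N k \<Longrightarrow> l2_norm (\<lambda>z. F m z - F n z) < (1/2)^k"
    by metis
  \<comment> \<open>Partial sums make the chosen indices increasing and keep each beyond \<open>N k\<close>.\<close>
  define s where "s k = (\<Sum>i\<le>k. N i)" for k
  have sN: "s j \<ge> N k" if "j \<ge> k" for j k
    unfolding s_def using that by (intro member_le_sum) auto
  define G where "G k = F (s k)" for k
  have [measurable]: "G k \<in> borel_measurable circle" for k by (simp add: G_def)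
  have conv: "AE z in circle. convergent (\<lambda>k. G k z)"
  proof (rule L2_rapid_sequence_converges_AE)
    show "G k \<in> L2" for k by (simp add: G_def F)
    show "l2_norm (\<lambda>z. G (Suc k) z - G k z) \<le> (1/2)^k" for k
      unfolding G_def by (rule less_imp_le[OF N[OF sN sN]]) auto
  qed
  define f where "f z = lim (\<lambda>k. G k z)" for z
  have [measurable]: "f \<in> borel_measurable circle"
    unfolding f_def by measurable
  have close: "(\<lambda>z. F n z - f z) \<in> L2 \<and> l2_norm (\<lambda>z. F n z - f z) \<le> (1/2)^k" if n: "n \<ge> N k" for n k
  proof -
    let ?b = "ennreal (((1/2)^k)\<^sup>2)"
    have "(\<integral>\<^sup>+z. ennreal ((norm (F n z - f z))\<^sup>2) \<partial>circle)
          = (\<integral>\<^sup>+z. liminf (\<lambda>j. ennreal ((norm (F n z - G j z))\<^sup>2)) \<partial>circle)"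
    proof (rule nn_integral_cong_AE, use conv in eventually_elim)
      case (elim z)
      hence "(\<lambda>j. G j z) \<longlonglongrightarrow> f z" by (simp add: convergent_LIMSEQ_iff f_def)
      hence "(\<lambda>j. ennreal ((norm (F n z - G j z))\<^sup>2)) \<longlonglongrightarrow> ennreal ((norm (F n z - f z))\<^sup>2)"
        by (intro tendsto_intros)
      thus ?case by (rule lim_imp_Liminf[symmetric, rotated]) simp
    qed
    also have "\<dots> \<le> liminf (\<lambda>j. \<integral>\<^sup>+z. ennreal ((norm (F n z - G j z))\<^sup>2) \<partial>circle)"
      by (rule nn_integral_liminf) measurable
    also have "\<dots> \<le> ?b"
    proof (rule Liminf_le)
      show "\<forall>\<^sub>F j in sequentially. (\<integral>\<^sup>+z. ennreal ((norm (F n z - G j z))\<^sup>2) \<partial>circle) \<le> ?b"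
        using eventually_ge_at_top[of k]
      proof eventually_elim
        case (elim j)
        have "(\<integral>\<^sup>+z. ennreal ((norm (F n z - G j z))\<^sup>2) \<partial>circle) = ennreal ((l2_norm (\<lambda>z. F n z - G j z))\<^sup>2)"
          unfolding G_def by (rule nn_integral_square_l2_norm[OF L2_diff[OF F F]])
        also have "\<dots> \<le> ?b"
          unfolding G_def using N[OF n sN[OF elim]] by (intro ennreal_leI power_mono) auto
        finally show ?case .
      qed
    qed simp
    finally have le: "(\<integral>\<^sup>+z. ennreal ((norm (F n z - f z))\<^sup>2) \<partial>circle) \<le> ?b" .
    have L: "(\<lambda>z. F n z - f z) \<in> L2"
      unfolding L2_def
    proof (intro CollectI conjI)
      show "integrable circle (\<lambda>z. (cmod (F n z - f z))\<^sup>2)"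
        by (rule integrableI_bounded) (use le_less_trans[OF le ennreal_less_top] in auto)
    qed measurable
    have "(l2_norm (\<lambda>z. F n z - f z))\<^sup>2 \<le> ((1/2)^k)\<^sup>2"
      using le nn_integral_square_l2_norm[OF L] by simp
    hence "l2_norm (\<lambda>z. F n z - f z) \<le> (1/2)^k" by (rule power2_le_imp_le) simp
    with L show ?thesis by blast
  qed
  show ?thesis
  proof (rule that)
    have "(\<lambda>z. F (N 0) z - (F (N 0) z - f z)) \<in> L2"
      using close[of 0 "N 0", OF order_refl] L2_diff[OF F] by blast
    thus "f \<in> L2" by simp
    show "(\<lambda>n. l2_norm (\<lambda>z. F n z - f z)) \<longlonglongrightarrow> 0"
    proof (rule LIMSEQ_I)
      fix e :: real assume "e > 0"
      then obtain k where k: "(1/2)^k < e" using real_arch_pow_inv[of e "1/2"] by auto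
      show "\<exists>no. \<forall>n\<ge>no. norm (l2_norm (\<lambda>z. F n z - f z) - 0) < e"
        using close[of k] k by (intro exI[of _ "N k"]) force
    qed
  qed
qed

lemma closed_subspaceD:
  assumes "closed_subspace M"
  shows "M \<subseteq> L2" "(\<lambda>z. 0) \<in> M"
    "f \<in> M \<Longrightarrow> g \<in> M \<Longrightarrow> (\<lambda>z. f z + g z) \<in> M"
    "f \<in> M \<Longrightarrow> (\<lambda>z. c * f z) \<in> M"
    "(\<And>n. F n \<in> M) \<Longrightarrow> f \<in> L2 \<Longrightarrow> (\<lambda>n. l2_norm (\<lambda>z. F n z - f z)) \<longlonglongrightarrow> 0 \<Longrightarrow> f \<in> M"
  using assms unfolding closed_subspace_def by blast+

lemma closed_subspace_diff:
  assumes "closed_subspace M" "f \<in> M" "g \<in> M"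
  shows "(\<lambda>z. f z - g z) \<in> M"
  using closed_subspaceD(3)[OF assms(1,2) closed_subspaceD(4)[OF assms(1,3), of "-1"]] by simp

lemma closed_subspace_AE:
  assumes "closed_subspace M" "f \<in> M" "g \<in> borel_measurable circle" "AE z in circle. g z = f z"
  shows "g \<in> M"
proof -
  have f: "f \<in> L2" using assms closed_subspaceD(1) by blast
  have g: "g \<in> L2" by (rule L2_cong_AE[OF f assms(3,4)])
  have "l2_norm (\<lambda>z. f z - g z) = l2_norm (\<lambda>z. 0)"
    by (rule l2_norm_cong_AE)
       (use assms(4) f g in \<open>auto elim: eventually_mono intro: borel_measurable_diff L2_measurable\<close>)
  hence "l2_norm (\<lambda>z. f z - g z) = 0" by (simp add: l2_norm_def)
  thus ?thesis
    using closed_subspaceD(5)[OF assms(1) _ g, of "\<lambda>_. f"] assms(2) by simp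
qed

text \<open>
  The parallelogram law in the form that suits a minimizing sequence: if \<open>a\<close> and \<open>b\<close> are almost as close
  to \<open>f\<close> as their midpoint can be, then they are close to each other.
\<close>

lemma l2_parallelogram:
  assumes "f \<in> L2" "a \<in> L2" "b \<in> L2"
  shows "(l2_norm (\<lambda>z. a z - b z))\<^sup>2 = 2 * (l2_norm (\<lambda>z. f z - a z))\<^sup>2 + 2 * (l2_norm (\<lambda>z. f z - b z))\<^sup>2
           - 4 * (l2_norm (\<lambda>z. f z - 1/2 * (a z + b z)))\<^sup>2"
proof -
  have i: "integrable circle (\<lambda>z. (norm (f z - a z))\<^sup>2)" "integrable circle (\<lambda>z. (norm (f z - b z))\<^sup>2)"
     "integrable circle (\<lambda>z. (norm (f z - 1/2 * (a z + b z)))\<^sup>2)"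
    by (rule L2_square_integrable, intro L2_diff L2_cmult L2_add assms)+
  have *: "(\<lambda>z. (norm (a z - b z))\<^sup>2) = (\<lambda>z. 2 * (norm (f z - a z))\<^sup>2 + 2 * (norm (f z - b z))\<^sup>2
           - 4 * (norm (f z - 1/2 * (a z + b z)))\<^sup>2)"
    by (simp add: fun_eq_iff cmod_power2) (simp add: power2_eq_square field_simps)
  show ?thesis
    unfolding l2_norm_square by (subst *) (simp add: i[simplified])
qed

text \<open>
  A minimizing sequence for the distance from \<open>f\<close> to \<open>M\<close> is a Cauchy sequence by the parallelogram law.
  Its limit \<open>g\<close> attains the distance, and a nonzero inner product of \<open>f - g\<close> with some \<open>h \<in> M\<close> would
  allow a small multiple of \<open>h\<close> to improve on \<open>g\<close>.
\<close>

theorem orthogonal_projection_exists: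
  assumes M: "closed_subspace M" and f: "f \<in> L2"
  shows "\<exists>g. g \<in> M \<and> (\<forall>h\<in>M. l2_inner (\<lambda>z. f z - g z) h = 0)"
proof -
  note subL2 = subsetD[OF closed_subspaceD(1)[OF M]]
  define d where "d = (INF g\<in>M. (l2_norm (\<lambda>z. f z - g z))\<^sup>2)"
  have bdd: "bdd_below ((\<lambda>g. (l2_norm (\<lambda>z. f z - g z))\<^sup>2) ` M)"
    by (rule bdd_belowI[of _ 0]) auto
  have ne: "M \<noteq> {}" using closed_subspaceD(2)[OF M] by auto
  have d_le: "d \<le> (l2_norm (\<lambda>z. f z - g z))\<^sup>2" if "g \<in> M" for g
    unfolding d_def by (rule cINF_lower[OF bdd that])
  have "\<exists>g\<in>M. (l2_norm (\<lambda>z. f z - g z))\<^sup>2 < d + 1 / real (Suc n)" for n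
    using cINF_less_iff[OF ne bdd, of "d + 1 / real (Suc n)"] unfolding d_def by simp
  then obtain G where GM: "\<And>n. G n \<in> M"
    and G: "\<And>n. (l2_norm (\<lambda>z. f z - G n z))\<^sup>2 < d + 1 / real (Suc n)" by metis
  have GL: "G n \<in> L2" for n using subL2 GM by blast
  have est: "(l2_norm (\<lambda>z. G m z - G n z))\<^sup>2 < 4 / real (Suc N)" if "m \<ge> N" "n \<ge> N" for m n N
  proof -
    have "(\<lambda>z. 1/2 * (G m z + G n z)) \<in> M"
      by (intro closed_subspaceD(4)[OF M] closed_subspaceD(3)[OF M] GM)
    from d_le[OF this] l2_parallelogram[OF f GL[of m] GL[of n]] G[of m] G[of n]
    have "(l2_norm (\<lambda>z. G m z - G n z))\<^sup>2 < 2 / real (Suc m) + 2 / real (Suc n)" by simp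
    also have "\<dots> \<le> 2 / real (Suc N) + 2 / real (Suc N)"
      using that by (intro add_mono divide_left_mono) auto
    finally show ?thesis by simp
  qed
  obtain g where gL: "g \<in> L2" and lim: "(\<lambda>n. l2_norm (\<lambda>z. G n z - g z)) \<longlonglongrightarrow> 0"
  proof (rule L2_complete[of G])
    fix e :: real assume e: "e > 0"
    obtain N where N: "4 / e\<^sup>2 < real N" using reals_Archimedean2 by blast
    have "4 < real N * e\<^sup>2" using N e by (simp add: divide_less_eq)
    also have "\<dots> < e\<^sup>2 * real (Suc N)" using e by (simp add: algebra_simps)
    finally have "4 / real (Suc N) < e\<^sup>2" by (subst divide_less_eq) simp
    hence "(l2_norm (\<lambda>z. G m z - G n z))\<^sup>2 < e\<^sup>2" if "m \<ge> N" "n \<ge> N" for m n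
      using est[OF that] by linarith
    hence "l2_norm (\<lambda>z. G m z - G n z) < e" if "m \<ge> N" "n \<ge> N" for m n
      using power2_less_imp_less[of _ e] that e by (meson less_imp_le)
    thus "\<exists>N. \<forall>m\<ge>N. \<forall>n\<ge>N. l2_norm (\<lambda>z. G m z - G n z) < e" by blast
  qed (use GL in auto)
  have gM: "g \<in> M" by (rule closed_subspaceD(5)[OF M GM gL lim])
  have min: "l2_norm (\<lambda>z. f z - g z) \<le> sqrt d"
  proof (rule LIMSEQ_le[OF tendsto_const])
    have "(\<lambda>n. sqrt (d + 1 / real (Suc n)) + l2_norm (\<lambda>z. G n z - g z)) \<longlonglongrightarrow> sqrt (d + 0) + 0"
      by (intro tendsto_intros lim LIMSEQ_Suc[OF lim_1_over_n])
    thus "(\<lambda>n. sqrt (d + 1 / real (Suc n)) + l2_norm (\<lambda>z. G n z - g z)) \<longlonglongrightarrow> sqrt d" by simp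
    have "l2_norm (\<lambda>z. f z - G n z) \<le> sqrt (d + 1 / real (Suc n))" for n
      using real_le_rsqrt[OF less_imp_le[OF G[of n]]] .
    hence "l2_norm (\<lambda>z. f z - g z) \<le> sqrt (d + 1 / real (Suc n)) + l2_norm (\<lambda>z. G n z - g z)" for n
      using l2_norm_triangle[OF f GL[of n] gL] add_right_mono order_trans by meson
    thus "\<exists>N. \<forall>n\<ge>N. l2_norm (\<lambda>z. f z - g z) \<le> sqrt (d + 1 / real (Suc n)) + l2_norm (\<lambda>z. G n z - g z)"
      by blast
  qed
  have d0: "d \<ge> 0" unfolding d_def by (rule cINF_greatest[OF ne]) simp
  have min2: "(l2_norm (\<lambda>z. f z - g z))\<^sup>2 \<le> d"
    using power_mono[OF min l2_norm_nonneg, of 2] d0 by simp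
  have "l2_inner (\<lambda>z. f z - g z) h = 0" if h: "h \<in> M" for h
  proof (rule ccontr)
    let ?a = "l2_inner (\<lambda>z. f z - g z) h"
    assume "?a \<noteq> 0"
    \<comment> \<open>With this \<open>t\<close> one has \<open>t \<parallel>h\<parallel>\<^sup>2 \<le> 1\<close>, while minimality of \<open>g\<close> would force it to be at least 2.\<close>
    define t where "t = 1 / ((l2_norm h)\<^sup>2 + 1)"
    have t: "t > 0" unfolding t_def by (intro divide_pos_pos add_nonneg_pos) auto
    let ?c = "complex_of_real t * ?a"
    have "(\<lambda>z. g z + ?c * h z) \<in> M"
      by (intro closed_subspaceD(3)[OF M] closed_subspaceD(4)[OF M] gM h)
    from d_le[OF this] have "d \<le> (l2_norm (\<lambda>z. (f z - g z) - ?c * h z))\<^sup>2"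
      by (simp add: diff_diff_eq)
    also have "\<dots> = (l2_norm (\<lambda>z. f z - g z))\<^sup>2 + (norm ?c * l2_norm h)\<^sup>2 - 2 * Re (cnj ?c * ?a)"
      by (subst l2_norm_diff_square)
         (simp_all add: L2_diff f gL L2_cmult subL2[OF h] l2_norm_cmult l2_inner_cmult_right)
    also have "cnj ?c * ?a = complex_of_real (t * (norm ?a)\<^sup>2)"
      by (simp add: complex_norm_square mult_ac del: of_real_power)
    also have "(norm ?c * l2_norm h)\<^sup>2 = t * (norm ?a)\<^sup>2 * (t * (l2_norm h)\<^sup>2)"
      using t by (simp add: norm_mult power_mult_distrib power2_eq_square)
    finally have "2 * (t * (norm ?a)\<^sup>2) \<le> t * (norm ?a)\<^sup>2 * (t * (l2_norm h)\<^sup>2)"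
      using min2 by simp
    moreover have "t * (norm ?a)\<^sup>2 > 0" using t \<open>?a \<noteq> 0\<close> by simp
    ultimately have "2 \<le> t * (l2_norm h)\<^sup>2"
      by (metis mult.commute mult_le_cancel_right_pos)
    moreover have "t * (l2_norm h)\<^sup>2 \<le> 1" 
      unfolding t_def by (simp add: divide_le_eq_1 add_nonneg_pos)
    ultimately show False by simp
  qed
  with gM show ?thesis by blast
qed

lemma orth_proj:
  assumes "closed_subspace M" "f \<in> L2"
  shows "orth_proj M f \<in> M" "h \<in> M \<Longrightarrow> l2_inner (\<lambda>z. f z - orth_proj M f z) h = 0"
  using someI_ex[OF orthogonal_projection_exists[OF assms]] unfolding orth_proj_def by blast+

lemma l2_inner_orth_proj:
  assumes "closed_subspace M" "f \<in> L2" "h \<in> M"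
  shows "l2_inner (orth_proj M f) h = l2_inner f h"
proof -
  have "orth_proj M f \<in> L2" "h \<in> L2"
    using orth_proj(1)[OF assms(1,2)] closed_subspaceD(1)[OF assms(1)] assms(3) by auto
  thus ?thesis
    using orth_proj(2)[OF assms] by (simp add: l2_inner_diff_left assms(2))
qed

section \<open>Fourier coefficients and the Hardy space\<close>

lemma fourier_coeff_diff:
  "f \<in> L2 \<Longrightarrow> g \<in> L2 \<Longrightarrow> fourier_coeff (\<lambda>z. f z - g z) n = fourier_coeff f n - fourier_coeff g n"
  by (simp add: fourier_coeff_def l2_inner_diff_left)

lemma fourier_coeff_add:
  "f \<in> L2 \<Longrightarrow> g \<in> L2 \<Longrightarrow> fourier_coeff (\<lambda>z. f z + g z) n = fourier_coeff f n + fourier_coeff g n"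
  by (simp add: fourier_coeff_def l2_inner_add_left)

lemma fourier_coeff_cmult: "fourier_coeff (\<lambda>z. c * f z) n = c * fourier_coeff f n"
  by (simp add: fourier_coeff_def l2_inner_cmult_left)

lemma fourier_coeff_cong_AE:
  assumes "AE z in circle. f z = g z" "f \<in> borel_measurable circle" "g \<in> borel_measurable circle"
  shows "fourier_coeff f n = fourier_coeff g n"
  unfolding fourier_coeff_def by (rule l2_inner_cong_AE) (use assms in auto)

lemma l2_inner_tendsto:
  assumes "\<And>n. F n \<in> L2" "f \<in> L2" "h \<in> L2" "(\<lambda>n. l2_norm (\<lambda>z. F n z - f z)) \<longlonglongrightarrow> 0"
  shows "(\<lambda>n. l2_inner (F n) h) \<longlonglongrightarrow> l2_inner f h"
proof (rule LIM_zero_cancel, rule Lim_null_comparison)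
  show "\<forall>\<^sub>F n in sequentially. norm (l2_inner (F n) h - l2_inner f h) \<le> l2_norm (\<lambda>z. F n z - f z) * l2_norm h"
    using l2_Cauchy_Schwarz[OF L2_diff[OF assms(1,2)] assms(3)]
    by (simp add: l2_inner_diff_left assms)
  show "(\<lambda>n. l2_norm (\<lambda>z. F n z - f z) * l2_norm h) \<longlonglongrightarrow> 0"
    using tendsto_mult_right[OF assms(4)] by simp
qed

lemma closed_subspace_H2: "closed_subspace H2"
  unfolding closed_subspace_def
proof (intro conjI ballI allI impI)
  fix F f assume f: "f \<in> L2" and F: "\<forall>n. F n \<in> H2" and lim: "(\<lambda>n. l2_norm (\<lambda>z. F n z - f z)) \<longlonglongrightarrow> 0"
  have FL: "F n \<in> L2" for n using F by (auto simp: H2_def)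
  have "fourier_coeff f k = 0" if "k < 0" for k
  proof -
    have "(\<lambda>n. fourier_coeff (F n) k) \<longlonglongrightarrow> fourier_coeff f k"
      unfolding fourier_coeff_def by (rule l2_inner_tendsto[OF FL f _ lim]) simp
    moreover have "fourier_coeff (F n) k = 0" for n using F that by (auto simp: H2_def)
    ultimately show ?thesis by (simp add: LIMSEQ_const_iff)
  qed
  thus "f \<in> H2" using f by (simp add: H2_def)
qed (auto simp: H2_def L2_add L2_cmult fourier_coeff_add fourier_coeff_cmult, auto simp: fourier_coeff_def l2_inner_def)

lemma H2_L2: "f \<in> H2 \<Longrightarrow> f \<in> L2"
  by (simp add: H2_def)

lemma powi_mult_circle:
  "z \<in> sphere 0 (1::real) \<Longrightarrow> (z::complex) powi m * z powi n = z powi (m + n)"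
  by (subst power_int_add) auto

lemma cnj_powi_circle:
  assumes "z \<in> sphere 0 (1::real)"
  shows "cnj (z powi n) = z powi (- n)"
proof -
  have "cnj z = inverse z"
    using assms by (simp add: inverse_eq_divide divide_conv_cnj)
  thus ?thesis by (simp add: power_int_minus power_int_inverse)
qed

lemma integral_circle_powi:
  "(LINT z|circle. z powi n) = (if n = 0 then 1 else 0)"
proof (cases "n = 0")
  case False
  let ?c = "\<i> * of_int n"
  let ?F = "\<lambda>x. exp (?c * x) / ?c"
  have cis: "cis t powi n = exp (?c * of_real t)" for t
    by (simp add: cis_conv_exp exp_power_int mult_ac)
  have "(LINT t|lborel. indicator {0..2*pi} t *\<^sub>R exp (?c * of_real t)) = ?F (of_real (2*pi)) - ?F (of_real 0)"
  proof (rule integral_FTC_Icc)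
    fix t :: real
    have "(?F has_field_derivative exp (?c * of_real t)) (at (of_real t))"
      using False by (auto intro!: derivative_eq_intros)
    thus "((\<lambda>t. ?F (of_real t)) has_vector_derivative exp (?c * of_real t)) (at t within {0..2*pi})"
      by (rule has_vector_derivative_real_field)
  qed (auto intro!: continuous_intros)
  also have "?F (of_real (2*pi)) = ?F (of_real 0)"
    using exp_integer_2pi[of n] by (simp add: mult_ac exp_eq_1)
  finally show ?thesis
    using False by (simp add: integral_circle set_lebesgue_integral_def cis)
qed simp

lemma fourier_coeff_powi: "fourier_coeff (\<lambda>z. z powi m) n = (if m = n then 1 else 0)"
proof -
  have "fourier_coeff (\<lambda>z. z powi m) n = (LINT z|circle. z powi (m - n))"
    unfolding fourier_coeff_def l2_inner_def
    by (rule Bochner_Integration.integral_cong) (simp_all only: space_circle cnj_powi_circle powi_mult_circle add_uminus_conv_diff)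
  thus ?thesis by (simp add: integral_circle_powi)
qed

lemma fourier_coeff_conv_integral:
  "fourier_coeff f n = (LINT z|circle. f z * z powi (- n))"
  unfolding fourier_coeff_def l2_inner_def
  by (rule Bochner_Integration.integral_cong) (simp_all only: space_circle cnj_powi_circle)

lemma powi_in_H2: "n \<ge> 0 \<Longrightarrow> (\<lambda>z. z powi n) \<in> H2"
  by (auto simp: H2_def fourier_coeff_powi)

lemma integrable_mult_bounded:
  fixes g b :: "complex \<Rightarrow> complex"
  assumes g: "integrable circle g" and [measurable]: "b \<in> borel_measurable circle"
    and b: "AE z in circle. norm (b z) \<le> C"
  shows "integrable circle (\<lambda>z. g z * b z)"
proof (rule Bochner_Integration.integrable_bound)
  show "integrable circle (\<lambda>z. C * norm (g z))" using g by simp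
  show "(\<lambda>z. g z * b z) \<in> borel_measurable circle" using g by measurable
  show "AE z in circle. norm (g z * b z) \<le> norm (C * norm (g z))"
    using b
  proof eventually_elim
    case (elim z)
    have "norm (g z * b z) \<le> C * norm (g z)"
      unfolding norm_mult using mult_right_mono[OF elim, of "norm (g z)"] by (simp add: mult.commute)
    thus ?case by (metis abs_ge_self order_trans real_norm_def)
  qed
qed

lemma integrable_mult_powi:
  "integrable circle g \<Longrightarrow> integrable circle (\<lambda>z. g z * z powi n)"
  by (rule integrable_mult_bounded[where C = 1]) (auto simp: norm_power_int)

section \<open>Boundary functions of bounded analytic functions\<close>

text \<open>
  The function \<open>boundary_value u\<close> is arbitrary where the radial limit fails to exist and need not be
  measurable. The relation keeps a measurable representative \<open>U\<close> at hand instead.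
\<close>

definition radial_boundary :: "(complex \<Rightarrow> complex) \<Rightarrow> (complex \<Rightarrow> complex) \<Rightarrow> bool" where
  "radial_boundary u U \<longleftrightarrow> U \<in> borel_measurable circle \<and>
     (AE z in circle. ((\<lambda>r. u (of_real r * z)) \<longlongrightarrow> U z) (at_left 1))"

text \<open>
  A sequence increasing to 1 along which radial limits are taken, so that measurability of limits and
  dominated convergence apply.
\<close>

definition radii :: "nat \<Rightarrow> real" where
  "radii n = 1 - 1 / real (n + 2)"

lemma radii_bounds: "0 \<le> radii n" "radii n < 1"
  by (auto simp: radii_def field_simps)

lemma filterlim_radii: "filterlim radii (at_left 1) sequentially"
proof -
  have "(\<lambda>n. 1 - 1 / real (n + 2)) \<longlonglongrightarrow> 1 - 0"
    using LIMSEQ_ignore_initial_segment[OF lim_1_over_n, of 2] by (intro tendsto_intros)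
  hence "radii \<longlonglongrightarrow> 1" by (simp add: radii_def[abs_def])
  thus ?thesis
    unfolding filterlim_at by (simp add: radii_bounds radii_bounds(2)[THEN less_imp_neq])
qed

lemma radial_boundary_measurable: "radial_boundary u U \<Longrightarrow> U \<in> borel_measurable circle"
  by (simp add: radial_boundary_def)

lemma radial_boundary_sequence:
  assumes "radial_boundary u U"
  shows "AE z in circle. (\<lambda>n. u (of_real (radii n) * z)) \<longlonglongrightarrow> U z"
proof -
  have "AE z in circle. ((\<lambda>r. u (of_real r * z)) \<longlongrightarrow> U z) (at_left 1)"
    using assms by (simp add: radial_boundary_def)
  thus ?thesis
    by eventually_elim (rule filterlim_compose[OF _ filterlim_radii])
qed

lemma boundary_value_eq:
  assumes "radial_boundary u U"
  shows "AE z in circle. boundary_value u z = U z"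
proof -
  have "AE z in circle. ((\<lambda>r. u (of_real r * z)) \<longlongrightarrow> U z) (at_left 1)"
    using assms by (simp add: radial_boundary_def)
  thus ?thesis
    by eventually_elim (simp add: boundary_value_def tendsto_Lim)
qed

lemma Hinf_bound:
  assumes "u \<in> Hinf"
  obtains C where "C \<ge> 0" "\<And>z. norm z < 1 \<Longrightarrow> norm (u z) \<le> C"
proof -
  obtain C where C: "\<forall>y\<in>u ` ball 0 1. norm y \<le> C"
    using assms unfolding Hinf_def bounded_iff by blast
  show ?thesis
  proof (rule that[of "max 0 C"])
    fix z :: complex assume "norm z < 1"
    hence "u z \<in> u ` ball 0 1" by simp
    thus "norm (u z) \<le> max 0 C" using C by (meson le_max_iff_disj)
  qed simp
qed

lemma dilation_continuous:
  assumes "u \<in> Hinf" "0 \<le> r" "r < 1"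
  shows "continuous_on (sphere 0 1) (\<lambda>z. u (of_real r * z))"
proof (rule continuous_on_compose2[of "ball 0 1" u])
  show "continuous_on (ball 0 1) u"
    using assms by (auto simp: Hinf_def intro: holomorphic_on_imp_continuous_on)
qed (use assms in \<open>auto intro!: continuous_intros simp: norm_mult\<close>)

lemma dilation_measurable:
  assumes "u \<in> Hinf" "0 \<le> r" "r < 1"
  shows "(\<lambda>z. u (of_real r * z)) \<in> borel_measurable circle"
  by (rule borel_measurable_circle_continuous[OF dilation_continuous[OF assms]])

lemma inner_function_boundary:
  assumes "inner_function u"
  obtains U where "radial_boundary u U" "AE z in circle. norm (U z) = 1"
proof -
  have u: "u \<in> Hinf" using assms by (simp add: inner_function_def)
  define U where "U z = lim (\<lambda>n. u (of_real (radii n) * z))" for z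
  have [measurable]: "(\<lambda>z. u (of_real (radii n) * z)) \<in> borel_measurable circle" for n
    by (rule dilation_measurable[OF u radii_bounds])
  have [measurable]: "U \<in> borel_measurable circle" unfolding U_def by measurable
  have "AE z in circle. \<exists>l. ((\<lambda>r. u (of_real r * z)) \<longlongrightarrow> l) (at_left 1) \<and> norm l = 1"
    using assms by (simp add: inner_function_def)
  hence AE: "AE z in circle. ((\<lambda>r. u (of_real r * z)) \<longlongrightarrow> U z) (at_left 1) \<and> norm (U z) = 1"
  proof eventually_elim
    case (elim z)
    then obtain l where l: "((\<lambda>r. u (of_real r * z)) \<longlongrightarrow> l) (at_left 1)" "norm l = 1" by blast
    have "(\<lambda>n. u (of_real (radii n) * z)) \<longlonglongrightarrow> l"
      by (rule filterlim_compose[OF l(1) filterlim_radii])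
    hence "U z = l" unfolding U_def by (rule limI)
    with l show ?case by simp
  qed
  show ?thesis
    by (rule that[of U]) (use AE in \<open>auto simp: radial_boundary_def elim: eventually_mono\<close>)
qed

lemma inner_functionI:
  assumes "u \<in> Hinf" "radial_boundary u U" "AE z in circle. norm (U z) = 1"
  shows "inner_function u"
  unfolding inner_function_def
proof (intro conjI assms(1))
  have "AE z in circle. ((\<lambda>r. u (of_real r * z)) \<longlongrightarrow> U z) (at_left 1)"
    using assms by (simp add: radial_boundary_def)
  thus "AE z in circle. \<exists>l. ((\<lambda>r. u (of_real r * z)) \<longlongrightarrow> l) (at_left 1) \<and> norm l = 1"
    using assms(3) by eventually_elim blast
qed

lemma radial_boundary_norm_le:
  assumes "radial_boundary u U" "\<And>z. norm z < 1 \<Longrightarrow> norm (u z) \<le> C"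
  shows "AE z in circle. norm (U z) \<le> C"
  using radial_boundary_sequence[OF assms(1)] AE_circle_norm
proof eventually_elim
  case (elim z)
  have "norm (u (of_real (radii n) * z)) \<le> C" for n
    using radii_bounds[of n] elim by (intro assms(2)) (simp add: norm_mult)
  thus ?case
    by (intro LIMSEQ_le_const2[OF tendsto_norm[OF elim(1)]]) auto
qed

lemma radial_boundary_mult:
  assumes "radial_boundary u U" "radial_boundary v V"
  shows "radial_boundary (\<lambda>z. u z * v z) (\<lambda>z. U z * V z)"
proof -
  have "AE z in circle. ((\<lambda>r. u (of_real r * z)) \<longlongrightarrow> U z) (at_left 1)"
    "AE z in circle. ((\<lambda>r. v (of_real r * z)) \<longlongrightarrow> V z) (at_left 1)"
    using assms by (simp_all add: radial_boundary_def)
  hence "AE z in circle. ((\<lambda>r. u (of_real r * z) * v (of_real r * z)) \<longlongrightarrow> U z * V z) (at_left 1)"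
    by eventually_elim (rule tendsto_mult)
  thus ?thesis using assms by (simp add: radial_boundary_def borel_measurable_times)
qed

lemma Hinf_mult:
  assumes "u \<in> Hinf" "v \<in> Hinf"
  shows "(\<lambda>z. u z * v z) \<in> Hinf"
proof -
  obtain C D where C: "C \<ge> 0" "\<And>z. norm z < 1 \<Longrightarrow> norm (u z) \<le> C"
    and D: "D \<ge> 0" "\<And>z. norm z < 1 \<Longrightarrow> norm (v z) \<le> D"
    using Hinf_bound[OF assms(1)] Hinf_bound[OF assms(2)] by metis
  have "norm (u z * v z) \<le> C * D" if "norm z < 1" for z
    unfolding norm_mult by (intro mult_mono C D that) simp
  hence "bounded ((\<lambda>z. u z * v z) ` ball 0 1)"
    by (auto simp: bounded_iff intro!: exI[of _ "C * D"])
  thus ?thesis using assms by (auto simp: Hinf_def intro!: holomorphic_intros)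
qed

text \<open>
  Termwise integration, to be used with powers of \<open>z\<close> for \<open>\<phi> k\<close>: for Taylor series on smaller circles and
  for the two halves of the Poisson kernel.
\<close>

lemma
  fixes g :: "complex \<Rightarrow> complex"
  assumes c: "summable (\<lambda>k. norm (c k))" and g: "integrable circle g"
    and m[measurable]: "\<And>k. \<phi> k \<in> borel_measurable circle"
    and b: "\<And>k z. z \<in> sphere 0 1 \<Longrightarrow> norm (\<phi> k z) \<le> 1"
  shows integral_series:
      "(\<lambda>k. c k * (LINT z|circle. \<phi> k z * g z)) sums (LINT z|circle. (\<Sum>k. c k * \<phi> k z) * g z)"
    and integrable_series: "integrable circle (\<lambda>z. (\<Sum>k. c k * \<phi> k z) * g z)"
proof -
  let ?f = "\<lambda>k z. c k * (\<phi> k z * g z)"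
  have int0: "integrable circle (\<lambda>z. \<phi> k z * g z)" for k
    using integrable_mult_bounded[OF g m AE_I2[OF b]] by (simp add: mult.commute)
  have le: "norm (?f k z) \<le> norm (c k) * norm (g z)" if "z \<in> sphere 0 1" for k z
    using b[OF that, of k] by (simp add: norm_mult mult_left_mono mult_left_le_one_le)
  have sm: "summable (\<lambda>k. norm (?f k z))" if "z \<in> sphere 0 1" for z
    by (rule summable_comparison_test'[OF summable_mult2[OF c, of "norm (g z)"], of 0])
       (use le[OF that] in simp)
  have int: "integrable circle (?f k)" for k using int0 by simp
  have AE: "AE z in circle. summable (\<lambda>k. norm (?f k z))"
    by (rule AE_I2) (use sm in simp)
  have sum: "summable (\<lambda>k. LINT z|circle. norm (?f k z))"
  proof (rule summable_comparison_test'[of _ 0])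
    show "summable (\<lambda>k. norm (c k) * (LINT z|circle. norm (g z)))"
      by (rule summable_mult2[OF c])
    fix k
    have "(LINT z|circle. norm (?f k z)) \<le> (LINT z|circle. norm (c k) * norm (g z))"
      by (rule integral_mono_AE) (use int0 g le in \<open>auto intro: AE_I2\<close>)
    thus "norm (LINT z|circle. norm (?f k z)) \<le> norm (c k) * (LINT z|circle. norm (g z))"
      by simp
  qed
  have eq: "(\<Sum>k. ?f k z) = (\<Sum>k. c k * \<phi> k z) * g z" if z: "z \<in> space circle" for z
  proof -
    have "summable (\<lambda>k. norm (c k * \<phi> k z))"
      by (rule summable_comparison_test'[OF c, of 0])
         (use b z in \<open>auto simp: norm_mult intro: mult_left_le\<close>)
    hence "summable (\<lambda>k. c k * \<phi> k z)" by (rule summable_norm_cancel)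
    from suminf_mult2[OF this, of "g z"] show ?thesis by (simp add: mult.assoc)
  qed
  show "integrable circle (\<lambda>z. (\<Sum>k. c k * \<phi> k z) * g z)"
    using integrable_suminf[OF int AE sum] by (rule Bochner_Integration.integrable_cong[THEN iffD1, rotated 2]) (simp_all only: eq)
  have "(LINT z|circle. (\<Sum>k. ?f k z)) = (LINT z|circle. (\<Sum>k. c k * \<phi> k z) * g z)"
    by (rule Bochner_Integration.integral_cong) (simp_all only: eq)
  thus "(\<lambda>k. c k * (LINT z|circle. \<phi> k z * g z)) sums (LINT z|circle. (\<Sum>k. c k * \<phi> k z) * g z)"
    using sums_integral[OF int AE sum] by simp
qed

lemma dilation_integral:
  assumes u: "u \<in> Hinf" and r: "0 \<le> r" "r < 1" and g: "integrable circle g"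
  shows "(\<lambda>k. ((deriv ^^ k) u 0 / fact k * of_real r ^ k) * (LINT z|circle. z powi int k * g z))
           sums (LINT z|circle. u (of_real r * z) * g z)"
proof -
  let ?a = "\<lambda>k. (deriv ^^ k) u 0 / fact k"
  have hol: "u holomorphic_on ball 0 1" using u by (simp add: Hinf_def)
  have "(\<lambda>k. ?a k * (of_real ((1 + r) / 2) - 0) ^ k) sums u (of_real ((1 + r) / 2))"
    by (rule holomorphic_power_series[OF hol]) (use r in \<open>simp add: norm_divide del: of_real_add\<close>)
  hence "summable (\<lambda>k. ?a k * of_real ((1 + r) / 2) ^ k)" by (simp add: sums_iff)
  hence sm: "summable (\<lambda>k. norm (?a k * of_real r ^ k))"
    by (rule powser_insidea) (use r in \<open>simp add: norm_divide del: of_real_add\<close>)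
  have "(\<lambda>k. (?a k * of_real r ^ k) * (LINT z|circle. z powi int k * g z))
          sums (LINT z|circle. (\<Sum>k. (?a k * of_real r ^ k) * z powi int k) * g z)"
    by (rule integral_series[OF sm g]) (rule measurable_powi_circle, simp add: norm_power)
  also have "(LINT z|circle. (\<Sum>k. (?a k * of_real r ^ k) * z powi int k) * g z) = (LINT z|circle. u (of_real r * z) * g z)"
  proof (rule Bochner_Integration.integral_cong)
    fix z assume "z \<in> space circle"
    hence "(\<lambda>k. ?a k * (of_real r * z - 0) ^ k) sums u (of_real r * z)"
      by (intro holomorphic_power_series[OF hol]) (use r in \<open>simp add: norm_mult\<close>)
    thus "(\<Sum>k. (?a k * of_real r ^ k) * z powi int k) * g z = u (of_real r * z) * g z"
      by (simp add: sums_iff power_mult_distrib mult.assoc)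
  qed simp
  finally show ?thesis .
qed

lemma boundary_integral_limit:
  assumes u: "u \<in> Hinf" and U: "radial_boundary u U" and g: "integrable circle g"
  shows "(\<lambda>n. LINT z|circle. u (of_real (radii n) * z) * g z) \<longlonglongrightarrow> (LINT z|circle. U z * g z)"
proof -
  have [measurable]: "U \<in> borel_measurable circle" "g \<in> borel_measurable circle"
    "(\<lambda>z. u (of_real (radii n) * z)) \<in> borel_measurable circle" for n
    using U g dilation_measurable[OF u radii_bounds] by (auto simp: radial_boundary_def)
  obtain C where C: "C \<ge> 0" "\<And>z. norm z < 1 \<Longrightarrow> norm (u z) \<le> C" using Hinf_bound[OF u] by blast
  show ?thesis
  proof (rule integral_dominated_convergence[where w = "\<lambda>z. C * norm (g z)"])
    show "AE z in circle. (\<lambda>n. u (of_real (radii n) * z) * g z) \<longlonglongrightarrow> U z * g z"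
      using radial_boundary_sequence[OF U] by eventually_elim (rule tendsto_mult_right)
    show "AE z in circle. norm (u (of_real (radii n) * z) * g z) \<le> C * norm (g z)" for n
      by (rule AE_I2)
         (use radii_bounds[of n] in \<open>auto simp: norm_mult intro!: mult_right_mono C\<close>)
  qed (use g in auto)
qed

text \<open>
  On each smaller circle \<open>u\<close> is the uniform sum of its Taylor series, so its integral against \<open>g\<close>
  vanishes; dominated convergence carries this to the boundary.
\<close>

lemma boundary_integral_zero:
  assumes u: "u \<in> Hinf" and U: "radial_boundary u U" and g: "integrable circle g"
    and z: "\<And>k::nat. (LINT z|circle. z powi int k * g z) = 0"
  shows "(LINT z|circle. U z * g z) = 0"
proof -
  have "(LINT z|circle. u (of_real (radii n) * z) * g z) = 0" for n
    using dilation_integral[OF u radii_bounds g, of n] unfolding z by (simp add: sums_iff)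
  thus ?thesis using boundary_integral_limit[OF u U g] by (simp add: LIMSEQ_const_iff)
qed

lemma boundary_bounded:
  assumes u: "u \<in> Hinf" and U: "radial_boundary u U"
  obtains C where "AE z in circle. norm (U z) \<le> C"
  using Hinf_bound[OF u] radial_boundary_norm_le[OF U] by metis

text \<open>
  For \<open>n < 0\<close> the function \<open>h z\<^sup>-\<^sup>n\<close> integrates to zero against every \<open>z\<^sup>k\<close> with \<open>k \<ge> 0\<close>, hence against \<open>U\<close>.
\<close>

lemma boundary_mult_H2:
  assumes u: "u \<in> Hinf" and U: "radial_boundary u U" and h: "h \<in> H2"
  shows "(\<lambda>z. U z * h z) \<in> H2"
proof -
  have hL: "h \<in> L2" using h by (rule H2_L2)
  obtain C where C: "AE z in circle. norm (U z) \<le> C" by (rule boundary_bounded[OF u U])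
  have "(\<lambda>z. U z * h z) \<in> L2"
    by (rule L2_bounded_mult[OF hL radial_boundary_measurable[OF U] C])
  moreover have "fourier_coeff (\<lambda>z. U z * h z) n = 0" if n: "n < 0" for n
  proof -
    have "fourier_coeff (\<lambda>z. U z * h z) n = (LINT z|circle. U z * (h z * z powi (- n)))"
      by (simp only: fourier_coeff_conv_integral mult.assoc)
    also have "\<dots> = 0"
    proof (rule boundary_integral_zero[OF u U integrable_mult_powi[OF L2_integrable[OF hL]]])
      fix k :: nat
      have "(LINT z|circle. z powi int k * (h z * z powi (- n))) = (LINT z|circle. h z * z powi (- (n - int k)))"
      proof (rule Bochner_Integration.integral_cong)
        fix z assume "z \<in> space circle"
        hence "z powi int k * z powi (- n) = z powi (- (n - int k))"
          using powi_mult_circle[of z "int k" "- n"] by simp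
        thus "z powi int k * (h z * z powi (- n)) = h z * z powi (- (n - int k))"
          by (metis mult.left_commute)
      qed simp
      also have "\<dots> = fourier_coeff h (n - int k)" by (rule fourier_coeff_conv_integral[symmetric])
      also have "\<dots> = 0" using h n by (simp add: H2_def)
      finally show "(LINT z|circle. z powi int k * (h z * z powi (- n))) = 0" .
    qed
    finally show ?thesis .
  qed
  ultimately show ?thesis by (simp add: H2_def)
qed

lemma const_in_H2: "(\<lambda>z. c) \<in> H2"
  using closed_subspaceD(4)[OF closed_subspace_H2 powi_in_H2[of 0], of c] by simp

lemma boundary_in_H2:
  assumes "u \<in> Hinf" "radial_boundary u U"
  shows "U \<in> H2"
  using boundary_mult_H2[OF assms const_in_H2[of 1]] by simp

lemma boundary_fourier_coeff:
  assumes u: "u \<in> Hinf" and U: "radial_boundary u U"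
  shows "fourier_coeff U (int m) = (deriv ^^ m) u 0 / fact m"
proof -
  let ?a = "\<lambda>k. (deriv ^^ k) u 0 / fact k"
  let ?g = "\<lambda>z. z powi (- int m)"
  have g: "integrable circle ?g" by (intro L2_integrable) simp
  have coeff: "(LINT z|circle. z powi int k * ?g z) = (if k = m then 1 else 0)" for k
    using fourier_coeff_powi[of "int k" "int m"] by (simp add: fourier_coeff_conv_integral)
  have "(LINT z|circle. u (of_real (radii n) * z) * ?g z) = ?a m * of_real (radii n) ^ m" for n
  proof -
    have "(\<lambda>k. (?a k * of_real (radii n) ^ k) * (if k = m then 1 else 0))
            sums (LINT z|circle. u (of_real (radii n) * z) * ?g z)"
      using dilation_integral[OF u radii_bounds g, of n] unfolding coeff .
    moreover have "(\<lambda>k. (?a k * of_real (radii n) ^ k) * (if k = m then 1 else 0)) =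
        (\<lambda>k. if k = m then ?a k * of_real (radii n) ^ k else 0)" by auto
    ultimately have "(\<lambda>k. if k = m then ?a k * of_real (radii n) ^ k else 0)
        sums (LINT z|circle. u (of_real (radii n) * z) * ?g z)" by (simp only:)
    thus ?thesis by (rule sums_unique2[OF _ sums_single])
  qed
  hence "(\<lambda>n. ?a m * of_real (radii n) ^ m) \<longlonglongrightarrow> (LINT z|circle. U z * ?g z)"
    using boundary_integral_limit[OF u U g] by simp
  moreover have "(\<lambda>n. ?a m * of_real (radii n) ^ m) \<longlonglongrightarrow> ?a m * of_real 1 ^ m"
    using filterlim_radii unfolding filterlim_at by (intro tendsto_intros) simp
  ultimately have "(LINT z|circle. U z * ?g z) = ?a m"
    using LIMSEQ_unique by fastforce
  thus ?thesis by (simp add: fourier_coeff_conv_integral)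
qed

text \<open>
  The boundary function has the Taylor coefficients of \<open>u\<close> as its Fourier coefficients, so it determines
  \<open>u\<close> on the disc.
\<close>

lemma boundary_power_series:
  assumes u: "u \<in> Hinf" and U: "radial_boundary u U" and w: "norm w < 1"
  shows "(\<lambda>n. fourier_coeff U (int n) * w ^ n) sums u w"
proof -
  have "(\<lambda>n. (deriv ^^ n) u 0 / fact n * (w - 0) ^ n) sums u w"
    by (rule holomorphic_power_series) (use u w in \<open>auto simp: Hinf_def\<close>)
  thus ?thesis by (simp add: boundary_fourier_coeff[OF u U])
qed

lemma Hinf_eq_if_boundary_eq:
  assumes u: "u \<in> Hinf" "radial_boundary u U" and v: "v \<in> Hinf" "radial_boundary v V"
    and eq: "AE z in circle. U z = V z" and w: "norm w < 1"
  shows "u w = v w"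
proof -
  have "fourier_coeff U n = fourier_coeff V n" for n
    by (rule fourier_coeff_cong_AE[OF eq]) (use u v in \<open>auto simp: radial_boundary_def\<close>)
  thus ?thesis
    using boundary_power_series[OF u w] boundary_power_series[OF v w] sums_unique2 by fastforce
qed

lemma cnj_flip_Hinf:
  assumes "u \<in> Hinf"
  shows "cnj_flip u \<in> Hinf"
proof -
  have eq: "cnj_flip u = cnj \<circ> u \<circ> cnj" by (auto simp: cnj_flip_def flip_def)
  have img: "cnj ` ball 0 1 = ball 0 1"
  proof -
    have "z \<in> cnj ` ball 0 1" if "norm z < 1" for z
      using that by (intro image_eqI[of z cnj "cnj z"]) auto
    thus ?thesis by auto
  qed
  have "cnj_flip u holomorphic_on ball 0 1"
    unfolding eq by (rule holomorphic_on_compose_cnj_cnj) (use assms img in \<open>auto simp: Hinf_def\<close>)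
  moreover obtain C where C: "\<And>z. norm z < 1 \<Longrightarrow> norm (u z) \<le> C"
    using Hinf_bound[OF assms] by blast
  hence "bounded (cnj_flip u ` ball 0 1)"
    unfolding bounded_iff by (intro exI[of _ C]) (auto simp: cnj_flip_def flip_def)
  ultimately show ?thesis by (simp add: Hinf_def)
qed

lemma radial_boundary_cnj_flip:
  assumes "radial_boundary u U"
  shows "radial_boundary (cnj_flip u) (\<lambda>z. cnj (U (cnj z)))"
proof -
  have [measurable]: "U \<in> borel_measurable circle" using assms by (simp add: radial_boundary_def)
  have "AE z in circle. ((\<lambda>r. u (of_real r * z)) \<longlongrightarrow> U z) (at_left 1)"
    using assms by (simp add: radial_boundary_def)
  from AE_circle_cnj[OF this]
  have "AE z in circle. ((\<lambda>r. cnj_flip u (of_real r * z)) \<longlongrightarrow> cnj (U (cnj z))) (at_left 1)"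
    by eventually_elim (auto simp: cnj_flip_def flip_def intro!: tendsto_cnj)
  thus ?thesis by (simp add: radial_boundary_def)
qed


section \<open>Lebesgue points and symmetric kernels\<close>

lemma set_integrable_lborel_const:
  "set_integrable lborel {a..b::real} (\<lambda>_. c :: 'a::{banach, second_countable_topology})"
  unfolding set_integrable_def
  by (intro integrable_scaleR_left integrable_real_indicator) (auto simp: emeasure_lborel_Icc_eq)

text \<open>
  Differentiation of the indefinite integral from the right is applied to \<open>H\<close> and to the reflected
  function; adding the two gives averages over symmetric intervals.
\<close>

lemma AE_lborel_lebesgue_point:
  fixes H :: "real \<Rightarrow> complex"
  assumes "integrable lborel H"
  shows "AE x in lborel. \<forall>e>0. \<exists>d>0. \<forall>s. 0 \<le> s \<and> s < d \<longrightarrow>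
           norm (LINT t:{-s..s}|lborel. H (x + t) - H x) \<le> e * (2 * s)"
proof -
  have right: "AE x in lborel. \<forall>e>0. \<exists>d>0. \<forall>s. 0 \<le> s \<and> s < d \<longrightarrow>
           norm (LINT t:{0..s}|lborel. H (x + t) - H x) \<le> e * s"
    if H: "integrable lborel H" for H :: "real \<Rightarrow> complex"
  proof -
    have on: "set_integrable lborel A H" if "A \<in> sets borel" for A
      unfolding set_integrable_def using that H by (intro integrable_mult_indicator) auto
    have "H integrable_on cbox a b" for a b
      using set_borel_integral_eq_integral(1)[OF on, of "cbox a b"] by simp
    then obtain N where N: "negligible N"
      "\<And>x e. x \<notin> N \<Longrightarrow> 0 < e \<Longrightarrow> \<exists>d>0. \<forall>h. 0 < h \<and> h < d \<longrightarrow>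
           norm (integral (cbox x (x + h *\<^sub>R One)) H /\<^sub>R h ^ DIM(real) - H x) < e"
      using integrable_ccontinuous_explicit[of H] by metis
    have "N \<in> null_sets lebesgue" using N(1) by (simp add: negligible_iff_null_sets)
    hence "AE x in lborel. x \<notin> N"
      using AE_not_in AE_completion_iff by blast
    thus ?thesis
    proof eventually_elim
      case (elim x)
      show ?case
      proof (intro allI impI)
        fix e :: real assume e: "e > 0"
        obtain d where d: "d > 0" "\<And>h. 0 < h \<Longrightarrow> h < d \<Longrightarrow> norm (integral {x..x + h} H /\<^sub>R h - H x) < e"
          using N(2)[OF elim e] by auto
        have "norm (LINT t:{0..s}|lborel. H (x + t) - H x) \<le> e * s" if s: "0 \<le> s" "s < d" for s
        proof (cases "s = 0")
          case True
          thus ?thesis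
            by (simp add: set_lebesgue_integral_def integral_eq_zero_AE AE_lborel_singleton indicator_def)
        next
          case False
          hence s0: "s > 0" using s by simp
          have int: "set_integrable lborel {0..s} (\<lambda>t. H (x + t))"
            using lborel_integrable_real_affine[OF H, of 1 x]
            unfolding set_integrable_def by (intro integrable_mult_indicator) auto
          have "(LINT t:{0..s}|lborel. H (x + t) - H x) = (LINT t:{0..s}|lborel. H (x + t)) - (LINT t:{0..s}|lborel. H x)"
            by (rule set_integral_diff(2)[OF int]) (rule set_integrable_lborel_const)
          also have "(LINT t:{0..s}|lborel. H x) = s *\<^sub>R H x"
            using s0 by (simp add: set_lebesgue_integral_def)
          also have "(LINT t:{0..s}|lborel. H (x + t)) = (LINT t:{x..x+s}|lborel. H t)"
            unfolding set_lebesgue_integral_def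
            by (subst lborel_integral_real_affine[of 1 "\<lambda>t. indicator {x..x+s} t *\<^sub>R H t" x])
               (auto intro!: Bochner_Integration.integral_cong simp: indicator_def)
          also have "\<dots> = integral {x..x+s} H"
            by (rule set_borel_integral_eq_integral(2)[OF on]) simp
          also have "norm (integral {x..x+s} H - s *\<^sub>R H x) = s * norm (integral {x..x + s} H /\<^sub>R s - H x)"
          proof -
            have "integral {x..x+s} H - s *\<^sub>R H x = s *\<^sub>R (integral {x..x + s} H /\<^sub>R s - H x)"
              using s0 by (simp add: scaleR_diff_right)
            thus ?thesis using s0 by simp
          qed
          also have "\<dots> \<le> s * e" using d(2)[OF s0 s(2)] s0 by (intro mult_left_mono) auto
          finally show ?thesis by (simp add: mult.commute)
        qed
        thus "\<exists>d>0. \<forall>s. 0 \<le> s \<and> s < d \<longrightarrow> norm (LINT t:{0..s}|lborel. H (x + t) - H x) \<le> e * s"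
          using d(1) by blast
      qed
    qed
  qed
  have intm: "integrable lborel (\<lambda>t. H (- t))"
    using lborel_integrable_real_affine[OF assms, of "-1" 0] by simp
  have "AE x in distr lborel borel uminus. \<forall>e>0. \<exists>d>0. \<forall>s. 0 \<le> s \<and> s < d \<longrightarrow>
           norm (LINT t:{0..s}|lborel. H (- (x + t)) - H (- x)) \<le> e * s"
    using right[OF intm] by (simp only: lborel_distr_uminus)
  hence left: "AE x in lborel. \<forall>e>0. \<exists>d>0. \<forall>s. 0 \<le> s \<and> s < d \<longrightarrow>
           norm (LINT t:{0..s}|lborel. H (- (- x + t)) - H (- (- x))) \<le> e * s"
    by (rule AE_distrD[rotated]) measurable
  show ?thesis
    using right[OF assms] left
  proof eventually_elim
    case (elim x)
    show ?case
    proof (intro allI impI)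
      fix e :: real assume e: "e > 0"
      obtain d1 where d1: "d1 > 0" "\<And>s. 0 \<le> s \<Longrightarrow> s < d1 \<Longrightarrow> norm (LINT t:{0..s}|lborel. H (x + t) - H x) \<le> e * s"
        using elim(1) e by blast
      obtain d2 where d2: "d2 > 0" "\<And>s. 0 \<le> s \<Longrightarrow> s < d2 \<Longrightarrow> norm (LINT t:{0..s}|lborel. H (- (- x + t)) - H (- (- x))) \<le> e * s"
        using elim(2) e by blast
      have "norm (LINT t:{-s..s}|lborel. H (x + t) - H x) \<le> e * (2 * s)" if s: "0 \<le> s" "s < min d1 d2" for s
      proof -
        let ?f = "\<lambda>t. H (x + t) - H x"
        have on: "set_integrable lborel {a..b} ?f" for a b
        proof (rule set_integral_diff(1))
          show "set_integrable lborel {a..b} (\<lambda>t. H (x + t))"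
            using lborel_integrable_real_affine[OF assms, of 1 x]
            unfolding set_integrable_def by (intro integrable_mult_indicator) auto
        qed (rule set_integrable_lborel_const)
        have "(LINT t:{-s..s}|lborel. ?f t) = (LINT t:{-s..0}|lborel. ?f t) + (LINT t:{0<..s}|lborel. ?f t)"
        proof (subst set_integral_Un[symmetric])
          show "set_integrable lborel {0<..s} ?f" by (rule set_integrable_subset[OF on[of 0 s]]) auto
          have "{-s..0} \<union> {0<..s} = {-s..s}" using s by auto
          thus "(LINT t:{-s..s}|lborel. ?f t) = (LINT t:{-s..0} \<union> {0<..s}|lborel. ?f t)" by simp
        qed (use on in auto)
        also have "(LINT t:{0<..s}|lborel. ?f t) = (LINT t:{0..s}|lborel. ?f t)"
          unfolding set_lebesgue_integral_def
        proof (rule integral_cong_AE)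
          show "AE t in lborel. indicator {0<..s} t *\<^sub>R ?f t = indicator {0..s} t *\<^sub>R ?f t"
            using AE_lborel_singleton[of 0] by eventually_elim (auto simp: indicator_def)
          have [measurable]: "H \<in> borel_measurable borel" using assms by auto
          show "(\<lambda>t. indicator {0<..s} t *\<^sub>R ?f t) \<in> borel_measurable lborel"
            "(\<lambda>t. indicator {0..s} t *\<^sub>R ?f t) \<in> borel_measurable lborel" by measurable
        qed
        also have "(LINT t:{-s..0}|lborel. ?f t) = (LINT t:{0..s}|lborel. ?f (- t))"
          unfolding set_lebesgue_integral_def
          by (subst lborel_integral_real_affine[of "-1" _ 0])
             (auto intro!: Bochner_Integration.integral_cong simp: indicator_def)
        also have "norm ((LINT t:{0..s}|lborel. ?f (- t)) + (LINT t:{0..s}|lborel. ?f t)) \<le> e * s + e * s"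
        proof (rule norm_triangle_mono)
          show "norm (LINT t:{0..s}|lborel. ?f (- t)) \<le> e * s" using d2(2)[of s] s by simp
          show "norm (LINT t:{0..s}|lborel. ?f t) \<le> e * s" using d1(2)[of s] s by simp
        qed
        finally show ?thesis by simp
      qed
      thus "\<exists>d>0. \<forall>s. 0 \<le> s \<and> s < d \<longrightarrow> norm (LINT t:{-s..s}|lborel. H (x + t) - H x) \<le> e * (2 * s)"
        using d1(1) d2(1) by (intro exI[of _ "min d1 d2"]) auto
    qed
  qed
qed

text \<open>
  The region under the graph of \<open>k\<close>, weighted by \<open>G\<close>. Integration over \<open>y\<close> gives \<open>k t\<close> times \<open>G t\<close>, while
  integration over \<open>t\<close> at height \<open>y\<close> sees only the set where \<open>k > y\<close>.
\<close>

definition layer :: "(real \<Rightarrow> real) \<Rightarrow> (real \<Rightarrow> 'a) \<Rightarrow> real \<Rightarrow> real \<Rightarrow> 'a::real_normed_vector" where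
  "layer k G t y = indicator {0..<k t} y *\<^sub>R G t"

lemma layer_integral:
  fixes G :: "real \<Rightarrow> 'a::{banach, second_countable_topology}"
  assumes "k t \<ge> 0"
  shows "(LINT y|lborel. layer k G t y) = k t *\<^sub>R G t"
  using assms by (simp add: layer_def)

lemma layer_integrable:
  fixes G :: "real \<Rightarrow> 'a::{banach, second_countable_topology}"
  assumes G: "integrable lborel G" and k[measurable]: "k \<in> borel_measurable borel"
    and kb: "\<And>t. 0 \<le> k t" "\<And>t. k t \<le> K"
  shows "integrable (lborel \<Otimes>\<^sub>M lborel) (\<lambda>(t, y). layer k G t y)"
proof (rule lborel_pair.Fubini_integrable)
  have [measurable]: "G \<in> borel_measurable borel" using G by auto
  have eq: "(\<lambda>(t, y). layer k G t y) = (\<lambda>p. if 0 \<le> snd p \<and> snd p < k (fst p) then G (fst p) else 0)"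
    by (auto simp: layer_def fun_eq_iff indicator_def)
  show "(\<lambda>(t, y). layer k G t y) \<in> borel_measurable (lborel \<Otimes>\<^sub>M lborel)"
    unfolding eq by measurable
  have "(LINT y|lborel. norm (case (t, y) of (t, y) \<Rightarrow> layer k G t y)) = k t * norm (G t)" for t
    using layer_integral[of k t "\<lambda>t. norm (G t)"] kb by (simp add: layer_def)
  moreover have "integrable lborel (\<lambda>t. k t * norm (G t))"
    by (rule Bochner_Integration.integrable_bound[of _ "\<lambda>t. K * norm (G t)"])
       (use G kb order_trans[OF kb] in \<open>auto intro!: AE_I2 mult_right_mono simp: abs_mult\<close>)
  ultimately show "integrable lborel (\<lambda>t. LINT y|lborel. norm (case (t, y) of (t, y) \<Rightarrow> layer k G t y))"
    by simp
  show "AE t in lborel. integrable lborel (\<lambda>y. case (t, y) of (t, y) \<Rightarrow> layer k G t y)"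
    using kb by (simp add: layer_def)
qed

lemma symmetric_set_interval:
  fixes A :: "real set"
  assumes A: "A \<subseteq> {-d..d}" "A \<noteq> {}" and sym: "\<And>s t. t \<in> A \<Longrightarrow> \<bar>s\<bar> \<le> \<bar>t\<bar> \<Longrightarrow> s \<in> A"
  obtains s where "0 \<le> s" "s \<le> d" "{-s<..<s} \<subseteq> A" "A \<subseteq> {-s..s}"
proof -
  define s where "s = Sup (abs ` A)"
  have le_d: "\<bar>t\<bar> \<le> d" if "t \<in> A" for t using A(1) that by (force simp: abs_le_iff)
  have bdd: "bdd_above (abs ` A)" by (intro bdd_aboveI[of _ d]) (use le_d in auto)
  have up: "\<bar>t\<bar> \<le> s" if "t \<in> A" for t unfolding s_def by (rule cSup_upper[OF _ bdd]) (use that in auto)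
  show ?thesis
  proof (rule that[of s])
    show "0 \<le> s" using A(2) up abs_ge_zero order_trans by blast
    show "s \<le> d" unfolding s_def by (rule cSup_least) (use A le_d in auto)
    show "A \<subseteq> {-s..s}" using up by (auto simp: abs_le_iff) (metis abs_le_iff minus_le_iff up)
    show "{-s<..<s} \<subseteq> A"
    proof
      fix t assume "t \<in> {-s<..<s}"
      hence "\<bar>t\<bar> < Sup (abs ` A)" by (auto simp: s_def)
      then obtain a where "a \<in> A" "\<bar>t\<bar> < \<bar>a\<bar>" using less_cSup_iff[OF _ bdd] A(2) by auto
      thus "t \<in> A" using sym less_imp_le by blast
    qed
  qed
qed

text \<open>
  A kernel that is even and decreasing away from 0 is a superposition of indicators of symmetric
  intervals, namely of the sets where \<open>k > y\<close>. Hence a bound for the averages of \<open>g\<close> over such intervals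
  passes to the integral of \<open>g\<close> against \<open>k\<close>.
\<close>

lemma averages_bound_kernel:
  fixes g :: "real \<Rightarrow> complex"
  assumes g: "set_integrable lborel {-d..d} g" and k[measurable]: "k \<in> borel_measurable borel"
    and kb: "\<And>t. 0 \<le> k t" "\<And>t. k t \<le> K"
    and mono: "\<And>s t. \<bar>s\<bar> \<le> \<bar>t\<bar> \<Longrightarrow> \<bar>t\<bar> \<le> d \<Longrightarrow> k t \<le> k s"
    and avg: "\<And>s. 0 \<le> s \<Longrightarrow> s \<le> d \<Longrightarrow> norm (LINT t:{-s..s}|lborel. g t) \<le> e * (2 * s)"
  shows "norm (LINT t:{-d..d}|lborel. k t *\<^sub>R g t) \<le> e * (LINT t:{-d..d}|lborel. k t)"
proof -
  define G where "G t = indicator {-d..d} t *\<^sub>R g t" for t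
  define I :: "real \<Rightarrow> real" where "I t = indicator {-d..d} t" for t
  have G: "integrable lborel G" using g by (simp add: G_def[abs_def] set_integrable_def)
  have I: "integrable lborel I"
    using set_integrable_lborel_const[of "-d" d "1::real"] by (simp add: I_def[abs_def] set_integrable_def)
  have [measurable]: "G \<in> borel_measurable borel" "I \<in> borel_measurable borel" using G I by auto
  note LG = layer_integrable[OF G k kb] and LI = layer_integrable[OF I k kb]
  have slice: "norm (LINT t|lborel. layer k G t y) \<le> e * (LINT t|lborel. layer k I t y)" for y
  proof -
    define A where "A = {t\<in>{-d..d}. 0 \<le> y \<and> y < k t}"
    have layA: "layer k F t y = indicator A t *\<^sub>R f t" if "F t = indicator {-d..d} t *\<^sub>R f t"
      for F f :: "real \<Rightarrow> 'b::real_normed_vector" and t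
      using that by (auto simp: layer_def A_def indicator_def)
    show ?thesis
    proof (cases "A = {}")
      case True
      have "layer k G t y = 0" "layer k I t y = 0" for t
        using layA[of G t g] layA[of I t "\<lambda>_. 1"] True by (auto simp: G_def I_def)
      thus ?thesis by simp
    next
      case False
      have sym: "s \<in> A" if "t \<in> A" "\<bar>s\<bar> \<le> \<bar>t\<bar>" for s t
      proof -
        have "\<bar>t\<bar> \<le> d" using that(1) by (auto simp: A_def abs_le_iff)
        thus ?thesis using that mono[of s t] unfolding A_def by auto
      qed
      have "A \<subseteq> {-d..d}" by (auto simp: A_def)
      then obtain s where s: "0 \<le> s" "s \<le> d" "{-s<..<s} \<subseteq> A" "A \<subseteq> {-s..s}"
        by (rule symmetric_set_interval[OF _ False sym])
      have [measurable]: "A \<in> sets borel" unfolding A_def by measurable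
      have eq: "AE t in lborel. indicator A t *\<^sub>R G t = indicator {-s..s} t *\<^sub>R g t"
          "AE t in lborel. indicator A t = (indicator {-s..s} t :: real)"
        using AE_lborel_singleton[of s] AE_lborel_singleton[of "-s"]
        by (eventually_elim; use s in \<open>force simp: indicator_def G_def\<close>)+
      have "(LINT t|lborel. layer k G t y) = (LINT t|lborel. indicator A t *\<^sub>R G t)"
        by (rule Bochner_Integration.integral_cong) (auto simp: layer_def G_def A_def indicator_def)
      also have "\<dots> = (LINT t:{-s..s}|lborel. g t)"
        unfolding set_lebesgue_integral_def
      proof (rule integral_cong_AE[OF _ _ eq(1)])
        have "indicator {-s..s} t *\<^sub>R g t = indicator {-s..s} t *\<^sub>R G t" for t
          using s by (auto simp: G_def indicator_def)
        hence "(\<lambda>t. indicator {-s..s} t *\<^sub>R g t) = (\<lambda>t. indicator {-s..s} t *\<^sub>R G t)" by (rule ext)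
        moreover have "(\<lambda>t. indicator {-s..s} t *\<^sub>R G t) \<in> borel_measurable lborel" by measurable
        ultimately show "(\<lambda>t. indicator {-s..s} t *\<^sub>R g t) \<in> borel_measurable lborel" by (simp only:)
      qed simp
      finally have 1: "norm (LINT t|lborel. layer k G t y) \<le> e * (2 * s)" using avg[OF s(1,2)] by simp
      have "(LINT t|lborel. layer k I t y) = (LINT t|lborel. indicator A t)"
        by (rule Bochner_Integration.integral_cong) (auto simp: layer_def I_def A_def indicator_def)
      also have "\<dots> = (LINT t|lborel. indicator {-s..s} t)"
        by (rule integral_cong_AE[OF _ _ eq(2)]) auto
      also have "\<dots> = 2 * s" using s by simp
      finally show ?thesis using 1 by simp
    qed
  qed
  have "(LINT t:{-d..d}|lborel. k t *\<^sub>R g t) = (LINT t|lborel. (LINT y|lborel. layer k G t y))"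
    unfolding set_lebesgue_integral_def
    by (rule Bochner_Integration.integral_cong) (simp_all add: layer_integral kb G_def scaleR_left_commute)
  also have "\<dots> = (LINT y|lborel. (LINT t|lborel. layer k G t y))"
    by (rule lborel_pair.Fubini_integral[OF LG, symmetric])
  also have "norm \<dots> \<le> (LINT y|lborel. e * (LINT t|lborel. layer k I t y))"
    by (rule Bochner_Integration.integral_norm_bound_integral)
       (use lborel_pair.integrable_snd[OF LG] lborel_pair.integrable_snd[OF LI] slice in auto)
  also have "\<dots> = e * (LINT t|lborel. (LINT y|lborel. layer k I t y))"
    by (simp add: lborel_pair.Fubini_integral[OF LI])
  also have "(LINT t|lborel. (LINT y|lborel. layer k I t y)) = (LINT t:{-d..d}|lborel. k t)"
    unfolding set_lebesgue_integral_def
    by (rule Bochner_Integration.integral_cong) (simp_all add: layer_integral kb I_def mult.commute)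
  finally show ?thesis .
qed

section \<open>Poisson integrals and the theorem of Fatou\<close>

definition poisson :: "complex \<Rightarrow> complex \<Rightarrow> real" where
  "poisson w z = (1 - (norm w)\<^sup>2) / (norm (1 - w * cnj z))\<^sup>2"

definition poisson_ext :: "(complex \<Rightarrow> complex) \<Rightarrow> complex \<Rightarrow> complex" where
  "poisson_ext h w = (LINT z|circle. complex_of_real (poisson w z) * h z)"

lemma poisson_nonneg: "norm w < 1 \<Longrightarrow> poisson w z \<ge> 0"
  unfolding poisson_def by (intro divide_nonneg_nonneg) (auto simp: power_le_one)

lemma one_minus_cnj_nonzero:
  assumes "norm w < 1" "norm z = 1"
  shows "1 - w * cnj z \<noteq> (0::complex)"
proof
  assume "1 - w * cnj z = 0"
  hence "norm (w * cnj z) = norm (1::complex)" by simp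
  thus False using assms by (simp add: norm_mult)
qed

lemma poisson_continuous:
  assumes "norm w < 1"
  shows "continuous_on (sphere 0 1) (poisson w)"
  unfolding poisson_def
  by (intro continuous_intros) (use one_minus_cnj_nonzero[OF assms] in auto)

lemma poisson_measurable:
  "norm w < 1 \<Longrightarrow> poisson w \<in> borel_measurable circle"
  by (intro borel_measurable_circle_continuous poisson_continuous)

text \<open>
  The first series is the analytic part of the Poisson kernel in \<open>w\<close>, the second the antianalytic part.
\<close>

lemma poisson_split:
  assumes w: "norm w < 1" and z: "norm z = 1"
  shows "complex_of_real (poisson w z) = (\<Sum>k. w ^ k * z powi (- int k)) + (\<Sum>k. cnj w ^ Suc k * z powi int (Suc k))"
proof -
  let ?a = "w * cnj z"
  have a: "norm ?a < 1" using w z by (simp add: norm_mult)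
  have zi: "z powi (- int k) = cnj z ^ k" for k
    using cnj_powi_circle[of z "int k"] z by simp
  have "(\<Sum>k. w ^ k * z powi (- int k)) = (\<Sum>k. ?a ^ k)" by (simp only: zi power_mult_distrib)
  also have "\<dots> = 1 / (1 - ?a)" by (rule suminf_geometric[OF a])
  finally have 1: "(\<Sum>k. w ^ k * z powi (- int k)) = 1 / (1 - ?a)" .
  have "(\<Sum>k. cnj w ^ Suc k * z powi int (Suc k)) = (\<Sum>k. cnj ?a * cnj ?a ^ k)"
    by (simp only: power_int_of_nat) (simp add: power_mult_distrib mult_ac)
  also have "\<dots> = cnj ?a * (1 / (1 - cnj ?a))"
    using a by (subst suminf_mult) (auto simp: suminf_geometric complete_algebra_summable_geometric
        simp flip: complex_cnj_mult)
  finally have 2: "(\<Sum>k. cnj w ^ Suc k * z powi int (Suc k)) = cnj ?a / (1 - cnj ?a)" by simp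
  have nz1: "1 - ?a \<noteq> 0" by (rule one_minus_cnj_nonzero[OF assms])
  hence "cnj (1 - ?a) \<noteq> 0" by (subst complex_cnj_zero_iff)
  hence nz2: "1 - cnj ?a \<noteq> 0" unfolding complex_cnj_diff complex_cnj_one .
  note nz = nz1 nz2
  have "1 / (1 - ?a) + cnj ?a / (1 - cnj ?a) = (1 - ?a * cnj ?a) / ((1 - ?a) * (1 - cnj ?a))"
    using nz by (simp add: divide_simps) (simp add: algebra_simps)
  also have "(1 - ?a) * (1 - cnj ?a) = complex_of_real ((norm (1 - ?a))\<^sup>2)"
    by (simp add: complex_norm_square del: of_real_power)
  also have "?a * cnj ?a = complex_of_real ((norm w)\<^sup>2)"
    using z complex_norm_square[of ?a] by (simp add: norm_mult del: of_real_power complex_cnj_mult)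
  finally show ?thesis unfolding 1 2 poisson_def by simp
qed

lemma poisson_ext_series:
  assumes h: "integrable circle h" and w: "norm w < 1"
  shows "summable (\<lambda>k. w ^ k * (LINT z|circle. z powi (- int k) * h z))"
    and "poisson_ext h w = (\<Sum>k. w ^ k * (LINT z|circle. z powi (- int k) * h z)) +
           (\<Sum>k. cnj w ^ Suc k * (LINT z|circle. z powi int (Suc k) * h z))"
proof -
  have sw: "summable (\<lambda>k. norm (w ^ k))" using w by (simp add: norm_power summable_geometric)
  have sw': "summable (\<lambda>k. norm (cnj w ^ Suc k))"
    using w by (simp add: norm_power norm_mult summable_geometric summable_mult)
  have b: "norm (z powi n) \<le> 1" if "z \<in> sphere 0 1" for z :: complex and n
    using that by (simp add: norm_power_int)
  let ?S1 = "\<lambda>z. \<Sum>k. w ^ k * z powi (- int k)" and ?S2 = "\<lambda>z. \<Sum>k. cnj w ^ Suc k * z powi int (Suc k)"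
  note s1 = integral_series[OF sw h measurable_powi_circle b, of "\<lambda>k. - int k"]
  note s2 = integral_series[OF sw' h measurable_powi_circle b, of "\<lambda>k. int (Suc k)"]
  have "poisson_ext h w = (LINT z|circle. ?S1 z * h z + ?S2 z * h z)"
    unfolding poisson_ext_def
    by (rule Bochner_Integration.integral_cong) (simp_all only: space_circle poisson_split[OF w] mem_sphere_0 ring_distribs)
  also have "\<dots> = (LINT z|circle. ?S1 z * h z) + (LINT z|circle. ?S2 z * h z)"
    by (rule Bochner_Integration.integral_add)
       (rule integrable_series[OF sw h measurable_powi_circle b] integrable_series[OF sw' h measurable_powi_circle b]; assumption)+
  finally show "poisson_ext h w = (\<Sum>k. w ^ k * (LINT z|circle. z powi (- int k) * h z)) +
           (\<Sum>k. cnj w ^ Suc k * (LINT z|circle. z powi int (Suc k) * h z))"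
    by (simp only: sums_unique[OF s1] sums_unique[OF s2])
  show "summable (\<lambda>k. w ^ k * (LINT z|circle. z powi (- int k) * h z))"
    by (rule sums_summable[OF s1])
qed

text \<open>
  The antianalytic part of the kernel only meets Fourier coefficients of negative index, which vanish
  for \<open>h \<in> H\<^sup>2\<close>.
\<close>

lemma poisson_ext_H2:
  assumes h: "h \<in> H2" and w: "norm w < 1"
  shows "(\<lambda>n. fourier_coeff h (int n) * w ^ n) sums poisson_ext h w"
proof -
  have int: "integrable circle h" using h by (intro L2_integrable H2_L2)
  have "(LINT z|circle. z powi int (Suc k) * h z) = fourier_coeff h (- int (Suc k))" for k
    by (simp only: fourier_coeff_conv_integral minus_minus mult.commute)
  also have "fourier_coeff h (- int (Suc k)) = 0" for k using h unfolding H2_def by simp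
  finally have "(\<lambda>k. w ^ k * (LINT z|circle. z powi (- int k) * h z)) sums poisson_ext h w"
    using poisson_ext_series[OF int w] by (simp only: mult_zero_right suminf_zero add_0_right summable_sums)
  moreover have "w ^ k * (LINT z|circle. z powi (- int k) * h z) = fourier_coeff h (int k) * w ^ k" for k
    by (simp only: fourier_coeff_conv_integral mult.commute)
  ultimately show ?thesis by (simp only:)
qed

lemma poisson_integral_one:
  assumes "norm w < 1"
  shows "(LINT z|circle. complex_of_real (poisson w z)) = 1"
proof -
  have "(\<lambda>n. fourier_coeff (\<lambda>z. 1) (int n) * w ^ n) sums poisson_ext (\<lambda>z. 1) w"
    by (rule poisson_ext_H2[OF const_in_H2 assms])
  moreover have "fourier_coeff (\<lambda>z. 1) (int n) = (if n = 0 then 1 else 0)" for n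
    using fourier_coeff_powi[of 0 "int n"] by simp
  hence "(\<lambda>n. fourier_coeff (\<lambda>z. 1) (int n) * w ^ n) = (\<lambda>n. if n = 0 then w ^ n else 0)"
    by (simp add: fun_eq_iff)
  ultimately have "poisson_ext (\<lambda>z. 1) w = 1"
    using sums_unique2[OF _ sums_single[of 0 "\<lambda>n. w ^ n"]] by simp
  thus ?thesis by (simp add: poisson_ext_def)
qed

lemma poisson_ext_bound:
  assumes [measurable]: "h \<in> borel_measurable circle" and b: "AE z in circle. norm (h z) \<le> C" and w: "norm w < 1"
  shows "norm (poisson_ext h w) \<le> C"
proof -
  have [measurable]: "poisson w \<in> borel_measurable circle" by (rule poisson_measurable[OF w])
  obtain B where "\<forall>y\<in>poisson w ` sphere 0 1. norm y \<le> B"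
    using compact_imp_bounded[OF compact_continuous_image[OF poisson_continuous[OF w] compact_sphere]]
    unfolding bounded_iff by blast
  hence B: "norm (poisson w z) \<le> B" if "z \<in> sphere 0 1" for z using that by blast
  have hL: "h \<in> L2" by (rule L2_bounded[OF _ b]) simp
  have intp: "integrable circle (\<lambda>z. complex_of_real (poisson w z))"
    by (rule L2_integrable, rule L2_bounded[where C = B]) (use B in auto)
  have inth: "integrable circle (\<lambda>z. complex_of_real (poisson w z) * h z)"
    using integrable_mult_bounded[OF intp _ b] by simp
  have "norm (poisson_ext h w) \<le> (LINT z|circle. norm (complex_of_real (poisson w z) * h z))"
    unfolding poisson_ext_def by simp
  also have "\<dots> \<le> (LINT z|circle. C * poisson w z)"
  proof (rule integral_mono_AE)
    show "AE z in circle. norm (complex_of_real (poisson w z) * h z) \<le> C * poisson w z"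
      using b by eventually_elim (simp add: norm_mult poisson_nonneg[OF w] mult.commute mult_right_mono)
    show "integrable circle (\<lambda>z. C * poisson w z)"
      using integrable_Re[OF intp] by simp
  qed (use inth in simp)
  also have "\<dots> = C * (LINT z|circle. poisson w z)" by simp
  also have "(LINT z|circle. poisson w z) = 1"
    using poisson_integral_one[OF w] by simp
  finally show ?thesis by simp
qed

lemma poisson_ext_Hinf:
  assumes h: "h \<in> H2" and b: "AE z in circle. norm (h z) \<le> C"
  shows "poisson_ext h \<in> Hinf"
proof -
  have "poisson_ext h holomorphic_on ball 0 1"
    by (rule power_series_holomorphic[where a = "\<lambda>n. fourier_coeff h (int n)"])
       (use poisson_ext_H2[OF h] in simp)
  moreover have "bounded (poisson_ext h ` ball 0 1)"
    unfolding bounded_iff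
    by (intro exI[of _ C]) (use poisson_ext_bound[OF L2_measurable[OF H2_L2[OF h]] b] in auto)
  ultimately show ?thesis by (simp add: Hinf_def)
qed


text \<open>
  The Poisson kernel as a function of the angle between \<open>w = r e\<^sup>i\<^sup>x\<close> and \<open>z = e\<^sup>i\<^sup>t\<close>, see \<open>poisson_polar\<close>.
\<close>

definition poisson_angle :: "real \<Rightarrow> real \<Rightarrow> real" where
  "poisson_angle r s = (1 - r\<^sup>2) / (1 - 2 * r * cos s + r\<^sup>2)"

lemma poisson_polar: "poisson (of_real r * cis x) (cis t) = poisson_angle r (t - x)"
proof -
  have "of_real r * cis x * cnj (cis t) = of_real r * cis (x - t)"
    by (simp add: cis_cnj cis_mult mult.assoc)
  also have "(norm (1 - of_real r * cis (x - t)))\<^sup>2 = (1 - r * cos (x - t))\<^sup>2 + (r * sin (x - t))\<^sup>2"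
    by (simp add: cmod_power2)
  also have "\<dots> = 1 - 2 * r * cos (x - t) + r\<^sup>2 * ((sin (x - t))\<^sup>2 + (cos (x - t))\<^sup>2)"
    by algebra
  also have "\<dots> = 1 - 2 * r * cos (t - x) + r\<^sup>2"
    using cos_minus[of "x - t"] by simp
  finally show ?thesis
    by (simp add: poisson_def poisson_angle_def norm_mult)
qed

lemma poisson_angle_denominator:
  fixes r :: real
  assumes "0 \<le> r" "r < 1"
  shows "(1 - r)\<^sup>2 \<le> 1 - 2 * r * cos s + r\<^sup>2" "0 < 1 - 2 * r * cos s + r\<^sup>2"
proof -
  have "r * cos s \<le> r * 1" using assms by (intro mult_left_mono) auto
  thus 1: "(1 - r)\<^sup>2 \<le> 1 - 2 * r * cos s + r\<^sup>2" by (simp add: power2_eq_square algebra_simps)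
  have "0 < (1 - r)\<^sup>2" using assms by simp
  with 1 show "0 < 1 - 2 * r * cos s + r\<^sup>2" by linarith
qed

lemma poisson_angle_nonneg: "0 \<le> r \<Longrightarrow> r < 1 \<Longrightarrow> 0 \<le> poisson_angle r s"
  unfolding poisson_angle_def
  by (intro divide_nonneg_nonneg less_imp_le[OF poisson_angle_denominator(2)]) (auto simp: power_le_one)

lemma poisson_angle_le:
  assumes "0 \<le> r" "r < 1"
  shows "poisson_angle r s \<le> (1 - r\<^sup>2) / (1 - r)\<^sup>2"
  unfolding poisson_angle_def using assms
  by (intro divide_left_mono poisson_angle_denominator mult_pos_pos) (auto simp: power_le_one)

lemma poisson_angle_measurable [measurable]: "poisson_angle r \<in> borel_measurable borel"
  unfolding poisson_angle_def by measurable

lemma poisson_angle_cos_mono: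
  assumes "0 \<le> r" "r < 1" "cos t \<le> cos s"
  shows "poisson_angle r t \<le> poisson_angle r s"
  unfolding poisson_angle_def
proof (rule divide_left_mono)
  show "1 - 2 * r * cos s + r\<^sup>2 \<le> 1 - 2 * r * cos t + r\<^sup>2"
    using mult_left_mono[OF assms(3), of "2 * r"] assms by simp
qed (use assms poisson_angle_denominator in \<open>auto simp: power_le_one\<close>)

lemma poisson_angle_mono:
  assumes "0 \<le> r" "r < 1" "\<bar>s\<bar> \<le> \<bar>t\<bar>" "\<bar>t\<bar> \<le> pi"
  shows "poisson_angle r t \<le> poisson_angle r s"
proof (rule poisson_angle_cos_mono[OF assms(1,2)])
  have "cos \<bar>t\<bar> \<le> cos \<bar>s\<bar>" using assms by (intro cos_monotone_0_pi_le) auto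
  thus "cos t \<le> cos s" by simp
qed

lemma poisson_angle_far:
  assumes "0 \<le> r" "r < 1" and c: "cos s \<le> cos d" and d: "sin d \<noteq> 0"
  shows "poisson_angle r s \<le> (1 - r\<^sup>2) / (sin d)\<^sup>2"
proof -
  have "(sin d)\<^sup>2 \<le> (r - cos d)\<^sup>2 + (sin d)\<^sup>2" by simp
  also have "\<dots> = 1 - 2 * r * cos d + r\<^sup>2"
    using sin_cos_squared_add[of d] by (simp add: power2_diff)
  finally have "poisson_angle r d \<le> (1 - r\<^sup>2) / (sin d)\<^sup>2"
    unfolding poisson_angle_def using assms poisson_angle_denominator[OF assms(1,2), of d]
    by (intro divide_left_mono mult_pos_pos) (auto simp: power_le_one)
  thus ?thesis using poisson_angle_cos_mono[OF assms(1-3)] by linarith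
qed

lemma poisson_angle_set_integrable:
  assumes "0 \<le> r" "r < 1"
  shows "set_integrable lborel {a..b} (\<lambda>t. poisson_angle r (t - x))"
  unfolding set_integrable_def
proof (rule Bochner_Integration.integrable_bound)
  show "integrable lborel (\<lambda>t. indicator {a..b} t *\<^sub>R ((1 - r\<^sup>2) / (1 - r)\<^sup>2))"
    using set_integrable_lborel_const unfolding set_integrable_def .
  show "AE t in lborel. norm (indicator {a..b} t *\<^sub>R poisson_angle r (t - x))
      \<le> norm (indicator {a..b} t *\<^sub>R ((1 - r\<^sup>2) / (1 - r)\<^sup>2))"
    using poisson_angle_nonneg[OF assms]
    by (intro AE_I2) (auto simp: indicator_def abs_of_nonneg
          intro!: order_trans[OF poisson_angle_le[OF assms]] divide_right_mono)
qed measurable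

lemma poisson_angle_integral:
  assumes "0 \<le> r" "r < 1"
  shows "(LINT t:{0..2*pi}|lborel. poisson_angle r (t - x)) = 2 * pi"
proof -
  let ?w = "of_real r * cis x"
  have w: "norm ?w < 1" using assms by (simp add: norm_mult)
  have [measurable]: "poisson ?w \<in> borel_measurable circle" by (rule poisson_measurable[OF w])
  have "1 = (LINT z|circle. complex_of_real (poisson ?w z))"
    by (rule poisson_integral_one[OF w, symmetric])
  also have "\<dots> = (LINT t:{0..2*pi}|lborel. complex_of_real (poisson ?w (cis t))) / (2 * pi)"
    by (rule integral_circle) measurable
  finally have "complex_of_real (2 * pi) = (LINT t:{0..2*pi}|lborel. complex_of_real (poisson ?w (cis t)))"
    by (simp add: field_simps)
  also have "\<dots> = complex_of_real (LINT t:{0..2*pi}|lborel. poisson_angle r (t - x))"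
    unfolding poisson_polar by (rule set_integral_complex_of_real)
  finally show ?thesis using of_real_eq_iff by metis
qed

text \<open>
  Within distance \<open>d\<close> of \<open>x\<close> the kernel is even and decreasing, so the Lebesgue point condition bounds
  that part of the integral. At greater distance the kernel tends to 0 uniformly as \<open>r\<close> tends to 1.
\<close>

lemma poisson_integral_converges:
  fixes H :: "real \<Rightarrow> complex"
  assumes H: "integrable lborel H" and x: "0 < x" "x < 2 * pi"
    and leb: "\<forall>e>0. \<exists>d>0. \<forall>s. 0 \<le> s \<and> s < d \<longrightarrow>
           norm (LINT t:{-s..s}|lborel. H (x + t) - H x) \<le> e * (2 * s)"
  shows "((\<lambda>r. (LINT t:{0..2*pi}|lborel. poisson_angle r (t - x) *\<^sub>R H t) / (2 * pi)) \<longlongrightarrow> H x) (at_left 1)"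
proof (rule tendstoI)
  fix e :: real assume e: "e > 0"
  let ?I = "\<lambda>r. (LINT t:{0..2*pi}|lborel. poisson_angle r (t - x) *\<^sub>R H t) / (2 * pi)"
  have [measurable]: "H \<in> borel_measurable borel" using H by auto
  obtain d0 where d0: "d0 > 0" "\<And>s. 0 \<le> s \<Longrightarrow> s < d0 \<Longrightarrow>
      norm (LINT t:{-s..s}|lborel. H (x + t) - H x) \<le> e / 2 * (2 * s)"
    using leb e half_gt_zero by metis
  \<comment> \<open>Small enough for the Lebesgue point condition and for \<open>[x - d, x + d]\<close> to stay inside \<open>(0, 2\<pi>)\<close>.\<close>
  define d where "d = min (d0 / 2) (min (x / 2) ((2 * pi - x) / 2))"
  have d_le: "d \<le> d0 / 2" "d \<le> x / 2" "d \<le> (2 * pi - x) / 2" unfolding d_def by linarith+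
  have d: "0 < d" "d < d0" "d < x" "x + d < 2 * pi" "d < pi"
    using d_le d0(1) x by (simp_all add: d_def)
  have sd: "sin d > 0" using d by (intro sin_gt_zero) auto
  have intH: "set_integrable lborel A H" if "A \<in> sets borel" for A
    unfolding set_integrable_def using that H by (intro integrable_mult_indicator) auto
  have intD: "set_integrable lborel {a..b} (\<lambda>t. H t - H x)" for a b
    by (intro set_integral_diff intH set_integrable_lborel_const) auto
  define D where "D = (LINT t:{0..2*pi}|lborel. norm (H t - H x))"
  have main: "norm (?I r - H x) \<le> e / 2 + (1 - r\<^sup>2) / (sin d)\<^sup>2 * D / (2 * pi)" if r: "0 \<le> r" "r < 1" for r
  proof -
    let ?k = "\<lambda>t. poisson_angle r (t - x)"
    let ?K = "(1 - r\<^sup>2) / (1 - r)\<^sup>2" and ?B = "(1 - r\<^sup>2) / (sin d)\<^sup>2"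
    note k0 = poisson_angle_nonneg[OF r] and kK = poisson_angle_le[OF r]
    have intk: "set_integrable lborel A (\<lambda>t. ?k t *\<^sub>R f t)" if A: "A \<in> sets borel" and f: "set_integrable lborel A f"
      for A and f :: "real \<Rightarrow> complex"
      unfolding set_integrable_def
    proof (rule Bochner_Integration.integrable_bound)
      show "integrable lborel (\<lambda>t. ?K *\<^sub>R (indicator A t *\<^sub>R f t))"
        using f unfolding set_integrable_def by (rule integrable_scaleR_right)
      have [measurable]: "(\<lambda>t. indicator A t *\<^sub>R f t) \<in> borel_measurable borel"
        using f unfolding set_integrable_def by auto
      have "(\<lambda>t. ?k t *\<^sub>R (indicator A t *\<^sub>R f t)) \<in> borel_measurable lborel" by measurable
      thus "(\<lambda>t. indicator A t *\<^sub>R ?k t *\<^sub>R f t) \<in> borel_measurable lborel"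
        by (simp only: scaleR_left_commute)
      show "AE t in lborel. norm (indicator A t *\<^sub>R ?k t *\<^sub>R f t) \<le> norm (?K *\<^sub>R (indicator A t *\<^sub>R f t))"
      proof (rule AE_I2)
        fix t
        have "?k t * norm (f t) \<le> ?K * norm (f t)" by (intro mult_right_mono kK) simp
        moreover have "\<bar>?K\<bar> = ?K" using k0 kK order_trans abs_of_nonneg by meson
        ultimately have "\<bar>?k t\<bar> * norm (f t) \<le> \<bar>?K\<bar> * norm (f t)"
          by (simp only: abs_of_nonneg[OF k0])
        thus "norm (indicator A t *\<^sub>R ?k t *\<^sub>R f t) \<le> norm (?K *\<^sub>R (indicator A t *\<^sub>R f t))"
          by (cases "t \<in> A") (simp_all only: norm_scaleR indicator_simps not_False_eq_True abs_zero mult_zero_left scaleR_one scaleR_zero_left scaleR_zero_right norm_zero order_refl abs_one mult_1)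
      qed
    qed
    define f where "f t = ?k t *\<^sub>R (H t - H x)" for t
    have fint: "set_integrable lborel {a..b} f" for a b
      unfolding f_def by (rule intk[OF _ intD]) simp
    have "(LINT t:{0..2*pi}|lborel. f t) = (LINT t:{0..2*pi}|lborel. ?k t *\<^sub>R H t - ?k t *\<^sub>R H x)"
      by (simp only: f_def scaleR_diff_right)
    also have "\<dots> = (LINT t:{0..2*pi}|lborel. ?k t *\<^sub>R H t) - (LINT t:{0..2*pi}|lborel. ?k t *\<^sub>R H x)"
      by (intro set_integral_diff(2) intk intH set_integrable_lborel_const) auto
    also have "(LINT t:{0..2*pi}|lborel. ?k t *\<^sub>R H x) = (2 * pi) *\<^sub>R H x"
    proof -
      have "(LINT t:{0..2*pi}|lborel. ?k t *\<^sub>R H x) = (LINT t|lborel. (indicator {0..2*pi} t *\<^sub>R ?k t) *\<^sub>R H x)"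
        by (simp only: set_lebesgue_integral_def scaleR_scaleR real_scaleR_def)
      also have "\<dots> = (LINT t|lborel. indicator {0..2*pi} t *\<^sub>R ?k t) *\<^sub>R H x"
        by (rule integral_scaleR_left)
           (use poisson_angle_set_integrable[OF r, of 0 "2*pi" x] in \<open>simp only: set_integrable_def\<close>)
      also have "\<dots> = (2 * pi) *\<^sub>R H x"
        by (simp only: poisson_angle_integral[OF r, of x, unfolded set_lebesgue_integral_def])
      finally show ?thesis .
    qed
    finally have If: "?I r - H x = (LINT t:{0..2*pi}|lborel. f t) / (2 * pi)"
      by (simp add: scaleR_conv_of_real field_simps)
    define F where "F = {0..2*pi} - {x-d..x+d}"
    have [measurable]: "F \<in> sets borel" by (simp add: F_def)
    have fF: "set_integrable lborel F f"
      by (rule set_integrable_subset[OF fint[of 0 "2*pi"]]) (auto simp: F_def)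
    have split: "(LINT t:{0..2*pi}|lborel. f t) = (LINT t:{x-d..x+d}|lborel. f t) + (LINT t:F|lborel. f t)"
    proof (subst set_integral_Un[symmetric])
      have "{x-d..x+d} \<union> F = {0..2*pi}" using d by (auto simp: F_def)
      thus "(LINT t:{0..2*pi}|lborel. f t) = (LINT t:{x-d..x+d} \<union> F|lborel. f t)" by simp
    qed (use fint fF in \<open>auto simp: F_def\<close>)
    have near: "norm (LINT t:{x-d..x+d}|lborel. f t) \<le> e / 2 * (2 * pi)"
    proof -
      have "(LINT t:{x-d..x+d}|lborel. f t) = (LINT s:{-d..d}|lborel. poisson_angle r s *\<^sub>R (H (x + s) - H x))"
        unfolding set_lebesgue_integral_def
        by (subst lborel_integral_real_affine[of 1 _ x])
           (auto intro!: Bochner_Integration.integral_cong simp: indicator_def f_def)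
      also have "norm \<dots> \<le> e / 2 * (LINT s:{-d..d}|lborel. poisson_angle r s)"
      proof (rule averages_bound_kernel)
        show "set_integrable lborel {-d..d} (\<lambda>s. H (x + s) - H x)"
        proof (intro set_integral_diff set_integrable_lborel_const)
          show "set_integrable lborel {-d..d} (\<lambda>s. H (x + s))"
            using lborel_integrable_real_affine[OF H, of 1 x]
            unfolding set_integrable_def by (intro integrable_mult_indicator) auto
        qed
        show "poisson_angle r t \<le> poisson_angle r s" if "\<bar>s\<bar> \<le> \<bar>t\<bar>" "\<bar>t\<bar> \<le> d" for s t
          using that d by (intro poisson_angle_mono[OF r]) auto
        show "norm (LINT t:{-s..s}|lborel. H (x + t) - H x) \<le> e / 2 * (2 * s)" if "0 \<le> s" "s \<le> d" for s
          using d0(2)[of s] that d by simp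
      qed (use k0 kK in auto)
      also have "(LINT s:{-d..d}|lborel. poisson_angle r s) = (LINT t:{x-d..x+d}|lborel. ?k t)"
        unfolding set_lebesgue_integral_def
        by (subst (2) lborel_integral_real_affine[of 1 _ x])
           (auto intro!: Bochner_Integration.integral_cong simp: indicator_def)
      also have "\<dots> \<le> (LINT t:{0..2*pi}|lborel. ?k t)"
        unfolding set_lebesgue_integral_def
        by (rule integral_mono_AE)
           (use poisson_angle_set_integrable[OF r] d k0 in \<open>auto simp: set_integrable_def indicator_def\<close>)
      finally show ?thesis using e by (simp add: poisson_angle_integral[OF r])
    qed
    have far: "norm (LINT t:F|lborel. f t) \<le> ?B * D"
    proof -
      have "norm (LINT t:F|lborel. f t) \<le> (LINT t|lborel. ?B * (indicator {0..2*pi} t * norm (H t - H x)))"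
        unfolding set_lebesgue_integral_def
      proof (rule Bochner_Integration.integral_norm_bound_integral)
        show "integrable lborel (\<lambda>t. indicator F t *\<^sub>R f t)" using fF by (simp add: set_integrable_def)
        show "integrable lborel (\<lambda>t. ?B * (indicator {0..2*pi} t * norm (H t - H x)))"
          using integrable_norm[OF intD[of 0 "2*pi", unfolded set_integrable_def]] by simp
        fix t :: real
        show "norm (indicator F t *\<^sub>R f t) \<le> ?B * (indicator {0..2*pi} t * norm (H t - H x))"
        proof (cases "t \<in> F")
          case True
          \<comment> \<open>The distance on the circle is \<open>\<bar>t - x\<bar>\<close> or \<open>2\<pi> - \<bar>t - x\<bar>\<close>, and it is at least \<open>d\<close>.\<close>
          have "cos (t - x) \<le> cos d"
          proof (cases "\<bar>t - x\<bar> \<le> pi")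
            case True
            have "cos \<bar>t - x\<bar> \<le> cos d"
              using True \<open>t \<in> F\<close> d by (intro cos_monotone_0_pi_le) (auto simp: F_def)
            thus ?thesis by simp
          next
            case False
            have "cos (2 * pi - \<bar>t - x\<bar>) \<le> cos d"
              using False \<open>t \<in> F\<close> d x by (intro cos_monotone_0_pi_le) (auto simp: F_def)
            thus ?thesis by simp
          qed
          hence "?k t \<le> ?B" by (intro poisson_angle_far[OF r]) (use sd in auto)
          hence "?k t * norm (H t - H x) \<le> ?B * norm (H t - H x)" by (rule mult_right_mono) simp
          moreover have "indicator F t = (1::real)" "indicator {0..2*pi} t = (1::real)"
            using True by (simp_all add: F_def)
          ultimately show ?thesis by (simp add: f_def abs_of_nonneg[OF k0])
        next
          case False
          have "0 \<le> ?B * (indicator {0..2*pi} t * norm (H t - H x))"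
            using r by (intro mult_nonneg_nonneg divide_nonneg_nonneg) (auto simp: power_le_one)
          thus ?thesis using False by simp
        qed
      qed
      also have "\<dots> = ?B * D" by (simp add: D_def set_lebesgue_integral_def)
      finally show ?thesis .
    qed
    have "norm (LINT t:{0..2*pi}|lborel. f t) \<le> e / 2 * (2 * pi) + ?B * D"
      unfolding split by (rule norm_triangle_mono[OF near far])
    hence "norm (LINT t:{0..2*pi}|lborel. f t) / (2 * pi) \<le> (e / 2 * (2 * pi) + ?B * D) / (2 * pi)"
      by (rule divide_right_mono) simp
    thus ?thesis
      unfolding If by (simp add: norm_divide add_divide_distrib)
  qed
  have "((\<lambda>r. e / 2 + (1 - r\<^sup>2) / (sin d)\<^sup>2 * D / (2 * pi)) \<longlongrightarrow> e / 2 + (1 - 1\<^sup>2) / (sin d)\<^sup>2 * D / (2 * pi)) (at_left (1::real))"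
    using sd by (intro tendsto_intros) auto
  hence "((\<lambda>r. e / 2 + (1 - r\<^sup>2) / (sin d)\<^sup>2 * D / (2 * pi)) \<longlongrightarrow> e / 2) (at_left 1)" by simp
  moreover have "e / 2 < e" using e by simp
  ultimately have "\<forall>\<^sub>F r in at_left 1. e / 2 + (1 - r\<^sup>2) / (sin d)\<^sup>2 * D / (2 * pi) < e"
    by (rule order_tendstoD)
  moreover have "\<forall>\<^sub>F r in at_left (1::real). r \<in> {0<..<1}" by (rule eventually_at_left_real) simp
  ultimately show "\<forall>\<^sub>F r in at_left 1. dist (?I r) (H x) < e"
  proof eventually_elim
    case (elim r)
    thus ?case using main[of r] by (auto simp: dist_norm)
  qed
qed

text \<open>
  Away from the point 1 the angle \<open>Arg2pi\<close> is a continuous inverse of \<open>cis\<close>, so a null set of angles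
  is carried to a null set of the circle. The set where \<open>P\<close> holds may fail to be measurable.
\<close>

lemma AE_circleI:
  assumes "AE t in lborel. 0 < t \<and> t < 2 * pi \<longrightarrow> P (cis t)"
  shows "AE z in circle. P z"
proof -
  obtain N where N: "N \<in> null_sets lborel" "{t. \<not> (0 < t \<and> t < 2 * pi \<longrightarrow> P (cis t))} \<subseteq> N"
    using assms unfolding eventually_ae_filter by auto
  let ?S = "sphere 0 1 - {1::complex}"
  define A where "A = {z\<in>?S. Arg2pi z \<notin> N}"
  have Nb: "N \<in> sets borel" using N(1) by auto
  have "continuous_on ?S Arg2pi"
  proof (intro continuous_at_imp_continuous_on ballI continuous_at_Arg2pi)
    fix z assume z: "z \<in> ?S"
    show "z \<notin> \<real>\<^sub>\<ge>\<^sub>0"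
    proof
      assume "z \<in> \<real>\<^sub>\<ge>\<^sub>0"
      then obtain r where "z = of_real r" "r \<ge> 0" by (auto elim: nonneg_Reals_cases)
      thus False using z by auto
    qed
  qed
  hence "Arg2pi \<in> borel_measurable (restrict_space borel ?S)"
    by (rule borel_measurable_continuous_on_restrict)
  hence "Arg2pi -` (- N) \<inter> space (restrict_space borel ?S) \<in> sets (restrict_space borel ?S)"
    by (rule measurable_sets) (use Nb in auto)
  hence "A \<in> sets (restrict_space borel ?S)"
    by (auto simp: A_def space_restrict_space vimage_def Int_def conj_commute)
  hence A: "A \<in> sets borel"
    by (subst (asm) sets_restrict_space_iff) auto
  have "AE t in lborel. t \<in> {0..2*pi} \<longrightarrow> cis t \<in> A"
    using AE_not_in[OF N(1)] AE_lborel_singleton[of 0] AE_lborel_singleton[of "2*pi"]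
  proof eventually_elim
    case (elim t)
    show ?case
    proof
      assume "t \<in> {0..2*pi}"
      with elim have t: "0 < t" "t < 2 * pi" by auto
      have arg: "Arg2pi (cis t) = t"
        using t Arg2pi_unique[of 1 t "cis t"] by (simp add: cis_conv_exp)
      have "cis t \<noteq> 1" using arg t Arg2pi_of_real[of 1] by auto
      thus "cis t \<in> A" using elim t by (simp add: A_def arg)
    qed
  qed
  hence AEu: "AE t in uniform_measure lborel {0..2*pi}. cis t \<in> A"
    by (subst AE_uniform_measure) auto
  have "{z \<in> space (restrict_space borel (sphere 0 1)). z \<in> A} = A"
    by (auto simp: A_def space_restrict_space)
  moreover have "A \<subseteq> sphere 0 1" by (auto simp: A_def)
  hence "A \<in> sets (restrict_space borel (sphere 0 1))"
    by (simp add: sets_restrict_space_iff A)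
  ultimately have "{z \<in> space (restrict_space borel (sphere 0 1)). z \<in> A} \<in> sets (restrict_space borel (sphere 0 1))"
    by (simp only:)
  hence "AE z in circle. z \<in> A"
    unfolding circle_def by (rule AE_distr_iff[OF measurable_cis_sphere, THEN iffD2, OF _ AEu])
  thus ?thesis
  proof eventually_elim
    case (elim z)
    let ?t = "Arg2pi z"
    have z: "z = cis ?t" using elim Arg2pi_eq[of z] by (simp add: A_def cis_conv_exp)
    have "?t \<noteq> 0" using elim z by (auto simp: A_def)
    hence "0 < ?t" "?t < 2 * pi" using Arg2pi_ge_0[of z] Arg2pi_lt_2pi[of z] by auto
    moreover have "?t \<notin> N" using elim by (simp add: A_def)
    ultimately have "P (cis ?t)" using N(2) by blast
    thus ?case using z by simp
  qed
qed

theorem Fatou_radial: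
  assumes h: "integrable circle h"
  shows "AE z in circle. ((\<lambda>r. poisson_ext h (of_real r * z)) \<longlongrightarrow> h z) (at_left 1)"
proof (rule AE_circleI)
  have [measurable]: "h \<in> borel_measurable circle" using h by auto
  define H where "H t = indicator {0..2*pi} t *\<^sub>R h (cis t)" for t
  have "integrable (uniform_measure lborel {0..2*pi}) (\<lambda>t. h (cis t))"
    using h unfolding circle_def by (rule integrable_distr[rotated]) measurable
  hence "integrable lborel (\<lambda>t. (2 * pi) *\<^sub>R ((indicator {0..2*pi} t / (2*pi)) *\<^sub>R h (cis t)))"
    unfolding uniform_measure_eq_density
    by (intro integrable_scaleR_right, subst (asm) integrable_density) (auto intro: measurable_comp_cis)
  hence H: "integrable lborel H" by (simp add: H_def[abs_def])
  show "AE t in lborel. 0 < t \<and> t < 2 * pi \<longrightarrow> ((\<lambda>r. poisson_ext h (of_real r * cis t)) \<longlongrightarrow> h (cis t)) (at_left 1)"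
    using AE_lborel_lebesgue_point[OF H]
  proof eventually_elim
    case (elim x)
    show ?case
    proof
      assume x: "0 < x \<and> x < 2 * pi"
      have "((\<lambda>r. (LINT t:{0..2*pi}|lborel. poisson_angle r (t - x) *\<^sub>R H t) / (2 * pi)) \<longlongrightarrow> H x) (at_left 1)"
        using x by (intro poisson_integral_converges[OF H _ _ elim]) auto
      moreover have "H x = h (cis x)" using x by (simp add: H_def)
      moreover have "\<forall>\<^sub>F r in at_left (1::real). r \<in> {0<..<1}" by (rule eventually_at_left_real) simp
      hence "\<forall>\<^sub>F r in at_left (1::real). (LINT t:{0..2*pi}|lborel. poisson_angle r (t - x) *\<^sub>R H t) / (2 * pi)
               = poisson_ext h (of_real r * cis x)"
      proof eventually_elim
        case (elim r)
        have w: "norm (of_real r * cis x) < 1" using elim by (simp add: norm_mult)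
        have [measurable]: "poisson (of_real r * cis x) \<in> borel_measurable circle" by (rule poisson_measurable[OF w])
        have "poisson_ext h (of_real r * cis x)
           = (LINT t:{0..2*pi}|lborel. complex_of_real (poisson (of_real r * cis x) (cis t)) * h (cis t)) / (2 * pi)"
          unfolding poisson_ext_def by (rule integral_circle) measurable
        also have "(LINT t:{0..2*pi}|lborel. complex_of_real (poisson (of_real r * cis x) (cis t)) * h (cis t))
            = (LINT t:{0..2*pi}|lborel. poisson_angle r (t - x) *\<^sub>R H t)"
          unfolding set_lebesgue_integral_def poisson_polar
          by (rule Bochner_Integration.integral_cong) (auto simp: H_def indicator_def scaleR_conv_of_real)
        finally show ?case by simp
      qed
      ultimately show "((\<lambda>r. poisson_ext h (of_real r * cis x)) \<longlongrightarrow> h (cis x)) (at_left 1)"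
        by (simp add: tendsto_cong)
    qed
  qed
qed

section \<open>Uniqueness of Fourier coefficients and boundary functions in the Hardy space\<close>

text \<open>
  The Poisson integral of \<open>g\<close> is a series in the Fourier coefficients of \<open>g\<close>, so it vanishes on the disc,
  while its radial limits are \<open>g\<close> almost everywhere. Integrability of \<open>g\<close> is the right generality here: in
  the theorem of Beurling \<open>g\<close> is \<open>\<bar>E\<bar>\<^sup>2 - 1\<close> with \<open>E \<in> L\<^sup>2\<close>.
\<close>

theorem fourier_uniqueness:
  assumes g: "integrable circle g" and z: "\<And>n. (LINT z|circle. g z * z powi n) = 0"
  shows "AE z in circle. g z = 0"
  using Fatou_radial[OF g] AE_circle_norm
proof eventually_elim
  case (elim z)
  have c: "(LINT z|circle. z powi n * g z) = 0" for n using z[of n] by (simp only: mult.commute)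
  have "\<forall>\<^sub>F r in at_left (1::real). r \<in> {0<..<1}" by (rule eventually_at_left_real) simp
  hence "\<forall>\<^sub>F r in at_left (1::real). poisson_ext g (of_real r * z) = 0"
  proof eventually_elim
    case (elim r)
    hence "norm (of_real r * z) < 1" using \<open>norm z = 1\<close> by (simp add: norm_mult)
    from poisson_ext_series(2)[OF g this] show ?case
      by (simp only: c mult_zero_right suminf_zero add_0_right)
  qed
  hence "((\<lambda>r. poisson_ext g (of_real r * z)) \<longlongrightarrow> 0) (at_left 1)" by (rule tendsto_eventually)
  thus ?case using tendsto_unique[OF _ elim(1)] by simp
qed

lemma L2_fourier_uniqueness:
  assumes "f \<in> L2" "\<And>n. fourier_coeff f n = 0"
  shows "AE z in circle. f z = 0"
proof (rule fourier_uniqueness[OF L2_integrable[OF assms(1)]])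
  show "(LINT z|circle. f z * z powi n) = 0" for n
    using assms(2)[of "- n"] by (simp add: fourier_coeff_conv_integral)
qed

text \<open>
  This is the passage from the circle back to the disc: bounded functions in \<open>H\<^sup>2\<close> are boundary
  functions of elements of \<open>H\<^sup>\<infinity>(\<D>)\<close>.
\<close>

lemma bounded_H2_radial_boundary:
  assumes "h \<in> H2" "AE z in circle. norm (h z) \<le> C"
  shows "poisson_ext h \<in> Hinf" "radial_boundary (poisson_ext h) h"
proof -
  show "poisson_ext h \<in> Hinf" by (rule poisson_ext_Hinf[OF assms])
  show "radial_boundary (poisson_ext h) h"
    using Fatou_radial[OF L2_integrable[OF H2_L2[OF assms(1)]]] L2_measurable[OF H2_L2[OF assms(1)]]
    by (simp add: radial_boundary_def)
qed

section \<open>Inner functions, their ranges and divisibility\<close>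

lemma cnj_mult_self_norm1: "norm z = 1 \<Longrightarrow> cnj z * z = 1" "norm z = 1 \<Longrightarrow> z * cnj z = 1"
  using complex_norm_square[of z] by (simp_all add: mult.commute)

lemma unimodular_mult_L2:
  assumes "V \<in> borel_measurable circle" "AE z in circle. norm (V z) = 1" "f \<in> L2"
  shows "(\<lambda>z. V z * f z) \<in> L2"
  by (rule L2_bounded_mult[OF assms(3,1), of 1]) (use assms(2) in \<open>auto elim: eventually_mono\<close>)

lemma closed_subspace_unimodular_vimage:
  assumes M: "closed_subspace M" and V: "V \<in> borel_measurable circle" "AE z in circle. norm (V z) = 1"
  shows "closed_subspace {f \<in> L2. (\<lambda>z. V z * f z) \<in> M}"
  unfolding closed_subspace_def
proof (intro conjI ballI allI impI)
  show "(\<lambda>z. 0) \<in> {f \<in> L2. (\<lambda>z. V z * f z) \<in> M}"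
    using closed_subspaceD(2)[OF M] by simp
next
  fix f g assume "f \<in> {f \<in> L2. (\<lambda>z. V z * f z) \<in> M}" "g \<in> {f \<in> L2. (\<lambda>z. V z * f z) \<in> M}"
  thus "(\<lambda>z. f z + g z) \<in> {f \<in> L2. (\<lambda>z. V z * f z) \<in> M}"
    using closed_subspaceD(3)[OF M, of "\<lambda>z. V z * f z" "\<lambda>z. V z * g z"]
    by (simp add: L2_add distrib_left)
next
  fix c f assume "f \<in> {f \<in> L2. (\<lambda>z. V z * f z) \<in> M}"
  thus "(\<lambda>z. c * f z) \<in> {f \<in> L2. (\<lambda>z. V z * f z) \<in> M}"
    using closed_subspaceD(4)[OF M, of "\<lambda>z. V z * f z" c]
    by (simp add: L2_cmult mult.left_commute)
next
  fix F f assume f: "f \<in> L2" and F: "\<forall>n. F n \<in> {f \<in> L2. (\<lambda>z. V z * f z) \<in> M}"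
    and lim: "(\<lambda>n. l2_norm (\<lambda>z. F n z - f z)) \<longlonglongrightarrow> 0"
  have "l2_norm (\<lambda>z. V z * F n z - V z * f z) = l2_norm (\<lambda>z. F n z - f z)" for n
  proof -
    have [measurable]: "F n \<in> borel_measurable circle" "f \<in> borel_measurable circle" "V \<in> borel_measurable circle"
      using F f V by (auto simp: L2_measurable)
    have "AE z in circle. (norm (V z * F n z - V z * f z))\<^sup>2 = (norm (F n z - f z))\<^sup>2"
      using V(2) by eventually_elim (simp add: norm_mult flip: right_diff_distrib)
    thus ?thesis
      unfolding l2_norm_def by (intro arg_cong[where f = sqrt] integral_cong_AE) measurable
  qed
  hence "(\<lambda>n. l2_norm (\<lambda>z. V z * F n z - V z * f z)) \<longlonglongrightarrow> 0" using lim by simp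
  hence "(\<lambda>z. V z * f z) \<in> M"
    by (rule closed_subspaceD(5)[OF M, of "\<lambda>n z. V z * F n z", rotated 2])
       (use F in simp, rule unimodular_mult_L2[OF V f])
  thus "f \<in> {f \<in> L2. (\<lambda>z. V z * f z) \<in> M}" using f by simp
qed auto

lemma times_H2_boundary:
  assumes "radial_boundary u U"
  shows "times_H2 u = {f \<in> L2. \<exists>h\<in>H2. AE z in circle. f z = U z * h z}"
proof -
  have bv: "AE z in circle. boundary_value u z = U z" by (rule boundary_value_eq[OF assms])
  have "(AE z in circle. f z = boundary_value u z * h z) \<longleftrightarrow> (AE z in circle. f z = U z * h z)" for f h
    by (rule eventually_subst) (use bv in \<open>auto elim: eventually_mono\<close>)
  thus ?thesis by (simp add: times_H2_def)
qed

locale inner_boundary =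
  fixes u U
  assumes Hinf: "u \<in> Hinf" and radial: "radial_boundary u U" and unimodular: "AE z in circle. norm (U z) = 1"
begin

lemma boundary_measurable [measurable]: "U \<in> borel_measurable circle"
  using radial by (rule radial_boundary_measurable)

lemma inner: "inner_function u"
  by (rule inner_functionI[OF Hinf radial unimodular])

lemma cnj_measurable: "(\<lambda>z. cnj (U z)) \<in> borel_measurable circle"
  by measurable

lemma cnj_unimodular: "AE z in circle. norm (cnj (U z)) = 1"
  using unimodular by simp

text \<open>
  Almost everywhere the conjugate of \<open>U\<close> is the inverse of \<open>U\<close>. Membership in the range becomes
  membership in \<open>H\<^sup>2\<close>, which gives closedness of the range at once.
\<close>

lemma mem_iff: "f \<in> times_H2 u \<longleftrightarrow> f \<in> L2 \<and> (\<lambda>z. cnj (U z) * f z) \<in> H2"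
proof
  assume "f \<in> times_H2 u"
  then obtain h where f: "f \<in> L2" and h: "h \<in> H2" "AE z in circle. f z = U z * h z"
    unfolding times_H2_boundary[OF radial] by auto
  have "AE z in circle. cnj (U z) * f z = h z"
    using h(2) unimodular by eventually_elim (simp add: cnj_mult_self_norm1 flip: mult.assoc)
  hence "(\<lambda>z. cnj (U z) * f z) \<in> H2"
    by (rule closed_subspace_AE[OF closed_subspace_H2 h(1), rotated])
       (use L2_measurable[OF f] in measurable)
  with f show "f \<in> L2 \<and> (\<lambda>z. cnj (U z) * f z) \<in> H2" by simp
next
  assume f: "f \<in> L2 \<and> (\<lambda>z. cnj (U z) * f z) \<in> H2"
  have "AE z in circle. f z = U z * (cnj (U z) * f z)"
    using unimodular by eventually_elim (simp add: cnj_mult_self_norm1 flip: mult.assoc)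
  with f show "f \<in> times_H2 u"
    unfolding times_H2_boundary[OF radial]
    by (intro CollectI conjI bexI[of _ "\<lambda>z. cnj (U z) * f z"]) simp_all
qed

lemma closed: "closed_subspace (times_H2 u)"
proof -
  have "times_H2 u = {f \<in> L2. (\<lambda>z. cnj (U z) * f z) \<in> H2}" using mem_iff by auto
  thus ?thesis
    using closed_subspace_unimodular_vimage[OF closed_subspace_H2 cnj_measurable cnj_unimodular] by simp
qed

lemma mult_mem: "h \<in> H2 \<Longrightarrow> (\<lambda>z. U z * h z) \<in> times_H2 u"
  unfolding times_H2_boundary[OF radial]
  using H2_L2[OF boundary_mult_H2[OF Hinf radial]] by auto

lemma boundary_mem: "U \<in> times_H2 u"
  using mult_mem[OF const_in_H2[of 1]] by simp

lemma subset_H2: "times_H2 u \<subseteq> H2"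
proof
  fix f assume "f \<in> times_H2 u"
  then obtain h where f: "f \<in> L2" and h: "h \<in> H2" "AE z in circle. f z = U z * h z"
    unfolding times_H2_boundary[OF radial] by auto
  show "f \<in> H2"
    by (rule closed_subspace_AE[OF closed_subspace_H2 boundary_mult_H2[OF Hinf radial h(1)] L2_measurable[OF f] h(2)])
qed

end

lemma inner_function_obtains_boundary:
  assumes "inner_function u"
  obtains U where "inner_boundary u U"
  using inner_function_boundary[OF assms] assms that
  unfolding inner_boundary_def inner_function_def by metis

lemma inner_boundary_poisson_ext:
  assumes "h \<in> H2" "AE z in circle. norm (h z) = 1"
  shows "inner_boundary (poisson_ext h) h"
proof -
  have "AE z in circle. norm (h z) \<le> 1" using assms(2) by (auto elim: eventually_mono)
  thus ?thesis
    unfolding inner_boundary_def using bounded_H2_radial_boundary[OF assms(1)] assms(2) by blast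
qed

text \<open>
  Since the limits of \<open>d\<close> are nonzero almost everywhere, the quotient \<open>w\<close> inherits radial limits from \<open>u\<close>
  and \<open>d\<close>; they multiply \<open>H\<^sup>2\<close> into itself.
\<close>

lemma inner_dvd_imp_times_H2_subset:
  assumes "inner_boundary d D" "inner_boundary u U" and dvd: "inner_dvd d u"
  shows "times_H2 u \<subseteq> times_H2 d"
proof
  interpret d: inner_boundary d D by fact
  interpret u: inner_boundary u U by fact
  obtain w where w: "w \<in> Hinf" "\<And>z. z \<in> ball 0 1 \<Longrightarrow> u z = w z * d z"
    using dvd unfolding inner_dvd_def by blast
  let ?W = "\<lambda>z. U z * cnj (D z)"
  have "AE z in circle. ((\<lambda>r. u (of_real r * z)) \<longlongrightarrow> U z) (at_left 1)"
    "AE z in circle. ((\<lambda>r. d (of_real r * z)) \<longlongrightarrow> D z) (at_left 1)"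
    using d.radial u.radial by (simp_all add: radial_boundary_def)
  hence "AE z in circle. ((\<lambda>r. w (of_real r * z)) \<longlongrightarrow> ?W z) (at_left 1)"
    using d.unimodular AE_circle_norm
  proof eventually_elim
    case (elim z)
    have D0: "D z \<noteq> 0" using elim(3) by auto
    have W: "?W z = U z / D z"
      using cnj_mult_self_norm1(2)[OF elim(3)] D0 by (simp add: field_simps)
    have "((\<lambda>r. u (of_real r * z) / d (of_real r * z)) \<longlongrightarrow> ?W z) (at_left 1)"
      unfolding W by (rule tendsto_divide[OF elim(1,2) D0])
    moreover have "\<forall>\<^sub>F r in at_left 1. d (of_real r * z) \<noteq> 0"
      by (rule tendsto_imp_eventually_ne[OF elim(2) D0])
    moreover have "\<forall>\<^sub>F r in at_left (1::real). r \<in> {0<..<1}" by (rule eventually_at_left_real) simp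
    ultimately show ?case
    proof -
      assume "\<forall>\<^sub>F r in at_left 1. d (of_real r * z) \<noteq> 0" "\<forall>\<^sub>F r in at_left (1::real). r \<in> {0<..<1}"
      hence "\<forall>\<^sub>F r in at_left 1. w (of_real r * z) = u (of_real r * z) / d (of_real r * z)"
      proof eventually_elim
        case (elim r)
        hence "of_real r * z \<in> ball 0 1" using \<open>norm z = 1\<close> by (simp add: norm_mult)
        from w(2)[OF this] elim show ?case by simp
      qed
      moreover assume "((\<lambda>r. u (of_real r * z) / d (of_real r * z)) \<longlongrightarrow> ?W z) (at_left 1)"
      ultimately show ?thesis by (simp add: tendsto_cong)
    qed
  qed
  hence W: "radial_boundary w ?W" by (simp add: radial_boundary_def)
  fix f assume "f \<in> times_H2 u"
  then obtain h where f: "f \<in> L2" and h: "h \<in> H2" "AE z in circle. f z = U z * h z"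
    unfolding times_H2_boundary[OF u.radial] by auto
  have "AE z in circle. f z = D z * (?W z * h z)"
    using h(2) d.unimodular
  proof eventually_elim
    case (elim z)
    have "D z * (?W z * h z) = (D z * cnj (D z)) * (U z * h z)" by (simp only: mult_ac)
    thus ?case using elim cnj_mult_self_norm1(2)[OF elim(2)] by simp
  qed
  thus "f \<in> times_H2 d"
    unfolding times_H2_boundary[OF d.radial]
    by (intro CollectI conjI f bexI[OF _ boundary_mult_H2[OF w(1) W h(1)]])
qed

text \<open>
  The quotient of the boundary functions is unimodular and lies in \<open>H\<^sup>2\<close>, so by the theorem of Fatou it
  comes from an inner function. Equality of boundary functions then gives equality on the disc.
\<close>

lemma inner_dvdI:
  assumes "inner_boundary d D" "inner_boundary u U" and mem: "U \<in> times_H2 d"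
  shows "inner_dvd d u"
proof -
  interpret d: inner_boundary d D by fact
  interpret u: inner_boundary u U by fact
  let ?W = "\<lambda>z. cnj (D z) * U z"
  have W: "?W \<in> H2" using mem d.mem_iff by blast
  have "AE z in circle. norm (?W z) = 1"
    using d.unimodular u.unimodular by eventually_elim (simp add: norm_mult)
  then interpret w: inner_boundary "poisson_ext ?W" ?W
    by (rule inner_boundary_poisson_ext[OF W])
  have "AE z in circle. U z = ?W z * D z"
    using d.unimodular
  proof eventually_elim
    case (elim z)
    have "?W z * D z = (cnj (D z) * D z) * U z" by (simp only: mult_ac)
    thus ?case using cnj_mult_self_norm1(1)[OF elim] by simp
  qed
  hence "u z = poisson_ext ?W z * d z" if "norm z < 1" for z
    using Hinf_eq_if_boundary_eq[OF u.Hinf u.radial Hinf_mult[OF w.Hinf d.Hinf]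
        radial_boundary_mult[OF w.radial d.radial] _ that] by blast
  thus ?thesis unfolding inner_dvd_def using w.Hinf by auto
qed

section \<open>Shift-invariant subspaces and the theorem of Beurling\<close>

lemma l2_inner_powi_mult:
  assumes "f \<in> borel_measurable circle" "g \<in> borel_measurable circle"
  shows "l2_inner (\<lambda>z. z powi n * f z) g = l2_inner f (\<lambda>z. z powi (- n) * g z)"
  unfolding l2_inner_def
proof (rule Bochner_Integration.integral_cong)
  fix z assume "z \<in> space circle"
  hence "cnj (z powi (- n)) = z powi n" using cnj_powi_circle[of z "- n"] by simp
  thus "z powi n * f z * cnj (g z) = f z * cnj (z powi (- n) * g z)"
    by (simp only: complex_cnj_mult mult_ac)
qed simp

lemma powi_mult_L2: "f \<in> L2 \<Longrightarrow> (\<lambda>z. z powi n * f z) \<in> L2"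
  by (rule L2_bounded_mult[where C = 1]) (auto simp: norm_power_int)

lemma fourier_coeff_powi_mult:
  "fourier_coeff (\<lambda>z. z powi n * f z) m = fourier_coeff f (m - n)"
  unfolding fourier_coeff_conv_integral
proof (rule Bochner_Integration.integral_cong)
  fix z assume "z \<in> space circle"
  hence "z powi n * z powi (- m) = z powi (- (m - n))" using powi_mult_circle[of z n "- m"] by simp
  thus "z powi n * f z * z powi (- m) = f z * z powi (- (m - n))"
    by (metis mult.commute mult.left_commute)
qed simp

lemma powi_mult_H2: "f \<in> H2 \<Longrightarrow> n \<ge> 0 \<Longrightarrow> (\<lambda>z. z powi n * f z) \<in> H2"
  by (simp add: H2_def powi_mult_L2 fourier_coeff_powi_mult)

lemma l2_inner_P_plus: "f \<in> L2 \<Longrightarrow> h \<in> H2 \<Longrightarrow> l2_inner (P_plus f) h = l2_inner f h"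
  by (rule l2_inner_orth_proj[OF closed_subspace_H2])

lemma P_plus_in_H2: "f \<in> L2 \<Longrightarrow> P_plus f \<in> H2"
  by (rule orth_proj(1)[OF closed_subspace_H2])

lemma fourier_coeff_P_plus:
  assumes "f \<in> L2"
  shows "fourier_coeff (P_plus f) n = (if n \<ge> 0 then fourier_coeff f n else 0)"
proof (cases "n \<ge> 0")
  case True
  thus ?thesis
    unfolding fourier_coeff_def using l2_inner_P_plus[OF assms powi_in_H2] by simp
next
  case False
  thus ?thesis using P_plus_in_H2[OF assms] by (simp add: H2_def)
qed

lemma P_plus_eq_0_iff:
  assumes "f \<in> L2"
  shows "(AE z in circle. P_plus f z = 0) \<longleftrightarrow> (\<forall>n\<ge>0. fourier_coeff f n = 0)"
proof
  assume "AE z in circle. P_plus f z = 0"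
  hence "fourier_coeff (P_plus f) n = fourier_coeff (\<lambda>z. 0) n" for n
    by (rule fourier_coeff_cong_AE) (auto intro: L2_measurable H2_L2 P_plus_in_H2 assms)
  moreover have "fourier_coeff (\<lambda>z. 0) n = 0" for n
    by (simp add: fourier_coeff_def l2_inner_def)
  ultimately have "fourier_coeff (P_plus f) n = 0" for n by simp
  thus "\<forall>n\<ge>0. fourier_coeff f n = 0"
    using fourier_coeff_P_plus[OF assms] by metis
next
  assume "\<forall>n\<ge>0. fourier_coeff f n = 0"
  thus "AE z in circle. P_plus f z = 0"
    by (intro L2_fourier_uniqueness H2_L2 P_plus_in_H2 assms) (simp add: fourier_coeff_P_plus[OF assms])
qed

text \<open>
  Orthogonality to the monomials forces all Fourier coefficients of \<open>P_plus f\<close> to vanish, so \<open>P_plus f\<close>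
  is zero, and \<open>f\<close> and \<open>P_plus f\<close> have the same inner product with \<open>h\<close>.
\<close>

lemma perp_H2:
  assumes f: "f \<in> L2" and c: "\<And>n. n \<ge> 0 \<Longrightarrow> fourier_coeff f n = 0" and h: "h \<in> H2"
  shows "l2_inner f h = 0"
proof -
  have "AE z in circle. P_plus f z = 0" using P_plus_eq_0_iff[OF f] c by blast
  hence "l2_inner h (P_plus f) = 0"
    by (intro l2_inner_zero_AE H2_L2 h P_plus_in_H2 f)
  hence "l2_inner (P_plus f) h = 0" by (subst l2_inner_commute) simp
  thus ?thesis using l2_inner_P_plus[OF f h] by simp
qed

lemma shift_invariant_power:
  assumes M: "closed_subspace M" and shift: "\<And>f. f \<in> M \<Longrightarrow> (\<lambda>z. z powi 1 * f z) \<in> M"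
    and f: "f \<in> M"
  shows "(\<lambda>z. z powi int n * f z) \<in> M"
proof (induction n)
  case 0
  thus ?case using f by simp
next
  case (Suc n)
  have "AE z in circle. z powi int (Suc n) * f z = z powi 1 * (z powi int n * f z)"
  proof (rule AE_I2)
    fix z assume "z \<in> space circle"
    hence "z powi 1 * z powi int n = z powi int (Suc n)" using powi_mult_circle[of z 1 "int n"] by simp
    thus "z powi int (Suc n) * f z = z powi 1 * (z powi int n * f z)" by (metis mult.assoc)
  qed
  thus ?case
    by (rule closed_subspace_AE[OF M shift[OF Suc], rotated])
       (rule L2_measurable[OF powi_mult_L2], use closed_subspaceD(1)[OF M] f in blast)
qed

text \<open>
  The subspace \<open>z M\<close> (called \<open>N\<close> in the proof) is strictly smaller than \<open>M\<close>: otherwise an element of \<open>M\<close>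
  could be divided by \<open>z\<close> any number of times within \<open>H\<^sup>2\<close>. Take a unit vector \<open>E\<close> of \<open>M\<close> orthogonal to
  \<open>z M\<close>. For \<open>n \<ge> 1\<close> the vector \<open>z\<^sup>n E\<close> is orthogonal to \<open>E\<close>, so \<open>\<bar>E\<bar>\<^sup>2\<close> has the Fourier coefficients of 1 and
  \<open>E\<close> is unimodular. For \<open>f \<in> M\<close> and \<open>n \<ge> 1\<close> also \<open>z\<^sup>n f\<close> is orthogonal to \<open>E\<close>, which says that the
  conjugate of \<open>E\<close> times \<open>f\<close> lies in \<open>H\<^sup>2\<close>.
\<close>

theorem Beurling_generator:
  assumes M: "closed_subspace M" "M \<subseteq> H2" and shift: "\<And>f. f \<in> M \<Longrightarrow> (\<lambda>z. z powi 1 * f z) \<in> M"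
    and ne: "g0 \<in> M" "\<not> (AE z in circle. g0 z = 0)"
  obtains e E where "inner_boundary e E" "E \<in> M" "M \<subseteq> times_H2 e"
proof -
  have subL2: "f \<in> L2" if "f \<in> M" for f using M(2) H2_L2 that by blast
  have shiftn: "(\<lambda>z. z powi int n * f z) \<in> M" if "f \<in> M" for n f
    by (rule shift_invariant_power[OF M(1) _ that]) (rule shift)
  \<comment> \<open>This is \<open>z M\<close>, written as a preimage so that it is closed under almost everywhere equality.\<close>
  define N where "N = {f \<in> L2. (\<lambda>z. z powi (-1) * f z) \<in> M}"
  have N: "closed_subspace N"
    unfolding N_def
    by (rule closed_subspace_unimodular_vimage[OF M(1) measurable_powi_circle])
       (rule AE_I2, simp add: norm_power_int norm_inverse)
  have shift_inv: "AE z in circle. z powi (- m) * (z powi n * f z) = z powi (n - m) * f z" for f m n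
  proof (rule AE_I2)
    fix z assume "z \<in> space circle"
    hence "z powi (- m) * z powi n = z powi (n - m)" using powi_mult_circle[of z "- m" n] by simp
    thus "z powi (- m) * (z powi n * f z) = z powi (n - m) * f z" by (metis mult.assoc)
  qed
  have N_M: "f \<in> M" if "f \<in> N" for f
  proof (rule closed_subspace_AE[OF M(1)])
    show "(\<lambda>z. z powi 1 * (z powi (-1) * f z)) \<in> M" using that shift unfolding N_def by blast
    show "f \<in> borel_measurable circle" using that by (simp add: N_def L2_measurable)
    show "AE z in circle. f z = z powi 1 * (z powi (-1) * f z)"
      using shift_inv[of "-1" "-1" f] by eventually_elim simp
  qed
  have shift_N: "(\<lambda>z. z powi int (Suc n) * f z) \<in> N" if f: "f \<in> M" for n f
  proof -
    have "(\<lambda>z. z powi (-1) * (z powi int (Suc n) * f z)) \<in> M"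
    proof (rule closed_subspace_AE[OF M(1) shiftn[OF f, of n]])
      show "(\<lambda>z. z powi (-1) * (z powi int (Suc n) * f z)) \<in> borel_measurable circle"
        by (intro L2_measurable powi_mult_L2 subL2[OF f])
      show "AE z in circle. z powi (-1) * (z powi int (Suc n) * f z) = z powi int n * f z"
        using shift_inv[of 1 "int (Suc n)" f] by eventually_elim simp
    qed
    thus ?thesis using powi_mult_L2[OF subL2[OF f]] by (simp only: N_def mem_Collect_eq)
  qed
  have "\<exists>g\<in>M. g \<notin> N"
  proof (rule ccontr)
    assume "\<not> (\<exists>g\<in>M. g \<notin> N)"
    hence down: "(\<lambda>z. z powi (-1) * f z) \<in> M" if "f \<in> M" for f using that by (auto simp: N_def)
    \<comment> \<open>Dividing by \<open>z\<close> moves coefficients down, until those of nonnegative index become negative ones.\<close>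
    have downn: "\<exists>f\<in>M. \<forall>k. fourier_coeff f k = fourier_coeff g0 (k + int n)" for n
    proof (induction n)
      case 0
      thus ?case using ne(1) by auto
    next
      case (Suc n)
      then obtain f where f: "f \<in> M" "\<And>k. fourier_coeff f k = fourier_coeff g0 (k + int n)" by blast
      show ?case
        by (rule bexI[OF _ down[OF f(1)]]) (simp only: fourier_coeff_powi_mult f(2), simp add: algebra_simps)
    qed
    have "fourier_coeff g0 k = 0" for k
    proof -
      obtain f where f: "f \<in> M" "\<And>j. fourier_coeff f j = fourier_coeff g0 (j + int (nat (k + 1)))"
        using downn by metis
      show ?thesis
      proof (cases "k < 0")
        case True
        thus ?thesis using ne(1) M(2) by (auto simp: H2_def)
      next
        case False
        have "fourier_coeff f (- 1) = 0" using f(1) M(2) by (auto simp: H2_def)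
        thus ?thesis using f(2)[of "- 1"] False by simp
      qed
    qed
    hence "AE z in circle. g0 z = 0" by (rule L2_fourier_uniqueness[OF subL2[OF ne(1)]])
    with ne(2) show False by contradiction
  qed
  then obtain g where g: "g \<in> M" "g \<notin> N" by blast
  let ?p = "orth_proj N g"
  note p = orth_proj[OF N subL2[OF g(1)]]
  \<comment> \<open>The component of \<open>g\<close> orthogonal to \<open>z M\<close>, not yet normalized.\<close>
  define e0 where "e0 z = g z - ?p z" for z
  have e0M: "e0 \<in> M"
    unfolding e0_def by (rule closed_subspace_diff[OF M(1) g(1) N_M[OF p(1)]])
  have e0L: "e0 \<in> L2" by (rule subL2[OF e0M])
  have "l2_norm e0 \<noteq> 0"
  proof
    assume "l2_norm e0 = 0"
    hence "AE z in circle. g z = ?p z"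
      using l2_norm_eq_0D[OF e0L] by (auto simp: e0_def)
    hence "g \<in> N"
      by (rule closed_subspace_AE[OF N p(1) L2_measurable[OF subL2[OF g(1)]]])
    with g(2) show False by contradiction
  qed
  hence c: "l2_norm e0 > 0" using l2_norm_nonneg[of e0] by linarith
  define E where "E z = complex_of_real (1 / l2_norm e0) * e0 z" for z
  have EM: "E \<in> M" unfolding E_def by (rule closed_subspaceD(4)[OF M(1) e0M])
  have EL: "E \<in> L2" by (rule subL2[OF EM])
  have [measurable]: "E \<in> borel_measurable circle" by (rule L2_measurable[OF EL])
  have normE: "l2_norm E = 1"
    unfolding E_def l2_norm_cmult using c by (simp add: norm_divide)
  have EN: "l2_inner E h = 0" if "h \<in> N" for h
    unfolding E_def l2_inner_cmult_left using p(2)[OF that] by (simp add: e0_def[abs_def])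
  have coeff: "(LINT z|circle. (f z * cnj (E z)) * z powi int (Suc n)) = 0" if f: "f \<in> M" for n f
  proof -
    have "(LINT z|circle. (f z * cnj (E z)) * z powi int (Suc n)) = l2_inner (\<lambda>z. z powi int (Suc n) * f z) E"
      unfolding l2_inner_def by (simp only: mult_ac)
    also have "\<dots> = cnj (l2_inner E (\<lambda>z. z powi int (Suc n) * f z))" by (rule l2_inner_commute)
    also have "\<dots> = 0" using EN[OF shift_N[OF f]] by simp
    finally show ?thesis .
  qed
  have int2: "integrable circle (\<lambda>z. E z * cnj (E z))" by (rule L2_mult_cnj_integrable[OF EL EL])
  have "AE z in circle. E z * cnj (E z) - 1 = 0"
  proof (rule fourier_uniqueness)
    show "integrable circle (\<lambda>z. E z * cnj (E z) - 1)" using int2 by simp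
    fix n
    have "(LINT z|circle. (E z * cnj (E z) - 1) * z powi n) = (LINT z|circle. E z * cnj (E z) * z powi n - z powi n)"
      by (simp only: left_diff_distrib mult_1)
    also have "\<dots> = (LINT z|circle. E z * cnj (E z) * z powi n) - (if n = 0 then 1 else 0)"
      by (subst Bochner_Integration.integral_diff[OF integrable_mult_powi[OF int2] L2_integrable[OF L2_powi]])
         (simp only: integral_circle_powi)
    also have "(LINT z|circle. E z * cnj (E z) * z powi n) = (if n = 0 then 1 else 0)"
    proof -
      consider "n = 0" | m where "n = int (Suc m)" | m where "n = - int (Suc m)"
        by (metis int_cases3 not0_implies_Suc of_nat_0 int_cases nat_int_comparison(1))
      thus ?thesis
      proof cases
        case 1
        thus ?thesis using l2_inner_self[of E] normE by (simp add: l2_inner_def)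
      next
        case 2
        thus ?thesis using coeff[OF EM] by simp
      next
        case 3
        have "(LINT z|circle. E z * cnj (E z) * z powi n) = (LINT z|circle. cnj (E z * cnj (E z) * z powi int (Suc m)))"
        proof (rule Bochner_Integration.integral_cong)
          fix z assume "z \<in> space circle"
          hence "cnj (z powi int (Suc m)) = z powi n" using cnj_powi_circle[of z "int (Suc m)"] 3 by simp
          thus "E z * cnj (E z) * z powi n = cnj (E z * cnj (E z) * z powi int (Suc m))"
            by (simp only: complex_cnj_mult complex_cnj_cnj mult_ac)
        qed simp
        also have "\<dots> = cnj (LINT z|circle. E z * cnj (E z) * z powi int (Suc m))"
          by (rule Bochner_Integration.integral_cnj)
        also have "\<dots> = 0" by (simp only: coeff[OF EM] complex_cnj_zero)
        finally show ?thesis using 3 by simp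
      qed
    qed
    finally show "(LINT z|circle. (E z * cnj (E z) - 1) * z powi n) = 0" by simp
  qed
  hence uni: "AE z in circle. norm (E z) = 1"
  proof eventually_elim
    case (elim z)
    hence "complex_of_real ((norm (E z))\<^sup>2) = 1" by (simp add: complex_norm_square del: of_real_power)
    hence "(norm (E z))\<^sup>2 = 1" using of_real_eq_1_iff by blast
    thus ?case by (simp add: power2_eq_1_iff) (use norm_ge_zero[of "E z"] in linarith)
  qed
  have EH: "E \<in> H2" using EM M(2) by blast
  interpret e: inner_boundary "poisson_ext E" E by (rule inner_boundary_poisson_ext[OF EH uni])
  have "M \<subseteq> times_H2 (poisson_ext E)"
  proof
    fix f assume f: "f \<in> M"
    have "fourier_coeff (\<lambda>z. cnj (E z) * f z) n = 0" if "n < 0" for n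
    proof -
      define m where "m = nat (- n) - 1"
      have m: "- n = int (Suc m)" using that by (simp add: m_def)
      have "fourier_coeff (\<lambda>z. cnj (E z) * f z) n = (LINT z|circle. (f z * cnj (E z)) * z powi int (Suc m))"
        unfolding fourier_coeff_conv_integral m by (simp only: mult.commute)
      thus ?thesis using coeff[OF f] by simp
    qed
    thus "f \<in> times_H2 (poisson_ext E)"
      unfolding e.mem_iff
      using subL2[OF f] unimodular_mult_L2[OF e.cnj_measurable e.cnj_unimodular subL2[OF f]]
      by (simp add: H2_def)
  qed
  thus ?thesis using that e.inner_boundary_axioms EM by blast
qed

section \<open>Orthogonality to the range of a greatest common divisor\<close>

lemma closed_subspace_H2_perp:
  assumes "S \<subseteq> L2"
  shows "closed_subspace (H2_perp S)"
  unfolding closed_subspace_def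
proof (intro conjI ballI allI impI)
  show "H2_perp S \<subseteq> L2" by (auto simp: H2_perp_def H2_L2)
  show "(\<lambda>z. 0) \<in> H2_perp S" using const_in_H2[of 0] by (simp add: H2_perp_def l2_inner_def)
next
  fix f g assume "f \<in> H2_perp S" "g \<in> H2_perp S"
  thus "(\<lambda>z. f z + g z) \<in> H2_perp S"
    using assms closed_subspaceD(3)[OF closed_subspace_H2, of f g]
    by (auto simp: H2_perp_def l2_inner_add_left H2_L2 subset_iff)
next
  fix c f assume "f \<in> H2_perp S"
  thus "(\<lambda>z. c * f z) \<in> H2_perp S"
    using closed_subspaceD(4)[OF closed_subspace_H2, of f c] by (auto simp: H2_perp_def l2_inner_cmult_left)
next
  fix F f assume f: "f \<in> L2" and F: "\<forall>n. F n \<in> H2_perp S" and lim: "(\<lambda>n. l2_norm (\<lambda>z. F n z - f z)) \<longlonglongrightarrow> 0"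
  have FH: "F n \<in> H2" for n using F by (auto simp: H2_perp_def)
  have "f \<in> H2" by (rule closed_subspaceD(5)[OF closed_subspace_H2 FH f lim])
  moreover have "l2_inner f g = 0" if g: "g \<in> S" for g
  proof -
    have "(\<lambda>n. l2_inner (F n) g) \<longlonglongrightarrow> l2_inner f g"
      by (rule l2_inner_tendsto[OF H2_L2[OF FH] f _ lim]) (use assms g in blast)
    moreover have "l2_inner (F n) g = 0" for n using F g by (auto simp: H2_perp_def)
    ultimately show ?thesis by (simp add: LIMSEQ_const_iff)
  qed
  ultimately show "f \<in> H2_perp S" by (simp add: H2_perp_def)
qed

lemma P_plus_in_H2_perp_iff:
  assumes f: "f \<in> L2" and S: "S \<subseteq> H2"
  shows "P_plus f \<in> H2_perp S \<longleftrightarrow> (\<forall>k\<in>S. l2_inner f k = 0)"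
proof -
  have "l2_inner (P_plus f) k = l2_inner f k" if "k \<in> S" for k
    using that S by (intro l2_inner_P_plus[OF f]) blast
  thus ?thesis using P_plus_in_H2[OF f] by (simp add: H2_perp_def)
qed

lemma (in inner_boundary) powi_mult_mem:
  assumes "f \<in> times_H2 u" "n \<ge> 0"
  shows "(\<lambda>z. z powi n * f z) \<in> times_H2 u"
proof -
  have "(\<lambda>z. z powi n * (cnj (U z) * f z)) \<in> H2"
    using assms mem_iff powi_mult_H2 by blast
  hence "(\<lambda>z. cnj (U z) * (z powi n * f z)) \<in> H2" by (simp only: mult.left_commute)
  thus ?thesis using assms mem_iff powi_mult_L2 by blast
qed

lemma l2_inner_eq_0_commute: "l2_inner f g = 0 \<longleftrightarrow> l2_inner g f = 0"
  by (metis l2_inner_commute complex_cnj_zero_iff)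

text \<open>
  Let \<open>P\<close> be the set of all \<open>g \<in> H\<^sup>2\<close> that are orthogonal to both ranges and \<open>M\<close> the set of all \<open>f \<in> H\<^sup>2\<close>
  that are orthogonal to \<open>P\<close>. Working with \<open>M\<close> instead of the closure of the sum of the ranges makes
  closedness immediate, and invariance of \<open>M\<close> under \<open>z\<close> is dual to invariance of \<open>P\<close> under the backward
  shift. The generator \<open>E\<close> of \<open>M\<close> lies in \<open>M\<close>, so that \<open>P\<close> is orthogonal to \<open>E H\<^sup>2\<close>.
\<close>

theorem inner_gcd_exists:
  assumes "inner_boundary u U" "inner_boundary v V"
  obtains e E where "inner_boundary e E" "is_inner_gcd e u v"
    "H2_perp (times_H2 u \<union> times_H2 v) \<subseteq> H2_perp (times_H2 e)"
proof -
  interpret u: inner_boundary u U by fact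
  interpret v: inner_boundary v V by fact
  define P where "P = H2_perp (times_H2 u \<union> times_H2 v)"
  define M where "M = H2_perp P"
  have PH: "P \<subseteq> H2" by (auto simp: P_def H2_perp_def)
  have M: "closed_subspace M" "M \<subseteq> H2"
  proof -
    show "closed_subspace M" unfolding M_def by (rule closed_subspace_H2_perp) (use PH H2_L2 in blast)
    show "M \<subseteq> H2" by (auto simp: M_def H2_perp_def)
  qed
  have sub: "times_H2 u \<union> times_H2 v \<subseteq> M"
  proof
    fix f assume f: "f \<in> times_H2 u \<union> times_H2 v"
    have "l2_inner f g = 0" if "g \<in> P" for g
    proof -
      have "l2_inner g f = 0" using that f unfolding P_def H2_perp_def by blast
      thus ?thesis by (subst l2_inner_eq_0_commute)
    qed
    thus "f \<in> M" using f u.subset_H2 v.subset_H2 by (auto simp: M_def H2_perp_def)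
  qed
  have back_shift: "P_plus (\<lambda>z. z powi (-1) * g z) \<in> P" if g: "g \<in> P" for g
  proof -
    have gH: "g \<in> H2" using g PH by blast
    have L: "(\<lambda>z. z powi (-1) * g z) \<in> L2" by (rule powi_mult_L2[OF H2_L2[OF gH]])
    have "l2_inner (P_plus (\<lambda>z. z powi (-1) * g z)) f = 0" if f: "f \<in> times_H2 u \<union> times_H2 v" for f
    proof -
      have fH: "f \<in> H2" using f sub M(2) by blast
      have "l2_inner (P_plus (\<lambda>z. z powi (-1) * g z)) f = l2_inner (\<lambda>z. z powi (-1) * g z) f"
        by (rule l2_inner_P_plus[OF L fH])
      also have "\<dots> = l2_inner g (\<lambda>z. z powi (- (-1)) * f z)"
        by (rule l2_inner_powi_mult) (intro L2_measurable H2_L2 gH fH)+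
      also have "(\<lambda>z. z powi (- (-1)) * f z) \<in> times_H2 u \<union> times_H2 v"
        using f u.powi_mult_mem[of f 1] v.powi_mult_mem[of f 1] by auto
      hence "l2_inner g (\<lambda>z. z powi (- (-1)) * f z) = 0"
        using g unfolding P_def H2_perp_def by blast
      finally show ?thesis .
    qed
    thus ?thesis using P_plus_in_H2[OF L] by (simp add: P_def H2_perp_def)
  qed
  have shift: "(\<lambda>z. z powi 1 * f z) \<in> M" if f: "f \<in> M" for f
  proof -
    have fH: "f \<in> H2" using f M(2) by blast
    have "l2_inner (\<lambda>z. z powi 1 * f z) g = 0" if g: "g \<in> P" for g
    proof -
      have gH: "g \<in> H2" using g PH by blast
      have L: "(\<lambda>z. z powi (-1) * g z) \<in> L2" by (rule powi_mult_L2[OF H2_L2[OF gH]])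
      have "l2_inner (\<lambda>z. z powi 1 * f z) g = l2_inner f (\<lambda>z. z powi (-1) * g z)"
        by (rule l2_inner_powi_mult) (intro L2_measurable H2_L2 gH fH)+
      also have "\<dots> = cnj (l2_inner (\<lambda>z. z powi (-1) * g z) f)" by (rule l2_inner_commute)
      also have "\<dots> = cnj (l2_inner (P_plus (\<lambda>z. z powi (-1) * g z)) f)"
        by (simp only: l2_inner_P_plus[OF L fH])
      also have "\<dots> = l2_inner f (P_plus (\<lambda>z. z powi (-1) * g z))" by (rule l2_inner_commute[symmetric])
      also have "\<dots> = 0" using f back_shift[OF g] by (simp add: M_def H2_perp_def)
      finally show ?thesis .
    qed
    thus ?thesis using powi_mult_H2[OF fH, of 1] by (simp only: M_def H2_perp_def) simp
  qed
  have UM: "U \<in> M" using sub u.boundary_mem by blast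
  have Une: "\<not> (AE z in circle. U z = 0)"
  proof
    assume "AE z in circle. U z = 0"
    hence "AE z in circle. (1::real) = 0" using u.unimodular by eventually_elim simp
    hence "(LINT z|circle. (1::real)) = (LINT z|circle. 0)" by (intro integral_cong_AE) auto
    thus False by simp
  qed
  obtain e E where e: "inner_boundary e E" and EM: "E \<in> M" and Me: "M \<subseteq> times_H2 e"
    by (rule Beurling_generator[OF M _ UM Une]) (use shift in blast)+
  interpret e: inner_boundary e E by fact
  have "is_inner_gcd e u v"
    unfolding is_inner_gcd_def
  proof (intro conjI allI impI)
    show "inner_function e" by (rule e.inner)
    show "inner_dvd e u"
      by (rule inner_dvdI[OF e assms(1)]) (use sub Me u.boundary_mem in blast)
    show "inner_dvd e v"
      by (rule inner_dvdI[OF e assms(2)]) (use sub Me v.boundary_mem in blast)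
    fix c assume c: "inner_function c" "inner_dvd c u" "inner_dvd c v"
    obtain C where C: "inner_boundary c C" by (rule inner_function_obtains_boundary[OF c(1)])
    interpret c: inner_boundary c C by fact
    have "times_H2 u \<union> times_H2 v \<subseteq> times_H2 c"
      using inner_dvd_imp_times_H2_subset[OF C assms(1) c(2)] inner_dvd_imp_times_H2_subset[OF C assms(2) c(3)]
      by blast
    have EH: "E \<in> H2" using EM M(2) by blast
    let ?q = "orth_proj (times_H2 c) E"
    note q = orth_proj[OF c.closed H2_L2[OF EH]]
    \<comment> \<open>The part of \<open>E\<close> orthogonal to the range of \<open>c\<close> lies in \<open>P\<close>, to which \<open>E\<close> is orthogonal.\<close>
    let ?r = "\<lambda>z. E z - ?q z"
    have rH: "?r \<in> H2"
      using closed_subspace_diff[OF closed_subspace_H2 EH] q(1) c.subset_H2 by blast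
    have "?r \<in> P"
      unfolding P_def H2_perp_def using rH q(2) \<open>times_H2 u \<union> times_H2 v \<subseteq> times_H2 c\<close> by blast
    hence "l2_inner E ?r = 0" using EM unfolding M_def H2_perp_def by blast
    moreover have "l2_inner ?r ?q = 0" by (rule q(2)[OF q(1)])
    hence "l2_inner ?q ?r = 0" by (simp only: l2_inner_eq_0_commute)
    moreover have "l2_inner ?r ?r = l2_inner E ?r - l2_inner ?q ?r"
      using q(1) c.subset_H2 by (intro l2_inner_diff_left H2_L2 EH rH) blast
    ultimately have "l2_norm ?r = 0" unfolding l2_inner_self[of ?r] by simp
    hence "AE z in circle. E z = ?q z" using l2_norm_eq_0D[OF H2_L2[OF rH]] by simp
    hence "E \<in> times_H2 c"
      by (rule closed_subspace_AE[OF c.closed q(1) L2_measurable[OF H2_L2[OF EH]]])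
    thus "inner_dvd c e" by (rule inner_dvdI[OF C e])
  qed
  moreover have "P \<subseteq> H2_perp (times_H2 e)"
  proof
    fix g assume g: "g \<in> P"
    hence gH: "g \<in> H2" using PH by blast
    have L: "(\<lambda>z. cnj (E z) * g z) \<in> L2"
      by (rule unimodular_mult_L2[OF e.cnj_measurable e.cnj_unimodular H2_L2[OF gH]])
    have coeff: "fourier_coeff (\<lambda>z. cnj (E z) * g z) n = 0" if "n \<ge> 0" for n
    proof -
      have "(\<lambda>z. z powi int (nat n) * E z) \<in> M" by (rule shift_invariant_power[OF M(1) _ EM]) (rule shift)
      hence "l2_inner g (\<lambda>z. z powi n * E z) = 0"
        using that g by (subst l2_inner_eq_0_commute) (auto simp: M_def H2_perp_def)
      thus ?thesis unfolding fourier_coeff_def l2_inner_def by (simp add: mult_ac)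
    qed
    have "l2_inner g f = 0" if fe: "f \<in> times_H2 e" for f
    proof -
      obtain h where f: "f \<in> L2" and h: "h \<in> H2" "AE z in circle. f z = E z * h z"
        using fe unfolding times_H2_boundary[OF e.radial] by auto
      have "l2_inner g f = l2_inner g (\<lambda>z. E z * h z)"
        by (rule l2_inner_cong_AE[OF _ h(2)])
           (use f gH boundary_mult_H2[OF e.Hinf e.radial h(1)] in \<open>auto intro: L2_measurable H2_L2\<close>)
      also have "\<dots> = l2_inner (\<lambda>z. cnj (E z) * g z) h" unfolding l2_inner_def by (simp add: mult_ac)
      also have "\<dots> = 0" by (rule perp_H2[OF L coeff h(1)])
      finally show ?thesis .
    qed
    with gH show "g \<in> H2_perp (times_H2 e)" by (simp add: H2_perp_def)
  qed
  ultimately show ?thesis using that e unfolding P_def by blast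
qed

text \<open>
  The chosen greatest common divisor \<open>d\<close> may differ from the \<open>e\<close> constructed above. Since \<open>d\<close> divides
  \<open>u\<close> and \<open>v\<close> and \<open>e\<close> divides \<open>d\<close>, the range of \<open>d\<close> lies between the two given ranges and that of \<open>e\<close>,
  and this suffices.
\<close>

theorem H2_perp_inner_gcd:
  assumes "inner_function u" "inner_function v"
  shows "H2_perp (times_H2 (inner_gcd u v)) = H2_perp (times_H2 u) \<inter> H2_perp (times_H2 v)"
proof -
  obtain U where U: "inner_boundary u U" by (rule inner_function_obtains_boundary[OF assms(1)])
  obtain V where V: "inner_boundary v V" by (rule inner_function_obtains_boundary[OF assms(2)])
  obtain e E where e: "inner_boundary e E" "is_inner_gcd e u v"
    "H2_perp (times_H2 u \<union> times_H2 v) \<subseteq> H2_perp (times_H2 e)"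
    by (rule inner_gcd_exists[OF U V])
  define d where "d = inner_gcd u v"
  have d: "is_inner_gcd d u v" unfolding d_def inner_gcd_def by (rule someI[of _ e]) (rule e(2))
  hence "inner_function d" by (simp add: is_inner_gcd_def)
  then obtain D where D: "inner_boundary d D" by (rule inner_function_obtains_boundary)
  have "times_H2 u \<subseteq> times_H2 d" "times_H2 v \<subseteq> times_H2 d"
    using inner_dvd_imp_times_H2_subset[OF D U] inner_dvd_imp_times_H2_subset[OF D V] d
    by (simp_all add: is_inner_gcd_def)
  moreover have "inner_dvd e d" using d e(2) by (simp add: is_inner_gcd_def)
  hence "times_H2 d \<subseteq> times_H2 e" by (rule inner_dvd_imp_times_H2_subset[OF e(1) D])
  moreover have "H2_perp B \<subseteq> H2_perp A" if "A \<subseteq> B" for A B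
    using that by (auto simp: H2_perp_def)
  moreover have "H2_perp (times_H2 u \<union> times_H2 v) = H2_perp (times_H2 u) \<inter> H2_perp (times_H2 v)"
    by (auto simp: H2_perp_def)
  ultimately show ?thesis using e(3) unfolding d_def[symmetric] by blast
qed

section \<open>Hankel operators on the range of an inner function\<close>

lemma cnj_flip_cnj_flip [simp]: "cnj_flip (cnj_flip f) = f"
  by (simp add: cnj_flip_def flip_def fun_eq_iff)

lemma cnj_flip_L2: "f \<in> L2 \<Longrightarrow> cnj_flip f \<in> L2"
  using L2_cnj[OF L2_flip] unfolding cnj_flip_def[abs_def] .

lemma l2_inner_cnj_flip:
  assumes "f \<in> L2" "g \<in> L2"
  shows "l2_inner (cnj_flip f) (cnj_flip g) = cnj (l2_inner f g)"
proof -
  have "l2_inner (cnj_flip f) (cnj_flip g) = (LINT z|circle. cnj (f (cnj z) * cnj (g (cnj z))))"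
    by (simp add: l2_inner_def cnj_flip_def flip_def)
  also have "\<dots> = (LINT z|circle. cnj (f z * cnj (g z)))"
    using integral_circle_cnj[of "\<lambda>z. cnj (f z * cnj (g z))"] assms L2_measurable by measurable
  also have "\<dots> = cnj (l2_inner f g)" unfolding l2_inner_def by (rule Bochner_Integration.integral_cnj)
  finally show ?thesis .
qed

lemma cnj_flip_powi: "cnj_flip (\<lambda>z. z powi n) = (\<lambda>z. z powi n)"
  by (simp add: cnj_flip_def flip_def fun_eq_iff)

lemma fourier_coeff_cnj_flip:
  assumes "f \<in> L2"
  shows "fourier_coeff (cnj_flip f) n = cnj (fourier_coeff f n)"
  using l2_inner_cnj_flip[OF assms L2_powi[of n]] unfolding fourier_coeff_def cnj_flip_powi .

lemma cnj_flip_H2: "f \<in> H2 \<Longrightarrow> cnj_flip f \<in> H2"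
  by (simp add: H2_def cnj_flip_L2 fourier_coeff_cnj_flip)

lemma inner_boundary_cnj_flip:
  assumes "inner_boundary u U"
  shows "inner_boundary (cnj_flip u) (cnj_flip U)"
proof -
  interpret inner_boundary u U by fact
  have "cnj_flip U = (\<lambda>z. cnj (U (cnj z)))" by (simp add: cnj_flip_def flip_def fun_eq_iff)
  thus ?thesis
    unfolding inner_boundary_def
    using cnj_flip_Hinf[OF Hinf] radial_boundary_cnj_flip[OF radial] AE_circle_cnj[OF unimodular] by simp
qed

lemma cnj_flip_times_H2:
  assumes "inner_boundary u U" "f \<in> times_H2 u"
  shows "cnj_flip f \<in> times_H2 (cnj_flip u)"
proof -
  interpret u: inner_boundary u U by fact
  interpret v: inner_boundary "cnj_flip u" "cnj_flip U" by (rule inner_boundary_cnj_flip) fact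
  have f: "f \<in> L2" "(\<lambda>z. cnj (U z) * f z) \<in> H2" using assms(2) u.mem_iff by auto
  have "cnj_flip (\<lambda>z. cnj (U z) * f z) = (\<lambda>z. cnj (cnj_flip U z) * cnj_flip f z)"
    by (simp add: cnj_flip_def flip_def fun_eq_iff)
  thus ?thesis using cnj_flip_H2[OF f(2)] cnj_flip_L2[OF f(1)] v.mem_iff by simp
qed

lemma Linf_mult_flip_L2:
  assumes "\<phi> \<in> Linf" "f \<in> L2"
  shows "(\<lambda>z. \<phi> z * flip f z) \<in> L2"
proof -
  obtain C where "\<phi> \<in> borel_measurable circle" "AE z in circle. norm (\<phi> z) \<le> C"
    using assms(1) unfolding Linf_def by blast
  thus ?thesis by (rule L2_bounded_mult[OF L2_flip[OF assms(2)]])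
qed

lemma Linf_L2: "\<phi> \<in> Linf \<Longrightarrow> \<phi> \<in> L2"
  using L2_bounded unfolding Linf_def by blast

lemma cnj_flip_Linf:
  assumes "\<phi> \<in> Linf"
  shows "cnj_flip \<phi> \<in> Linf"
proof -
  obtain C where C: "AE z in circle. norm (\<phi> z) \<le> C" using assms unfolding Linf_def by blast
  have "AE z in circle. norm (cnj_flip \<phi> z) \<le> C"
    using AE_circle_cnj[OF C] by (simp add: cnj_flip_def flip_def)
  moreover have "cnj_flip \<phi> \<in> borel_measurable circle"
    by (intro L2_measurable cnj_flip_L2 Linf_L2 assms)
  ultimately show ?thesis unfolding Linf_def by blast
qed

lemma hankel_in_H2: "\<phi> \<in> Linf \<Longrightarrow> f \<in> H2 \<Longrightarrow> hankel \<phi> f \<in> H2"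
  unfolding hankel_def by (intro P_plus_in_H2 Linf_mult_flip_L2 H2_L2)

text \<open>
  Substituting the conjugate of \<open>z\<close> for \<open>z\<close> moves \<open>flip\<close> from one factor of the inner product to the other.
\<close>

lemma hankel_adjoint_identity:
  assumes \<phi>: "\<phi> \<in> Linf" and f: "f \<in> H2" and g: "g \<in> H2"
  shows "l2_inner (hankel \<phi> f) g = l2_inner f (hankel (cnj_flip \<phi>) g)"
proof -
  have [measurable]: "\<phi> \<in> borel_measurable circle" "f \<in> borel_measurable circle" "g \<in> borel_measurable circle"
    by (intro L2_measurable Linf_L2 \<phi> H2_L2 f g)+
  have "l2_inner (hankel \<phi> f) g = l2_inner (\<lambda>z. \<phi> z * flip f z) g"
    unfolding hankel_def by (rule l2_inner_P_plus[OF Linf_mult_flip_L2[OF \<phi> H2_L2[OF f]] g])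
  also have "\<dots> = (LINT z|circle. \<phi> (cnj z) * f z * cnj (g (cnj z)))"
    using integral_circle_cnj[of "\<lambda>z. \<phi> (cnj z) * f z * cnj (g (cnj z))"]
    by (simp add: l2_inner_def flip_def)
  also have "\<dots> = l2_inner f (\<lambda>z. cnj_flip \<phi> z * flip g z)"
    by (simp add: l2_inner_def flip_def cnj_flip_def mult_ac)
  also have "\<dots> = cnj (l2_inner (\<lambda>z. cnj_flip \<phi> z * flip g z) f)" by (rule l2_inner_commute)
  also have "\<dots> = cnj (l2_inner (hankel (cnj_flip \<phi>) g) f)"
    unfolding hankel_def
    by (simp only: l2_inner_P_plus[OF Linf_mult_flip_L2[OF cnj_flip_Linf[OF \<phi>] H2_L2[OF g]] f])
  also have "\<dots> = l2_inner f (hankel (cnj_flip \<phi>) g)" by (rule l2_inner_commute[symmetric])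
  finally show ?thesis .
qed

lemma H2_adjoint_hankel:
  assumes \<phi>: "\<phi> \<in> Linf" and g: "g \<in> H2"
  shows "H2_adjoint (hankel \<phi>) g \<in> H2"
    and "AE z in circle. H2_adjoint (hankel \<phi>) g z = hankel (cnj_flip \<phi>) g z"
proof -
  let ?k = "H2_adjoint (hankel \<phi>) g" and ?k' = "hankel (cnj_flip \<phi>) g"
  have k': "?k' \<in> H2" by (rule hankel_in_H2[OF cnj_flip_Linf[OF \<phi>] g])
  have "\<exists>k. k \<in> H2 \<and> (\<forall>f\<in>H2. l2_inner (hankel \<phi> f) g = l2_inner f k)"
    using k' hankel_adjoint_identity[OF \<phi> _ g] by blast
  from someI_ex[OF this] have k: "?k \<in> H2" "\<And>f. f \<in> H2 \<Longrightarrow> l2_inner (hankel \<phi> f) g = l2_inner f ?k"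
    unfolding H2_adjoint_def by blast+
  show "?k \<in> H2" by (rule k(1))
  have d: "(\<lambda>z. ?k z - ?k' z) \<in> H2" by (rule closed_subspace_diff[OF closed_subspace_H2 k(1) k'])
  have "l2_inner (\<lambda>z. ?k z - ?k' z) (\<lambda>z. ?k z - ?k' z) =
      l2_inner (\<lambda>z. ?k z - ?k' z) ?k - l2_inner (\<lambda>z. ?k z - ?k' z) ?k'"
    by (intro l2_inner_diff_right H2_L2 k(1) k' d)
  also have "\<dots> = 0"
    using k(2)[OF d] hankel_adjoint_identity[OF \<phi> d g] by simp
  finally have "l2_norm (\<lambda>z. ?k z - ?k' z) = 0" unfolding l2_inner_self by simp
  thus "AE z in circle. ?k z = ?k' z" using l2_norm_eq_0D[OF H2_L2[OF d]] by simp
qed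

lemma fourier_coeff_hankel_argument:
  "fourier_coeff (\<lambda>z. \<phi> z * flip f z) n = l2_inner \<phi> (\<lambda>z. z powi n * cnj_flip f z)"
  by (simp add: fourier_coeff_def l2_inner_def cnj_flip_def mult_ac)

lemma hankel_eq_0_iff:
  assumes "\<phi> \<in> Linf" "f \<in> H2"
  shows "(AE z in circle. hankel \<phi> f z = 0) \<longleftrightarrow>
     (\<forall>n\<ge>0. l2_inner \<phi> (\<lambda>z. z powi n * cnj_flip f z) = 0)"
  unfolding hankel_def
  by (subst P_plus_eq_0_iff) (simp_all only: Linf_mult_flip_L2 assms H2_L2 fourier_coeff_hankel_argument)

text \<open>
  The map \<open>cnj_flip\<close> carries the range of \<open>u\<close> onto that of \<open>cnj_flip u\<close>. The latter is invariant under
  multiplication by \<open>z\<close>, so the conditions on all coefficients \<open>n \<ge> 0\<close> reduce to the one for \<open>n = 0\<close>.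
\<close>

theorem hankel_kernel_iff_perp:
  assumes u: "inner_boundary u U" and \<phi>: "\<phi> \<in> Linf"
  shows "(\<forall>f\<in>times_H2 u. AE z in circle. hankel \<phi> f z = 0) \<longleftrightarrow>
         (\<forall>k\<in>times_H2 (cnj_flip u). l2_inner \<phi> k = 0)"
proof -
  interpret u: inner_boundary u U by fact
  interpret v: inner_boundary "cnj_flip u" "cnj_flip U" by (rule inner_boundary_cnj_flip) fact
  show ?thesis
  proof (intro iffI ballI)
    fix k assume *: "\<forall>f\<in>times_H2 u. AE z in circle. hankel \<phi> f z = 0" and k: "k \<in> times_H2 (cnj_flip u)"
    have f: "cnj_flip k \<in> times_H2 u" using cnj_flip_times_H2[OF v.inner_boundary_axioms k] by simp
    hence "cnj_flip k \<in> H2" using u.subset_H2 by blast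
    from hankel_eq_0_iff[OF \<phi> this] * f
    have "l2_inner \<phi> (\<lambda>z. z powi 0 * cnj_flip (cnj_flip k) z) = 0" by blast
    thus "l2_inner \<phi> k = 0" by simp
  next
    fix f assume *: "\<forall>k\<in>times_H2 (cnj_flip u). l2_inner \<phi> k = 0" and f: "f \<in> times_H2 u"
    have "f \<in> H2" using f u.subset_H2 by blast
    from hankel_eq_0_iff[OF \<phi> this] * v.powi_mult_mem[OF cnj_flip_times_H2[OF u f]]
    show "AE z in circle. hankel \<phi> f z = 0" by blast
  qed
qed

text \<open>
  If \<open>c \<noteq> 0\<close>, then the conjugate of \<open>U\<close> lies in \<open>H\<^sup>2\<close> together with \<open>U\<close>, so that only the zeroth Fourier
  coefficient of \<open>U\<close> survives.
\<close>

lemma const_in_times_H2: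
  assumes "inner_boundary u U" and nc: "\<not> u constant_on ball 0 1" and mem: "(\<lambda>z. c) \<in> times_H2 u"
  shows "c = 0"
proof (rule ccontr)
  assume c: "c \<noteq> 0"
  interpret u: inner_boundary u U by fact
  have UL: "U \<in> L2" by (rule H2_L2[OF boundary_in_H2[OF u.Hinf u.radial]])
  have H: "(\<lambda>z. cnj (U z) * c) \<in> H2" using mem u.mem_iff[of "\<lambda>z. c"] by simp
  have pos: "fourier_coeff U n = 0" if "n > 0" for n
  proof -
    have "fourier_coeff (\<lambda>z. cnj (U z) * c) (- n) = c * cnj (fourier_coeff U n)"
    proof -
      have "fourier_coeff (\<lambda>z. cnj (U z) * c) (- n) = c * (LINT z|circle. cnj (U z) * z powi n)"
        by (subst integral_mult_right_zero[symmetric]) (simp add: fourier_coeff_conv_integral mult_ac)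
      also have "(LINT z|circle. cnj (U z) * z powi n) = (LINT z|circle. cnj (U z * z powi (- n)))"
      proof (rule Bochner_Integration.integral_cong)
        fix z assume "z \<in> space circle"
        thus "cnj (U z) * z powi n = cnj (U z * z powi (- n))"
          using cnj_powi_circle[of z "- n"] by (simp only: complex_cnj_mult space_circle minus_minus)
      qed simp
      also have "\<dots> = cnj (fourier_coeff U n)"
        unfolding fourier_coeff_conv_integral by (rule Bochner_Integration.integral_cnj)
      finally show ?thesis .
    qed
    moreover have "fourier_coeff (\<lambda>z. cnj (U z) * c) (- n) = 0" using H that by (simp add: H2_def)
    ultimately show ?thesis using c by simp
  qed
  have "u w = fourier_coeff U 0" if w: "norm w < 1" for w
  proof -
    have "(\<lambda>n. fourier_coeff U (int n) * w ^ n) = (\<lambda>n. if n = 0 then fourier_coeff U (int n) * w ^ n else 0)"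
      using pos by (auto simp: fun_eq_iff)
    hence "u w = fourier_coeff U (int 0) * w ^ 0"
      using boundary_power_series[OF u.Hinf u.radial w] sums_unique2[OF _ sums_single] by metis
    thus ?thesis by simp
  qed
  hence "u constant_on ball 0 1" unfolding constant_on_def by auto
  with nc show False by contradiction
qed

text \<open>
  The function \<open>G n\<close> below has the coefficients of \<open>G 0\<close> moved down by \<open>n\<close> places. So \<open>G n - z G (n + 1)\<close>
  is a constant function in the range of \<open>u\<close>, and the constant is the \<open>n\<close>-th coefficient of \<open>hankel \<phi> f\<close>.
\<close>

theorem hankel_invariant_imp_kernel:
  assumes "inner_boundary u U" and nc: "\<not> u constant_on ball 0 1" and \<phi>: "\<phi> \<in> Linf"
    and inv: "\<And>f. f \<in> times_H2 u \<Longrightarrow> hankel \<phi> f \<in> times_H2 u" and f: "f \<in> times_H2 u"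
  shows "AE z in circle. hankel \<phi> f z = 0"
proof -
  interpret u: inner_boundary u U by fact
  have fH: "f \<in> H2" using f u.subset_H2 by blast
  define G where "G n = hankel \<phi> (\<lambda>z. z powi int n * f z)" for n
  define c where "c n = l2_inner \<phi> (\<lambda>z. z powi n * cnj_flip f z)" for n
  have GM: "G n \<in> times_H2 u" for n
    unfolding G_def by (rule inv[OF u.powi_mult_mem[OF f]]) simp
  hence GL: "G n \<in> L2" for n using u.subset_H2 H2_L2 by blast
  have Gc: "fourier_coeff (G n) k = (if k \<ge> 0 then c (k + int n) else 0)" for n k
  proof -
    have "(\<lambda>z. z powi int n * f z) \<in> L2" by (rule powi_mult_L2[OF H2_L2[OF fH]])
    note L = Linf_mult_flip_L2[OF \<phi> this]
    have "l2_inner \<phi> (\<lambda>z. z powi k * cnj_flip (\<lambda>z. z powi int n * f z) z) = c (k + int n)"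
      unfolding c_def l2_inner_def
    proof (rule Bochner_Integration.integral_cong)
      fix z assume "z \<in> space circle"
      hence "z powi k * z powi int n = z powi (k + int n)" using powi_mult_circle[of z k "int n"] by (simp only: space_circle)
      hence "z powi k * cnj_flip (\<lambda>z. z powi int n * f z) z = z powi (k + int n) * cnj_flip f z"
        unfolding cnj_flip_def flip_def complex_cnj_mult complex_cnj_power_int complex_cnj_cnj by (metis mult.assoc)
      thus "\<phi> z * cnj (z powi k * cnj_flip (\<lambda>z. z powi int n * f z) z) =
            \<phi> z * cnj (z powi (k + int n) * cnj_flip f z)" by simp
    qed simp
    thus ?thesis
      unfolding G_def hankel_def fourier_coeff_P_plus[OF L] fourier_coeff_hankel_argument by simp
  qed
  have "c (int n) = 0" for n
  proof -
    let ?d = "\<lambda>z. G n z - z powi 1 * G (Suc n) z"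
    have dM: "?d \<in> times_H2 u"
      by (rule closed_subspace_diff[OF u.closed GM u.powi_mult_mem[OF GM]]) simp
    have L1: "(\<lambda>z. z powi 1 * G (Suc n) z) \<in> L2" by (rule powi_mult_L2[OF GL])
    have dL: "?d \<in> L2" by (rule L2_diff[OF GL L1])
    have const: "fourier_coeff (\<lambda>z. c (int n)) k = (if k = 0 then c (int n) else 0)" for k
      using fourier_coeff_cmult[of "c (int n)" "\<lambda>z. z powi 0" k] by (simp only: fourier_coeff_powi) auto
    have "AE z in circle. ?d z - c (int n) = 0"
    proof (rule L2_fourier_uniqueness[OF L2_diff[OF dL L2_const]])
      fix k
      have "fourier_coeff (\<lambda>z. ?d z - c (int n)) k =
          fourier_coeff (G n) k - fourier_coeff (\<lambda>z. z powi 1 * G (Suc n) z) k - fourier_coeff (\<lambda>z. c (int n)) k"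
        by (simp only: fourier_coeff_diff[OF dL L2_const] fourier_coeff_diff[OF GL L1])
      also have "\<dots> = 0"
        unfolding fourier_coeff_powi_mult Gc const by (cases "k = 0") (auto simp: algebra_simps)
      finally show "fourier_coeff (\<lambda>z. ?d z - c (int n)) k = 0" .
    qed
    hence "AE z in circle. c (int n) = ?d z" by (rule eventually_mono) simp
    hence "(\<lambda>z. c (int n)) \<in> times_H2 u"
      by (rule closed_subspace_AE[OF u.closed dM, rotated]) simp
    thus ?thesis by (rule const_in_times_H2[OF assms(1) nc])
  qed
  hence "c n = 0" if "n \<ge> 0" for n using that by (metis nonneg_int_cases)
  thus ?thesis unfolding hankel_eq_0_iff[OF \<phi> fH] c_def by blast
qed

text \<open>
  The adjoint is given only up to almost everywhere equality, hence the detour through \<open>adj_zero\<close> and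
  closure of the range under such equality.
\<close>

theorem corollary3p2:
  fixes u \<phi> :: "complex \<Rightarrow> complex"
  assumes "inner_function u"
    and "\<not> u constant_on ball 0 1"
    and "\<phi> \<in> Linf"
  shows "(reduces (times_H2 u) (hankel \<phi>) \<longleftrightarrow>
            times_H2 u \<subseteq> H2_ker (hankel \<phi>) \<inter> H2_ker (H2_adjoint (hankel \<phi>))) \<and>
         (times_H2 u \<subseteq> H2_ker (hankel \<phi>) \<inter> H2_ker (H2_adjoint (hankel \<phi>)) \<longleftrightarrow>
            P_plus \<phi> \<in> H2_perp (times_H2 (inner_gcd u (cnj_flip u))))"
proof -
  obtain U where U: "inner_boundary u U" by (rule inner_function_obtains_boundary[OF assms(1)])
  interpret u: inner_boundary u U by fact
  interpret v: inner_boundary "cnj_flip u" "cnj_flip U" by (rule inner_boundary_cnj_flip[OF U])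
  let ?T = "hankel \<phi>" and ?\<psi> = "cnj_flip \<phi>"
  note \<phi> = assms(3) and \<psi> = cnj_flip_Linf[OF assms(3)]
  have inH2: "f \<in> H2" if "f \<in> times_H2 u" for f using that u.subset_H2 by blast
  note adj = H2_adjoint_hankel[OF \<phi> inH2]
  have adj_meas: "H2_adjoint ?T f \<in> borel_measurable circle" if "f \<in> times_H2 u" for f
    by (rule L2_measurable[OF H2_L2[OF adj(1)[OF that]]])
  have hankel_meas: "hankel \<eta> f \<in> borel_measurable circle" if "\<eta> \<in> Linf" "f \<in> times_H2 u" for \<eta> f
    by (rule L2_measurable[OF H2_L2[OF hankel_in_H2[OF that(1) inH2[OF that(2)]]]])
  have adj_zero: "(AE z in circle. H2_adjoint ?T f z = 0) \<longleftrightarrow> (AE z in circle. hankel ?\<psi> f z = 0)"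
    if f: "f \<in> times_H2 u" for f
    by (rule eventually_subst) (use adj(2)[OF f] in \<open>auto elim: eventually_mono\<close>)
  have two: "times_H2 u \<subseteq> H2_ker ?T \<inter> H2_ker (H2_adjoint ?T) \<longleftrightarrow>
      (\<forall>f\<in>times_H2 u. AE z in circle. hankel \<phi> f z = 0) \<and> (\<forall>f\<in>times_H2 u. AE z in circle. hankel ?\<psi> f z = 0)"
    using adj_zero inH2 unfolding H2_ker_def by blast
  have null_mem: "f \<in> times_H2 u" if "f \<in> borel_measurable circle" "AE z in circle. f z = 0" for f
    using closed_subspace_AE[OF u.closed closed_subspaceD(2)[OF u.closed] that] .
  have one_two: "reduces (times_H2 u) ?T \<longleftrightarrow> times_H2 u \<subseteq> H2_ker ?T \<inter> H2_ker (H2_adjoint ?T)"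
    unfolding two
  proof
    assume red: "reduces (times_H2 u) ?T"
    have "hankel ?\<psi> f \<in> times_H2 u" if f: "f \<in> times_H2 u" for f
    proof (rule closed_subspace_AE[OF u.closed _ hankel_meas[OF \<psi> f]])
      show "H2_adjoint ?T f \<in> times_H2 u" using red f by (simp add: reduces_def)
      show "AE z in circle. hankel ?\<psi> f z = H2_adjoint ?T f z"
        using adj(2)[OF f] by (auto elim: eventually_mono)
    qed
    thus "(\<forall>f\<in>times_H2 u. AE z in circle. hankel \<phi> f z = 0) \<and> (\<forall>f\<in>times_H2 u. AE z in circle. hankel ?\<psi> f z = 0)"
      using hankel_invariant_imp_kernel[OF U assms(2) \<phi>] hankel_invariant_imp_kernel[OF U assms(2) \<psi>] red
      by (simp add: reduces_def)
  next
    assume "(\<forall>f\<in>times_H2 u. AE z in circle. hankel \<phi> f z = 0) \<and> (\<forall>f\<in>times_H2 u. AE z in circle. hankel ?\<psi> f z = 0)"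
    thus "reduces (times_H2 u) ?T"
      unfolding reduces_def
      using u.closed u.subset_H2 null_mem hankel_meas[OF \<phi>] adj_meas adj_zero by blast
  qed
  have "(\<forall>f\<in>times_H2 u. AE z in circle. hankel \<phi> f z = 0) \<longleftrightarrow> P_plus \<phi> \<in> H2_perp (times_H2 (cnj_flip u))"
    unfolding hankel_kernel_iff_perp[OF U \<phi>] P_plus_in_H2_perp_iff[OF Linf_L2[OF \<phi>] v.subset_H2] ..
  moreover have "(\<forall>f\<in>times_H2 u. AE z in circle. hankel ?\<psi> f z = 0) \<longleftrightarrow> P_plus \<phi> \<in> H2_perp (times_H2 u)"
  proof -
    have "l2_inner ?\<psi> k = cnj (l2_inner \<phi> (cnj_flip k))" if "k \<in> times_H2 (cnj_flip u)" for k
    proof -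
      have "k \<in> L2" using that v.subset_H2 H2_L2 by blast
      thus ?thesis using l2_inner_cnj_flip[OF Linf_L2[OF \<phi>] cnj_flip_L2] by simp
    qed
    hence "(\<forall>k\<in>times_H2 (cnj_flip u). l2_inner ?\<psi> k = 0) \<longleftrightarrow> (\<forall>k\<in>times_H2 (cnj_flip u). l2_inner \<phi> (cnj_flip k) = 0)"
      by simp
    also have "\<dots> \<longleftrightarrow> (\<forall>k\<in>times_H2 u. l2_inner \<phi> k = 0)"
      using cnj_flip_times_H2[OF U] cnj_flip_times_H2[OF v.inner_boundary_axioms] by (metis cnj_flip_cnj_flip)
    also have "\<dots> \<longleftrightarrow> P_plus \<phi> \<in> H2_perp (times_H2 u)"
      unfolding P_plus_in_H2_perp_iff[OF Linf_L2[OF \<phi>] u.subset_H2] ..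
    finally show ?thesis unfolding hankel_kernel_iff_perp[OF U \<psi>] .
  qed
  ultimately have "times_H2 u \<subseteq> H2_ker ?T \<inter> H2_ker (H2_adjoint ?T) \<longleftrightarrow>
      P_plus \<phi> \<in> H2_perp (times_H2 (inner_gcd u (cnj_flip u)))"
    unfolding two H2_perp_inner_gcd[OF u.inner v.inner] by blast
  with one_two show ?thesis by blast
qed

end
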